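(* Let $(W,S)$ be an irreducible affine Weyl group and $L$ a weight function on $W$ with $L(w)>0$ for all $w\ne 1$. Let $x,y\in W$ and write $$T_xT_y=\sum_{z\in W}f_{x,y,z}T_z,\qquad f_{x,y,z}\in\mathbb Z[v,v^{-1}].$$ Then, for every $z\in W$, the degree of $f_{x,y,z}$ in $v$ is at most $c_{x,y}$.
   Context: Geometric realization. Let $V$ be a Euclidean space of finite dimension $r\ge 1$, $\Phi\subset V$ an irreducible root system of rank $r$, $\check\Phi\subset V^*$ the dual root system, $\check\alpha$ the coroot of $\alpha\in\Phi$, $\langle x,y\rangle$ the value of $y\in V^*$ at $x\in V$, $\Phi^+\subset\Phi$ a fixed set of positive roots, $W_0$ the Weyl group of $\Phi$. For $\alpha\in\Phi^+$, $n\in\mathbb Z$ let $H_{\alpha,n}=\{x\in V\mid\langle x,\check\alpha\rangle=n\}$, and let $\mathcal F$ be the set of all $H_{\alpha,n}$. Let $\Omega$ be the group generated by the orthogonal reflections $\sigma_H$ in $H\in\mathcal F$, acting on $V$ on the right. Alcoves are the connected components of $V-\bigcup_{H\in\mathcal F}H$; $X$ is the set of alcoves. Let $S$ be the set of $\Omega$-orbits in the set of faces (codimension 1 facets) of alcoves; a face in the orbit $s\in S$ is of type $s$. For $s\in S$, $A\in X$, let $sA$ be the unique alcove distinct from $A$ sharing with $A$ a face of type $s$. These involutions generate a Coxeter group $(W,S)$, the irreducible affine Weyl group associated with $W_0$; it acts on the left on $X$, simply transitively and commuting with $\Omega$. $\ell$ is the length function, $<$ the Bruhat order. $A_0=\{x\in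 V\mid 0<\langle x,\check\alpha\rangle<1\ \forall\alpha\in\Phi^+\}$ is the fundamental alcove. Weights. A weight function is $L:W\to\mathbb Z$ with $L(ww')=L(w)+L(w')$ whenever $\ell(ww')=\ell(w)+\ell(w')$. If $H\in\mathcal F$ supports a face of type $s$, put $c_H=L(s)$ (well defined). View $W_0$ as the parabolic subgroup of $W$ stabilizing the set of alcoves containing $0$ in their closure. If $W$ is of type $\tilde C_r$ ($r\ge 2$; linear diagram with nodes $s_1,\dots,s_{r+1}$ and double bonds at both ends) with $W_0=\langle s_1,\dots,s_r\rangle$, or of type $\tilde A_1$ ($r=1$, generators $s_1,s_2$) with $W_0=\langle s_1\rangle$, the labelling is chosen, as one may by symmetry of the diagram, so that $L(s_1)\ge L(s_{r+1})$. Hecke algebra. $\mathcal H$ is the Iwahori–Hecke algebra over $\mathbb Z[v,v^{-1}]$ with basis $\{T_w\}_{w\in W}$ and $T_sT_w=T_{sw}$ if $sw>w$, $T_sT_w=T_{sw}+(v^{L(s)}-v^{-L(s)})T_w$ if $sw<w$ ($s\in S$, $w\in W$). The degree in $v$ of a Laurent polynomial is the highest power of $v$ occurring. The bound. For alcoves $A,B$ let $H(A,B)=\{H\in\mathcal F\mid H\text{ separates }A\text{ and }B\}$. Let $\overline{\mathcal F}$ be the set of directions (parallelism classes) of hyperplanes in $\mathcal F$ and $\overline H$ the direction of $H$. For $x,y\in W$: $$H_{x,y}=H(A_0,yA_0)\cap H(yA_0,xyA_0),\qquad I_{x,y}=\{i\in\overline{\mathcal F}\mid\exists H\in H_{x,y},\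 \overline H=i\},$$ $$c_{x,y}(i)=\max_{H\in H_{x,y},\ \overline H=i}c_H\ \ (i\in I_{x,y}),\qquad c_{x,y}=\sum_{i\in I_{x,y}}c_{x,y}(i).$$ *)

theory Defs
  imports "HOL-Analysis.Analysis" "HOL-Library.Poly_Mapping"
    "HOL-Algebra.Bij" "HOL-Algebra.Generated_Groups" "HOL-Algebra.Multiplicative_Group"
begin

section \<open>Root systems\<close>

text \<open>The coroot of \<open>\<alpha>\<close> as a linear functional, so that \<open>coroot \<alpha> x\<close> is the value
  \<open>\<langle>x, \<alpha>\<^sup>\<or>\<rangle>\<close>.  The space \<open>V\<close> is the type \<open>'a::euclidean_space\<close>; its dimension \<open>r \<ge> 1\<close> is
  \<open>DIM('a)\<close>.\<close>

definition coroot :: "'a::euclidean_space \<Rightarrow> 'a \<Rightarrow> real" where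
  "coroot \<alpha> x = 2 * (x \<bullet> \<alpha>) / (\<alpha> \<bullet> \<alpha>)"

text \<open>Root systems in the sense of Bourbaki: reducedness is not part of the definition.\<close>

definition root_system :: "'a::euclidean_space set \<Rightarrow> bool" where
  "root_system \<Phi> \<longleftrightarrow>
     finite \<Phi> \<and> 0 \<notin> \<Phi> \<and> span \<Phi> = UNIV \<and>
     (\<forall>\<alpha>\<in>\<Phi>. \<forall>\<beta>\<in>\<Phi>. \<beta> - coroot \<alpha> \<beta> *\<^sub>R \<alpha> \<in> \<Phi>) \<and>
     (\<forall>\<alpha>\<in>\<Phi>. \<forall>\<beta>\<in>\<Phi>. coroot \<alpha> \<beta> \<in> \<int>)"

definition irreducible_root_system :: "'a::euclidean_space set \<Rightarrow> bool" where
  "irreducible_root_system \<Phi> \<longleftrightarrow>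
     root_system \<Phi> \<and>
     \<not> (\<exists>\<Phi>\<^sub>1 \<Phi>\<^sub>2. \<Phi>\<^sub>1 \<noteq> {} \<and> \<Phi>\<^sub>2 \<noteq> {} \<and> \<Phi> = \<Phi>\<^sub>1 \<union> \<Phi>\<^sub>2 \<and> (\<forall>\<alpha>\<in>\<Phi>\<^sub>1. \<forall>\<beta>\<in>\<Phi>\<^sub>2. \<alpha> \<bullet> \<beta> = 0))"

definition positive_roots :: "'a::euclidean_space set \<Rightarrow> 'a set \<Rightarrow> bool" where
  "positive_roots \<Phi> P \<longleftrightarrow>
     (\<exists>\<gamma>. (\<forall>\<alpha>\<in>\<Phi>. \<gamma> \<bullet> \<alpha> \<noteq> 0) \<and> P = {\<alpha>\<in>\<Phi>. \<gamma> \<bullet> \<alpha> > 0})"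

section \<open>Hyperplanes, alcoves and faces\<close>

text \<open>From here on \<open>P\<close> is the set of positive roots.\<close>

definition hyperplane :: "'a::euclidean_space \<Rightarrow> int \<Rightarrow> 'a set" where
  "hyperplane \<alpha> n = {x. coroot \<alpha> x = of_int n}"

definition hyperplanes :: "'a::euclidean_space set \<Rightarrow> 'a set set" where
  "hyperplanes P = {hyperplane \<alpha> n | \<alpha> n. \<alpha> \<in> P}"

text \<open>The orthogonal reflection in \<open>H\<close>: \<open>closest_point H\<close> is the orthogonal projection onto \<open>H\<close>.\<close>

definition reflection :: "'a::euclidean_space set \<Rightarrow> 'a \<Rightarrow> 'a" where
  "reflection H x = 2 *\<^sub>R closest_point H x - x"

text \<open>The group \<open>\<Omega>\<close> enters only through its orbits on faces, so that writing it on the left instead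
  of the right makes no difference.\<close>

definition Omega :: "'a::euclidean_space set \<Rightarrow> ('a \<Rightarrow> 'a) set" where
  "Omega P = generate (BijGroup UNIV) (reflection ` hyperplanes P)"

definition alcoves :: "'a::euclidean_space set \<Rightarrow> 'a set set" where
  "alcoves P = components (- \<Union> (hyperplanes P))"

definition fundamental_alcove :: "'a::euclidean_space set \<Rightarrow> 'a set" where
  "fundamental_alcove P = {x. \<forall>\<alpha>\<in>P. 0 < coroot \<alpha> x \<and> coroot \<alpha> x < 1}"

text \<open>Faces are taken closed.\<close>

definition faces :: "'a::euclidean_space set \<Rightarrow> 'a set set" where
  "faces P = {F. \<exists>A\<in>alcoves P. F facet_of closure A}"

definition face_types :: "'a::euclidean_space set \<Rightarrow> 'a set set set" where
  "face_types P = {{\<omega> ` F | \<omega>. \<omega> \<in> Omega P} | F. F \<in> faces P}"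

section \<open>The affine Weyl group\<close>

text \<open>The involution \<open>A \<mapsto> sA\<close> of the set of alcoves defined by a type \<open>s\<close> of faces.\<close>

definition type_invol :: "'a::euclidean_space set \<Rightarrow> 'a set set \<Rightarrow> 'a set \<Rightarrow> 'a set" where
  "type_invol P s =
     (\<lambda>A\<in>alcoves P. THE B. B \<in> alcoves P \<and> B \<noteq> A \<and>
        (\<exists>F\<in>s. F facet_of closure A \<and> F facet_of closure B))"

definition simple_gens :: "'a::euclidean_space set \<Rightarrow> ('a set \<Rightarrow> 'a set) set" where
  "simple_gens P = type_invol P ` face_types P"

text \<open>\<open>W\<close> as a group of permutations of the set of alcoves.  The multiplication is composition
  of functions, so \<open>W\<close> acts on the left, and \<open>wA\<close> is the application \<open>w A\<close>.\<close>

definition affine_weyl :: "'a::euclidean_space set \<Rightarrow> ('a set \<Rightarrow> 'a set) monoid" where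
  "affine_weyl P = (BijGroup (alcoves P))
     \<lparr>carrier := generate (BijGroup (alcoves P)) (simple_gens P)\<rparr>"

definition word_prod :: "'a::euclidean_space set \<Rightarrow> ('a set \<Rightarrow> 'a set) list \<Rightarrow> 'a set \<Rightarrow> 'a set" where
  "word_prod P ss = foldr (\<lambda>s w. s \<otimes>\<^bsub>affine_weyl P\<^esub> w) ss \<one>\<^bsub>affine_weyl P\<^esub>"

definition weyl_length :: "'a::euclidean_space set \<Rightarrow> ('a set \<Rightarrow> 'a set) \<Rightarrow> nat" where
  "weyl_length P w =
     (LEAST n. \<exists>ss. set ss \<subseteq> simple_gens P \<and> length ss = n \<and> word_prod P ss = w)"

definition weyl_reflections :: "'a::euclidean_space set \<Rightarrow> ('a set \<Rightarrow> 'a set) set" where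
  "weyl_reflections P =
     {w \<otimes>\<^bsub>affine_weyl P\<^esub> s \<otimes>\<^bsub>affine_weyl P\<^esub> inv\<^bsub>affine_weyl P\<^esub> w | w s.
        w \<in> carrier (affine_weyl P) \<and> s \<in> simple_gens P}"

definition bruhat_less ::
    "'a::euclidean_space set \<Rightarrow> ('a set \<Rightarrow> 'a set) \<Rightarrow> ('a set \<Rightarrow> 'a set) \<Rightarrow> bool" where
  "bruhat_less P =
     (\<lambda>u w. u \<in> carrier (affine_weyl P) \<and>
        (\<exists>t\<in>weyl_reflections P. w = t \<otimes>\<^bsub>affine_weyl P\<^esub> u) \<and>
        weyl_length P u < weyl_length P w)\<^sup>+\<^sup>+"

text \<open>\<open>W\<^sub>0\<close>, as the stabilizer of the set of alcoves with \<open>0\<close> in their closure.\<close>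

definition finite_weyl :: "'a::euclidean_space set \<Rightarrow> ('a set \<Rightarrow> 'a set) set" where
  "finite_weyl P =
     {w \<in> carrier (affine_weyl P).
        w ` {A\<in>alcoves P. 0 \<in> closure A} = {A\<in>alcoves P. 0 \<in> closure A}}"

section \<open>Weight functions\<close>

definition weight_function ::
    "'a::euclidean_space set \<Rightarrow> (('a set \<Rightarrow> 'a set) \<Rightarrow> int) \<Rightarrow> bool" where
  "weight_function P L \<longleftrightarrow>
     (\<forall>w\<in>carrier (affine_weyl P). \<forall>w'\<in>carrier (affine_weyl P).
        weyl_length P (w \<otimes>\<^bsub>affine_weyl P\<^esub> w') = weyl_length P w + weyl_length P w' \<longrightarrow>
        L (w \<otimes>\<^bsub>affine_weyl P\<^esub> w') = L w + L w')"

text \<open>\<open>g\<close> numbers the Coxeter generators \<open>g 1, \<dots>, g (r + 1)\<close> along the diagram of type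
  \<open>\<tilde>C\<^sub>r\<close> (\<open>r \<ge> 2\<close>) resp. \<open>\<tilde>A\<^sub>1\<close> (\<open>r = 1\<close>).  Recall that \<open>ord\<close> is \<open>0\<close> for
  elements of infinite order.\<close>

definition type_C_labelling ::
    "'a::euclidean_space set \<Rightarrow> (nat \<Rightarrow> 'a set \<Rightarrow> 'a set) \<Rightarrow> bool" where
  "type_C_labelling P g \<longleftrightarrow>
     DIM('a) \<ge> 2 \<and> bij_betw g {1..DIM('a) + 1} (simple_gens P) \<and>
     (\<forall>i\<in>{1..DIM('a) + 1}. \<forall>j\<in>{1..DIM('a) + 1}. i < j \<longrightarrow>
        group.ord (affine_weyl P) (g i \<otimes>\<^bsub>affine_weyl P\<^esub> g j) =
          (if j = i + 1 then (if i = 1 \<or> i = DIM('a) then 4 else 3) else 2))"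

definition type_A1_labelling ::
    "'a::euclidean_space set \<Rightarrow> (nat \<Rightarrow> 'a set \<Rightarrow> 'a set) \<Rightarrow> bool" where
  "type_A1_labelling P g \<longleftrightarrow>
     DIM('a) = 1 \<and> bij_betw g {1..2} (simple_gens P) \<and>
     group.ord (affine_weyl P) (g 1 \<otimes>\<^bsub>affine_weyl P\<^esub> g 2) = 0"

text \<open>The normalization \<open>L(s\<^sub>1) \<ge> L(s\<^sub>r\<^sub>+\<^sub>1)\<close>; it is vacuous for the other types.\<close>

definition normalized_weight ::
    "'a::euclidean_space set \<Rightarrow> (('a set \<Rightarrow> 'a set) \<Rightarrow> int) \<Rightarrow> bool" where
  "normalized_weight P L \<longleftrightarrow>
     (\<forall>g. (type_C_labelling P g \<or> type_A1_labelling P g) \<and>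
          finite_weyl P = generate (affine_weyl P) (g ` {1..DIM('a)}) \<longrightarrow>
          L (g 1) \<ge> L (g (DIM('a) + 1)))"

definition hyp_weight ::
    "'a::euclidean_space set \<Rightarrow> (('a set \<Rightarrow> 'a set) \<Rightarrow> int) \<Rightarrow> 'a set \<Rightarrow> int" where
  "hyp_weight P L H =
     (THE c. \<exists>s\<in>face_types P. \<exists>F\<in>s. affine hull F = H \<and> c = L (type_invol P s))"

section \<open>The Hecke algebra\<close>

text \<open>\<open>\<int>[v, v\<^sup>-\<^sup>1]\<close> is the group ring of \<open>\<int>\<close> over \<open>\<int>\<close>, with convolution as its multiplication.\<close>

type_synonym laurent = "int \<Rightarrow>\<^sub>0 int"

definition v_power :: "int \<Rightarrow> laurent" where
  "v_power k = Poly_Mapping.single k 1"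

text \<open>Meaningful only for \<open>f \<noteq> 0\<close>.\<close>

definition laurent_degree :: "laurent \<Rightarrow> int" where
  "laurent_degree f = Max (Poly_Mapping.keys f)"

text \<open>The elements of the Hecke algebra lie in the free \<open>\<int>[v, v\<^sup>-\<^sup>1]\<close>-module on \<open>W\<close>.  As \<open>W\<close> is
  not a type, this is cut out by the support.\<close>

type_synonym 'a hecke = "('a set \<Rightarrow> 'a set) \<Rightarrow>\<^sub>0 laurent"

definition hecke_T :: "('a set \<Rightarrow> 'a set) \<Rightarrow> 'a hecke" where
  "hecke_T w = Poly_Mapping.single w 1"

definition hecke_scale :: "laurent \<Rightarrow> 'a hecke \<Rightarrow> 'a hecke" where
  "hecke_scale c h = Poly_Mapping.map (\<lambda>d. c * d) h"

definition hecke_ring ::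
    "'a::euclidean_space set \<Rightarrow> ('a hecke \<Rightarrow> 'a hecke \<Rightarrow> 'a hecke) \<Rightarrow> 'a hecke ring" where
  "hecke_ring P mul =
     \<lparr>carrier = {h. Poly_Mapping.keys h \<subseteq> carrier (affine_weyl P)}, monoid.mult = mul,
      one = hecke_T \<one>\<^bsub>affine_weyl P\<^esub>, zero = 0, add = (+)\<rparr>"

text \<open>\<open>mul\<close> is the multiplication of the Iwahori--Hecke algebra: it makes the free module on \<open>W\<close>
  an associative algebra with unit \<open>T\<^sub>1\<close> and satisfies the defining relations, which determine it
  uniquely on the carrier.\<close>

definition hecke_multiplication ::
    "'a::euclidean_space set \<Rightarrow> (('a set \<Rightarrow> 'a set) \<Rightarrow> int) \<Rightarrow>
     ('a hecke \<Rightarrow> 'a hecke \<Rightarrow> 'a hecke) \<Rightarrow> bool" where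
  "hecke_multiplication P L mul \<longleftrightarrow>
     ring (hecke_ring P mul) \<and>
     (\<forall>c. \<forall>a\<in>carrier (hecke_ring P mul). \<forall>b\<in>carrier (hecke_ring P mul).
        mul (hecke_scale c a) b = hecke_scale c (mul a b) \<and>
        mul a (hecke_scale c b) = hecke_scale c (mul a b)) \<and>
     (\<forall>s\<in>simple_gens P. \<forall>w\<in>carrier (affine_weyl P).
        (bruhat_less P w (s \<otimes>\<^bsub>affine_weyl P\<^esub> w) \<longrightarrow>
           mul (hecke_T s) (hecke_T w) = hecke_T (s \<otimes>\<^bsub>affine_weyl P\<^esub> w)) \<and>
        (bruhat_less P (s \<otimes>\<^bsub>affine_weyl P\<^esub> w) w \<longrightarrow>
           mul (hecke_T s) (hecke_T w) =
             hecke_T (s \<otimes>\<^bsub>affine_weyl P\<^esub> w)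
             + hecke_scale (v_power (L s) - v_power (- L s)) (hecke_T w)))"

text \<open>The coefficient \<open>f\<^sub>x\<^sub>,\<^sub>y\<^sub>,\<^sub>z\<close> of \<open>T\<^sub>z\<close> in \<open>T\<^sub>x T\<^sub>y\<close>.\<close>

definition hecke_coeff ::
    "('a hecke \<Rightarrow> 'a hecke \<Rightarrow> 'a hecke) \<Rightarrow> ('a set \<Rightarrow> 'a set) \<Rightarrow> ('a set \<Rightarrow> 'a set) \<Rightarrow>
     ('a set \<Rightarrow> 'a set) \<Rightarrow> laurent" where
  "hecke_coeff mul x y z = Poly_Mapping.lookup (mul (hecke_T x) (hecke_T y)) z"

section \<open>The bound\<close>

definition separates :: "'a::euclidean_space set \<Rightarrow> 'a set \<Rightarrow> 'a set \<Rightarrow> bool" where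
  "separates H A B \<longleftrightarrow>
     (\<exists>D\<in>components (- H). \<exists>E\<in>components (- H). D \<noteq> E \<and> A \<subseteq> D \<and> B \<subseteq> E)"

definition separating :: "'a::euclidean_space set \<Rightarrow> 'a set \<Rightarrow> 'a set \<Rightarrow> 'a set set" where
  "separating P A B = {H\<in>hyperplanes P. separates H A B}"

definition direction :: "'a::euclidean_space set \<Rightarrow> 'a set \<Rightarrow> 'a set set" where
  "direction P H = {H'\<in>hyperplanes P. affine_parallel H H'}"

definition directions :: "'a::euclidean_space set \<Rightarrow> 'a set set set" where
  "directions P = direction P ` hyperplanes P"

definition H_set ::
    "'a::euclidean_space set \<Rightarrow> ('a set \<Rightarrow> 'a set) \<Rightarrow> ('a set \<Rightarrow> 'a set) \<Rightarrow> 'a set set" where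
  "H_set P x y =
     separating P (fundamental_alcove P) (y (fundamental_alcove P)) \<inter>
     separating P (y (fundamental_alcove P)) ((x \<otimes>\<^bsub>affine_weyl P\<^esub> y) (fundamental_alcove P))"

definition I_set ::
    "'a::euclidean_space set \<Rightarrow> ('a set \<Rightarrow> 'a set) \<Rightarrow> ('a set \<Rightarrow> 'a set) \<Rightarrow> 'a set set set" where
  "I_set P x y = {i\<in>directions P. \<exists>H\<in>H_set P x y. direction P H = i}"

definition c_dir ::
    "'a::euclidean_space set \<Rightarrow> (('a set \<Rightarrow> 'a set) \<Rightarrow> int) \<Rightarrow>
     ('a set \<Rightarrow> 'a set) \<Rightarrow> ('a set \<Rightarrow> 'a set) \<Rightarrow> 'a set set \<Rightarrow> int" where
  "c_dir P L x y i = Max {hyp_weight P L H | H. H \<in> H_set P x y \<and> direction P H = i}"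

definition c_bound ::
    "'a::euclidean_space set \<Rightarrow> (('a set \<Rightarrow> 'a set) \<Rightarrow> int) \<Rightarrow>
     ('a set \<Rightarrow> 'a set) \<Rightarrow> ('a set \<Rightarrow> 'a set) \<Rightarrow> int" where
  "c_bound P L x y = (\<Sum>i\<in>I_set P x y. c_dir P L x y i)"

end

theory Submission
  imports Defs
begin

text \<open>
  The proof is by induction on \<open>\<ell>(x)\<close>.  Write \<open>x = us\<close> with \<open>\<ell>(x) = \<ell>(u) + 1\<close>.  If \<open>sy > y\<close>, then
  \<open>T\<^sub>x T\<^sub>y = T\<^sub>u T\<^sub>s\<^sub>y\<close> and \<open>H\<^sub>u\<^sub>,\<^sub>s\<^sub>y = H\<^sub>x\<^sub>,\<^sub>y\<close>.  If \<open>sy < y\<close>, then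
  \<open>T\<^sub>x T\<^sub>y = T\<^sub>u T\<^sub>s\<^sub>y + (v\<^bsup>L(s)\<^esup> - v\<^bsup>-L(s)\<^esup>) T\<^sub>u T\<^sub>y\<close> and \<open>H\<^sub>u\<^sub>,\<^sub>s\<^sub>y \<subseteq> H\<^sub>x\<^sub>,\<^sub>y\<close>, so the point is the inequality
  \<open>c\<^sub>u\<^sub>,\<^sub>y + L(s) \<le> c\<^sub>x\<^sub>,\<^sub>y\<close>.  Let \<open>\<sigma>\<close> be the reflection in the wall \<open>H\<close> between \<open>yA\<^sub>0\<close> and \<open>syA\<^sub>0\<close>.  For every
  \<open>K \<in> H\<^sub>u\<^sub>,\<^sub>y\<close> one of \<open>K\<close>, \<open>\<sigma>K\<close> lies in \<open>H\<^sub>x\<^sub>,\<^sub>y\<close>, and both have the same weight.  The choices can be made so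
  that the weights add up over each orbit of \<open>\<sigma>\<close> on the set of directions, and the direction of \<open>H\<close>,
  which does not occur in \<open>H\<^sub>u\<^sub>,\<^sub>y\<close>, contributes at least \<open>L(s)\<close> to \<open>c\<^sub>x\<^sub>,\<^sub>y\<close>.
\<close>

section \<open>Coroots and affine reflections\<close>

text \<open>W is given as a permutation group of alcoves and its generators come from orbits of
  facets, so every fact about lengths is obtained by counting separating hyperplanes. An alcove is
  determined by the signs of the functionals \<open>coroot \<alpha> x - n\<close> at any one of its
  points, and the reflections permute these functionals; all statements about separation thus become
  sign conditions at chosen points of A_0, yA_0 and xyA_0. The obstacle in the key inequality is
  double charging: if direction i keeps its heaviest hyperplane while the mirror direction has to
  send its own into i, then i would pay for both. In that situation the mirror image of the
  hyperplane in direction i turns out to be available as well, so that the two can be swapped. The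
  letter s is split off at the right end of x because it then acts on yA_0 itself, so that the wall
  being crossed is a wall of yA_0. The Hecke relations describe only left multiplication by T_s,
  whence T_x = T_u T_s has to be derived first.\<close>

lemma coroot_add: "coroot \<alpha> (x + y) = coroot \<alpha> x + coroot \<alpha> y"
  by (simp add: coroot_def algebra_simps add_divide_distrib inner_add_left)

lemma coroot_diff: "coroot \<alpha> (x - y) = coroot \<alpha> x - coroot \<alpha> y"
  by (simp add: coroot_def algebra_simps diff_divide_distrib inner_diff_left)

lemma coroot_scale: "coroot \<alpha> (c *\<^sub>R x) = c * coroot \<alpha> x"
  by (simp add: coroot_def)

lemma coroot_uminus: "coroot (- \<alpha>) x = - coroot \<alpha> x"
  by (simp add: coroot_def)

lemma coroot_self: "\<alpha> \<noteq> 0 \<Longrightarrow> coroot \<alpha> \<alpha> = 2"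
  by (simp add: coroot_def)

lemma coroot_inner: "coroot \<alpha> x = ((2 / (\<alpha> \<bullet> \<alpha>)) *\<^sub>R \<alpha>) \<bullet> x"
  by (simp add: coroot_def inner_commute)

text \<open>A reflection preserves lengths, so the denominators of the two coroots agree and only
  the linearity of the inner product remains.\<close>

lemma coroot_sroot:
  "coroot (\<beta> - coroot \<alpha> \<beta> *\<^sub>R \<alpha>) x = coroot \<beta> x - coroot \<beta> \<alpha> * coroot \<alpha> x"
proof (cases "\<alpha> = 0")
  case False
  define c where "c = coroot \<alpha> \<beta>"
  have c: "c * (\<alpha> \<bullet> \<alpha>) = 2 * (\<alpha> \<bullet> \<beta>)"
    using False by (simp add: c_def coroot_def inner_commute)
  have "(\<beta> - c *\<^sub>R \<alpha>) \<bullet> (\<beta> - c *\<^sub>R \<alpha>) = \<beta> \<bullet> \<beta> - 2 * c * (\<alpha> \<bullet> \<beta>) + c * (c * (\<alpha> \<bullet> \<alpha>))"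
    by (simp add: inner_diff_left inner_diff_right inner_commute algebra_simps)
  also have "\<dots> = \<beta> \<bullet> \<beta>" by (simp add: c)
  finally have n: "(\<beta> - c *\<^sub>R \<alpha>) \<bullet> (\<beta> - c *\<^sub>R \<alpha>) = \<beta> \<bullet> \<beta>" .
  have "c = 2 * (\<alpha> \<bullet> \<beta>) / (\<alpha> \<bullet> \<alpha>)" by (simp add: c_def coroot_def inner_commute)
  then show ?thesis unfolding c_def[symmetric]
    unfolding coroot_def n
    by (simp add: inner_diff_right diff_divide_distrib inner_commute algebra_simps)
qed (simp add: coroot_def)

text \<open>Closed form of the orthogonal reflection in \<open>hyperplane \<alpha> n\<close>, to
  compute with instead of \<open>closest_point\<close>.\<close>

definition arefl :: "'a::euclidean_space \<Rightarrow> int \<Rightarrow> 'a \<Rightarrow> 'a" where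
  "arefl \<alpha> n x = x - (coroot \<alpha> x - of_int n) *\<^sub>R \<alpha>"

lemma coroot_arefl_self: "\<alpha> \<noteq> 0 \<Longrightarrow> coroot \<alpha> (arefl \<alpha> n x) - n = - (coroot \<alpha> x - n)"
  by (simp add: arefl_def coroot_diff coroot_scale coroot_self)

lemma arefl_arefl [simp]: "\<alpha> \<noteq> 0 \<Longrightarrow> arefl \<alpha> n (arefl \<alpha> n x) = x"
  using coroot_arefl_self[of \<alpha> n x] by (simp add: arefl_def[of \<alpha> n "arefl \<alpha> n x"]) (simp add: arefl_def algebra_simps)

lemma hyperplane_inner: "hyperplane \<alpha> n = {x. ((2 / (\<alpha> \<bullet> \<alpha>)) *\<^sub>R \<alpha>) \<bullet> x = of_int n}"
  by (simp add: hyperplane_def coroot_inner)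

text \<open>Moving x along the root by half of the displacement of \<open>arefl\<close> gives the
  foot of the perpendicular; Cauchy-Schwarz shows that no point of the hyperplane is nearer.\<close>

lemma reflection_hyperplane:
  assumes "\<alpha> \<noteq> 0" shows "reflection (hyperplane \<alpha> n) = arefl \<alpha> n"
proof
  fix x
  define t where "t = (coroot \<alpha> x - n) / 2"
  have c: "coroot \<alpha> (x - t *\<^sub>R \<alpha>) = n"
    using assms by (simp add: coroot_diff coroot_scale coroot_self t_def field_simps)
  have "x - t *\<^sub>R \<alpha> = closest_point (hyperplane \<alpha> n) x"
  proof (rule closest_point_unique)
    show "convex (hyperplane \<alpha> n)" "closed (hyperplane \<alpha> n)"
      unfolding hyperplane_inner by (rule convex_hyperplane, rule closed_hyperplane)
    show "x - t *\<^sub>R \<alpha> \<in> hyperplane \<alpha> n" using c by (simp add: hyperplane_def)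
    show "\<forall>z\<in>hyperplane \<alpha> n. dist x (x - t *\<^sub>R \<alpha>) \<le> dist x z"
    proof
      fix z assume "z \<in> hyperplane \<alpha> n"
      then have "coroot \<alpha> z = n" by (simp add: hyperplane_def)
      then have "coroot \<alpha> (x - z) = 2 * t" by (simp add: coroot_diff t_def)
      then have e: "t * (\<alpha> \<bullet> \<alpha>) = (x - z) \<bullet> \<alpha>" using assms by (simp add: coroot_def field_simps)
      have n: "\<alpha> \<bullet> \<alpha> = norm \<alpha> * norm \<alpha>" by (metis power2_eq_square power2_norm_eq_inner)
      have "\<bar>t\<bar> * (norm \<alpha> * norm \<alpha>) = \<bar>(x - z) \<bullet> \<alpha>\<bar>"
        unfolding e[symmetric] n by (simp add: abs_mult)
      also have "\<dots> \<le> norm (x - z) * norm \<alpha>" by (rule Cauchy_Schwarz_ineq2)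
      finally have "(\<bar>t\<bar> * norm \<alpha>) * norm \<alpha> \<le> norm (x - z) * norm \<alpha>" by (simp add: mult.assoc)
      then have "\<bar>t\<bar> * norm \<alpha> \<le> norm (x - z)" using assms by simp
      then show "dist x (x - t *\<^sub>R \<alpha>) \<le> dist x z" by (simp add: dist_norm)
    qed
  qed
  then have "reflection (hyperplane \<alpha> n) x = 2 *\<^sub>R (x - t *\<^sub>R \<alpha>) - x"
    by (simp add: reflection_def)
  also have "\<dots> = x - (2 * t) *\<^sub>R \<alpha>"
    by (simp add: algebra_simps scaleR_2)
  also have "\<dots> = arefl \<alpha> n x"
    by (simp add: arefl_def t_def)
  finally show "reflection (hyperplane \<alpha> n) x = arefl \<alpha> n x" .
qed

lemma arefl_fixes: "x \<in> hyperplane \<alpha> n \<Longrightarrow> arefl \<alpha> n x = x"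
  by (simp add: arefl_def hyperplane_def)

text \<open>Splitting off the translation makes the facts about injective linear images (closures,
  affine hulls, faces) applicable.\<close>

lemma arefl_affine: "arefl \<alpha> n = (\<lambda>x. of_int n *\<^sub>R \<alpha> + x) \<circ> (\<lambda>x. x - coroot \<alpha> x *\<^sub>R \<alpha>)"
  by (simp add: fun_eq_iff arefl_def algebra_simps)

lemma linear_sroot: "linear (\<lambda>x. x - coroot \<alpha> x *\<^sub>R \<alpha>)"
  by (rule linearI) (simp_all add: coroot_add coroot_scale algebra_simps)

lemma inj_sroot: assumes "\<alpha> \<noteq> 0" shows "inj (\<lambda>x. x - coroot \<alpha> x *\<^sub>R \<alpha>)"
  by (rule inj_on_inverseI[where g="\<lambda>x. x - coroot \<alpha> x *\<^sub>R \<alpha>"])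
    (simp add: coroot_diff coroot_scale coroot_self assms)

lemma arefl_image:
  "arefl \<alpha> n ` S = (\<lambda>x. of_int n *\<^sub>R \<alpha> + x) ` (\<lambda>x. x - coroot \<alpha> x *\<^sub>R \<alpha>) ` S"
  by (simp add: arefl_affine image_comp)

lemma arefl_closure: "\<alpha> \<noteq> 0 \<Longrightarrow> closure (arefl \<alpha> n ` S) = arefl \<alpha> n ` closure S"
  by (simp add: arefl_image closure_translation closure_injective_linear_image[OF linear_sroot inj_sroot])

lemma arefl_affine_hull: "affine hull (arefl \<alpha> n ` S) = arefl \<alpha> n ` (affine hull S)"
  by (simp add: arefl_image affine_hull_translation affine_hull_linear_image[symmetric]
      linear_linear linear_sroot)

lemma arefl_facet_of:
  "\<alpha> \<noteq> 0 \<Longrightarrow> F facet_of S \<Longrightarrow> arefl \<alpha> n ` F facet_of arefl \<alpha> n ` S"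
  by (simp add: arefl_image facet_of_def face_of_linear_image[OF linear_sroot inj_sroot]
      aff_dim_translation_eq aff_dim_injective_linear_image[OF linear_sroot inj_sroot])

lemma arefl_dist: assumes "\<alpha> \<noteq> 0" shows "dist (arefl \<alpha> n x) (arefl \<alpha> n y) = dist x y"
proof -
  define z where "z = x - y"
  have e: "arefl \<alpha> n x - arefl \<alpha> n y = z - coroot \<alpha> z *\<^sub>R \<alpha>"
    by (simp add: arefl_def z_def coroot_diff algebra_simps)
  have c: "coroot \<alpha> z * (\<alpha> \<bullet> \<alpha>) = 2 * (z \<bullet> \<alpha>)" using assms by (simp add: coroot_def)
  have "(norm (z - coroot \<alpha> z *\<^sub>R \<alpha>))\<^sup>2
      = z \<bullet> z - 2 * coroot \<alpha> z * (z \<bullet> \<alpha>) + coroot \<alpha> z * (coroot \<alpha> z * (\<alpha> \<bullet> \<alpha>))"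
    by (simp add: power2_norm_eq_inner inner_diff_left inner_diff_right inner_commute algebra_simps)
  also have "\<dots> = (norm z)\<^sup>2" by (simp add: c power2_norm_eq_inner)
  finally show ?thesis by (simp add: dist_norm e z_def)
qed

text \<open>\<open>separates\<close> speaks of components; this reduces it to a comparison of signs.
  A connected set that avoids the hyperplane cannot change sign, and the two half-spaces are
  connected.\<close>

lemma components_hyperplane:
  assumes "\<alpha> \<noteq> 0"
  shows "components (- hyperplane \<alpha> n) = {{x. coroot \<alpha> x < n}, {x. coroot \<alpha> x > n}}"
proof -
  define u where "u = (2 / (\<alpha> \<bullet> \<alpha>)) *\<^sub>R \<alpha>"
  have u: "coroot \<alpha> x = u \<bullet> x" for x by (simp add: u_def coroot_inner)
  have u0: "u \<noteq> 0" using assms by (simp add: u_def)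
  let ?L = "{x. coroot \<alpha> x < n}" and ?R = "{x. coroot \<alpha> x > n}"
  have UN: "- hyperplane \<alpha> n = ?L \<union> ?R" by (auto simp: hyperplane_def)
  have cL: "connected ?L" unfolding u
    by (simp add: convex_connected convex_halfspace_lt)
  have cR: "connected ?R" unfolding u
    by (simp add: convex_connected convex_halfspace_gt)
  have side: "(coroot \<alpha> x < n \<longleftrightarrow> coroot \<alpha> y < n)" if c: "connected_component (- hyperplane \<alpha> n) x y" for x y
  proof (rule ccontr)
    assume ne: "\<not> ?thesis"
    obtain C where C: "connected C" "C \<subseteq> - hyperplane \<alpha> n" "x \<in> C" "y \<in> C"
      using c by (auto simp: connected_component_def)
    have "\<exists>z\<in>C. u \<bullet> z = n"
      using ne connected_ivt_hyperplane[OF C(1,3,4), of u n]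
        connected_ivt_hyperplane[OF C(1,4,3), of u n] by (fastforce simp: u)
    then show False using C(2) by (auto simp: hyperplane_def u)
  qed
  have compL: "connected_component_set (- hyperplane \<alpha> n) x = ?L" if "coroot \<alpha> x < n" for x
    using that side[of x] connected_component_maximal[of x ?L "- hyperplane \<alpha> n"] cL UN by auto
  have compR: "connected_component_set (- hyperplane \<alpha> n) x = ?R" if "coroot \<alpha> x > n" for x
  proof -
    have "connected_component_set (- hyperplane \<alpha> n) x \<subseteq> ?R"
    proof
      fix y assume y: "y \<in> connected_component_set (- hyperplane \<alpha> n) x"
      then have "y \<in> - hyperplane \<alpha> n" using connected_component_in by fastforce
      then show "y \<in> ?R" using side[of x y] y that by (auto simp: hyperplane_def)
    qed
    then show ?thesis
      using that connected_component_maximal[of x ?R "- hyperplane \<alpha> n"] cR UN by auto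
  qed
  have ex: "coroot \<alpha> ((t / 2) *\<^sub>R \<alpha>) = t" for t using assms by (simp add: coroot_scale coroot_self)
  have exL: "\<exists>x. coroot \<alpha> x < n" by (rule exI[of _ "((n - 1)/2) *\<^sub>R \<alpha>"]) (simp add: ex)
  have exR: "\<exists>x. coroot \<alpha> x > n" by (rule exI[of _ "((n + 1)/2) *\<^sub>R \<alpha>"]) (simp add: ex)
  show ?thesis
  proof (intro equalityI subsetI)
    fix C assume "C \<in> components (- hyperplane \<alpha> n)"
    then obtain x where "x \<in> - hyperplane \<alpha> n" "C = connected_component_set (- hyperplane \<alpha> n) x"
      by (auto simp: components_def)
    then show "C \<in> {?L, ?R}" using compL compR UN by auto
  next
    fix C assume "C \<in> {?L, ?R}"
    then show "C \<in> components (- hyperplane \<alpha> n)"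
    proof
      assume C: "C = ?L"
      obtain x where x: "coroot \<alpha> x < n" using exL by auto
      then show ?thesis using componentsI[of x "- hyperplane \<alpha> n"] compL[OF x] UN C by auto
    next
      assume C: "C \<in> {?R}"
      obtain x where x: "coroot \<alpha> x > n" using exR by auto
      then show ?thesis using componentsI[of x "- hyperplane \<alpha> n"] compR[OF x] UN C by auto
    qed
  qed
qed

section \<open>The hyperplane arrangement of a root system\<close>

locale affine_arrangement =
  fixes \<Phi> P :: "'a::euclidean_space set"
  assumes root_system: "root_system \<Phi>" and positive: "positive_roots \<Phi> P"
begin

lemma finite_roots: "finite \<Phi>"
  and root_nonzero: "\<alpha> \<in> \<Phi> \<Longrightarrow> \<alpha> \<noteq> 0"
  and root_reflect: "\<alpha> \<in> \<Phi> \<Longrightarrow> \<beta> \<in> \<Phi> \<Longrightarrow> \<beta> - coroot \<alpha> \<beta> *\<^sub>R \<alpha> \<in> \<Phi>"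
  and coroot_root_Ints: "\<alpha> \<in> \<Phi> \<Longrightarrow> \<beta> \<in> \<Phi> \<Longrightarrow> coroot \<alpha> \<beta> \<in> \<int>"
  using root_system by (auto simp: root_system_def)

lemma root_uminus: "\<alpha> \<in> \<Phi> \<Longrightarrow> - \<alpha> \<in> \<Phi>"
  using root_reflect[of \<alpha> \<alpha>] root_nonzero[of \<alpha>] by (simp add: coroot_self scaleR_2)

lemma positive_subset: "P \<subseteq> \<Phi>" and finite_positive: "finite P"
  using positive finite_roots by (auto simp: positive_roots_def)

lemma root_cases: "\<alpha> \<in> \<Phi> \<Longrightarrow> \<alpha> \<in> P \<or> - \<alpha> \<in> P"
proof -
  assume \<alpha>: "\<alpha> \<in> \<Phi>"
  obtain \<gamma> where \<gamma>: "\<forall>\<alpha>\<in>\<Phi>. \<gamma> \<bullet> \<alpha> \<noteq> 0" "P = {\<alpha>\<in>\<Phi>. \<gamma> \<bullet> \<alpha> > 0}"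
    using positive unfolding positive_roots_def by blast
  show "\<alpha> \<in> P \<or> - \<alpha> \<in> P"
  proof (cases "\<gamma> \<bullet> \<alpha> > 0")
    case False
    then have "\<gamma> \<bullet> (- \<alpha>) > 0" using bspec[OF \<gamma>(1) \<alpha>] by simp
    then show ?thesis using root_uminus[OF \<alpha>] \<gamma>(2) by simp
  qed (use \<alpha> \<gamma>(2) in simp)
qed

lemma hyperplane_uminus: "hyperplane (- \<alpha>) (- n) = hyperplane \<alpha> n"
  by (auto simp: hyperplane_def coroot_uminus)

text \<open>Opposite roots define the same hyperplanes, so all of \<Phi> may serve as index set.
  Unlike P, it is stable under reflections.\<close>

lemma hyperplane_in: "\<alpha> \<in> \<Phi> \<Longrightarrow> hyperplane \<alpha> n \<in> hyperplanes P"
  using root_cases[of \<alpha>] hyperplane_uminus[of \<alpha> n, symmetric] unfolding hyperplanes_def by blast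

lemma hyperplanesE:
  assumes "H \<in> hyperplanes P"
  obtains \<alpha> n where "\<alpha> \<in> \<Phi>" "H = hyperplane \<alpha> n"
  using assms positive_subset by (auto simp: hyperplanes_def)

lemma arefl_root:
  assumes "\<alpha> \<in> \<Phi>" "\<beta> \<in> \<Phi>"
  obtains \<beta>' m' where "\<beta>' \<in> \<Phi>"
    "\<And>x. coroot \<beta>' (arefl \<alpha> n x) - of_int m' = coroot \<beta> x - of_int m"
    "\<And>x. arefl \<beta>' m' (arefl \<alpha> n x) = arefl \<alpha> n (arefl \<beta> m x)"
proof -
  define \<beta>' where "\<beta>' = \<beta> - coroot \<alpha> \<beta> *\<^sub>R \<alpha>"
  obtain k where k: "coroot \<beta> \<alpha> = of_int k"
    using coroot_root_Ints[OF assms(2,1)] by (auto simp: Ints_def)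
  have c: "coroot \<beta>' (arefl \<alpha> n x) - of_int (m - n * k) = coroot \<beta> x - of_int m" for x
  proof -
    have "coroot \<beta>' (arefl \<alpha> n x) = coroot \<beta>' x - (coroot \<alpha> x - n) * coroot \<beta>' \<alpha>"
      by (simp add: arefl_def coroot_diff coroot_scale)
    moreover have "coroot \<beta>' \<alpha> = - k"
      using coroot_self[OF root_nonzero[OF assms(1)]] by (simp add: \<beta>'_def coroot_sroot k)
    moreover have "coroot \<beta>' x = coroot \<beta> x - k * coroot \<alpha> x"
      by (simp add: \<beta>'_def coroot_sroot k)
    ultimately show ?thesis by (simp add: algebra_simps)
  qed
  have "arefl \<beta>' (m - n * k) (arefl \<alpha> n x) = arefl \<alpha> n (arefl \<beta> m x)" for x
  proof -
    have "arefl \<beta>' (m - n * k) (arefl \<alpha> n x) = arefl \<alpha> n x - (coroot \<beta> x - m) *\<^sub>R \<beta>'"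
      unfolding arefl_def[of \<beta>'] c ..
    also have "\<dots> = x - (coroot \<beta> x - m) *\<^sub>R \<beta>
        - (coroot \<alpha> (x - (coroot \<beta> x - m) *\<^sub>R \<beta>) - n) *\<^sub>R \<alpha>"
      unfolding coroot_diff coroot_scale by (simp add: arefl_def \<beta>'_def algebra_simps)
    also have "\<dots> = arefl \<alpha> n (arefl \<beta> m x)"
      by (simp add: arefl_def)
    finally show ?thesis .
  qed
  with c show thesis using root_reflect[OF assms] that[of \<beta>' "m - n * k"] by (auto simp: \<beta>'_def)
qed

lemma arefl_image_hyperplane:
  assumes "\<alpha> \<noteq> 0" "\<And>x. coroot \<beta>' (arefl \<alpha> n x) - of_int m' = coroot \<beta> x - of_int m"
  shows "arefl \<alpha> n ` hyperplane \<beta> m = hyperplane \<beta>' m'"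
proof (intro equalityI subsetI)
  fix x assume "x \<in> hyperplane \<beta>' m'"
  then have "arefl \<alpha> n x \<in> hyperplane \<beta> m"
    using assms(2)[of "arefl \<alpha> n x"] by (simp add: hyperplane_def arefl_arefl[OF assms(1)])
  then show "x \<in> arefl \<alpha> n ` hyperplane \<beta> m"
    by (metis arefl_arefl[OF assms(1)] imageI)
next
  fix x assume "x \<in> arefl \<alpha> n ` hyperplane \<beta> m"
  then obtain y where "x = arefl \<alpha> n y" "coroot \<beta> y = m" by (auto simp: hyperplane_def)
  then show "x \<in> hyperplane \<beta>' m'" using assms(2)[of y] by (simp add: hyperplane_def)
qed

section \<open>Alcoves as cells of constant sign\<close>

definition generic :: "'a set" where "generic = - \<Union> (hyperplanes P)"

lemma generic_iff: "x \<in> generic \<longleftrightarrow> (\<forall>\<alpha>\<in>\<Phi>. \<forall>n::int. coroot \<alpha> x \<noteq> n)"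
proof -
  have "x \<in> generic \<longleftrightarrow> (\<forall>H\<in>hyperplanes P. x \<notin> H)" by (auto simp: generic_def)
  also have "\<dots> \<longleftrightarrow> (\<forall>\<alpha>\<in>\<Phi>. \<forall>n::int. x \<notin> hyperplane \<alpha> n)"
    by (metis hyperplanesE hyperplane_in)
  finally show ?thesis by (simp add: hyperplane_def)
qed

text \<open>A strictly positive product encodes at once that the signs agree and that neither point
  lies on the hyperplane.\<close>

definition cell :: "'a \<Rightarrow> 'a set" where
  "cell a = {x. \<forall>\<alpha>\<in>\<Phi>. \<forall>n::int. 0 < (coroot \<alpha> x - n) * (coroot \<alpha> a - n)}"

lemma cell_generic: "x \<in> cell a \<Longrightarrow> x \<in> generic"
proof -
  assume x: "x \<in> cell a"
  have "coroot \<alpha> x \<noteq> of_int n" if "\<alpha> \<in> \<Phi>" for \<alpha> n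
  proof -
    have "0 < (coroot \<alpha> x - of_int n) * (coroot \<alpha> a - of_int n)" using x that by (simp add: cell_def)
    then show ?thesis by (metis diff_self less_irrefl mult_zero_left)
  qed
  then show ?thesis by (simp add: generic_iff)
qed

lemma cell_self: "a \<in> generic \<Longrightarrow> a \<in> cell a"
proof -
  assume a: "a \<in> generic"
  have "0 < (coroot \<alpha> a - of_int n) * (coroot \<alpha> a - of_int n)" if "\<alpha> \<in> \<Phi>" for \<alpha> n
  proof -
    have "coroot \<alpha> a - of_int n \<noteq> 0" using a that by (simp add: generic_iff)
    then show ?thesis by (metis power2_eq_square zero_less_power2)
  qed
  then show ?thesis by (simp add: cell_def)
qed

lemma cell_cong: assumes "x \<in> cell a" shows "cell x = cell a"
proof -
  have "0 < (coroot \<alpha> y - n) * (coroot \<alpha> x - n) \<longleftrightarrow> 0 < (coroot \<alpha> y - n) * (coroot \<alpha> a - n)"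
    if "\<alpha> \<in> \<Phi>" for \<alpha> y and n :: int
  proof -
    have "0 < (coroot \<alpha> x - n) * (coroot \<alpha> a - n)" using assms that by (auto simp: cell_def)
    then show ?thesis by (auto simp: zero_less_mult_iff)
  qed
  then show ?thesis by (auto simp: cell_def)
qed

text \<open>For each root the two integers next to the value at \<open>a\<close> imply the
  conditions for all other integers, and negative roots add nothing. Openness, convexity and the
  closure are read off from this finite description.\<close>

lemma cell_strips:
  assumes "a \<in> generic"
  shows "cell a = {x. \<forall>\<alpha>\<in>P. of_int \<lfloor>coroot \<alpha> a\<rfloor> < coroot \<alpha> x \<and> coroot \<alpha> x < of_int \<lfloor>coroot \<alpha> a\<rfloor> + 1}"
    (is "_ = ?S")
proof (intro equalityI subsetI)
  fix x assume x: "x \<in> cell a"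
  show "x \<in> ?S"
  proof (clarify)
    fix \<alpha> assume "\<alpha> \<in> P"
    then have \<alpha>: "\<alpha> \<in> \<Phi>" using positive_subset by auto
    let ?k = "\<lfloor>coroot \<alpha> a\<rfloor>"
    have k: "of_int ?k < coroot \<alpha> a"
      using assms \<alpha> by (metis generic_iff of_int_floor_le order_le_less)
    have "0 < (coroot \<alpha> x - ?k) * (coroot \<alpha> a - ?k)"
      "0 < (coroot \<alpha> x - of_int (?k + 1)) * (coroot \<alpha> a - of_int (?k + 1))"
      using x \<alpha> unfolding cell_def by blast+
    moreover have "coroot \<alpha> a < of_int ?k + 1" by linarith
    ultimately show "of_int ?k < coroot \<alpha> x \<and> coroot \<alpha> x < of_int ?k + 1"
      using k by (simp add: zero_less_mult_iff)
  qed
next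
  fix x assume x: "x \<in> ?S"
  have *: "0 < (coroot \<alpha> x - n) * (coroot \<alpha> a - n)" if \<alpha>: "\<alpha> \<in> P" for \<alpha> and n :: int
  proof -
    let ?k = "\<lfloor>coroot \<alpha> a\<rfloor>"
    have k: "of_int ?k < coroot \<alpha> a"
      using assms \<alpha> by (metis generic_iff of_int_floor_le order_le_less positive_subset subsetD)
    have k': "coroot \<alpha> a < of_int ?k + 1" by linarith
    have xk: "of_int ?k < coroot \<alpha> x" "coroot \<alpha> x < of_int ?k + 1" using x \<alpha> by auto
    show ?thesis
    proof (cases "n \<le> ?k")
      case True
      then have "real_of_int n \<le> ?k" by simp
      then show ?thesis using k xk by (intro mult_pos_pos) auto
    next
      case False
      then have "real_of_int ?k + 1 \<le> n" by linarith
      then show ?thesis using k' xk by (intro mult_neg_neg) linarith+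
    qed
  qed
  show "x \<in> cell a" unfolding cell_def
  proof (clarify)
    fix \<alpha> n assume "\<alpha> \<in> \<Phi>"
    then consider "\<alpha> \<in> P" | "- \<alpha> \<in> P" using root_cases by auto
    then show "0 < (coroot \<alpha> x - real_of_int n) * (coroot \<alpha> a - real_of_int n)"
    proof cases
      case 2
      from *[OF 2, of "- n"] have "0 < (- (coroot \<alpha> x - n)) * (- (coroot \<alpha> a - n))"
        by (simp add: coroot_uminus)
      then show ?thesis by (simp only: minus_mult_minus)
    qed (use * in auto)
  qed
qed

lemma continuous_coroot: "continuous_on S (coroot \<alpha>)"
  unfolding coroot_inner[abs_def] by (intro continuous_intros)

lemma open_cell: "a \<in> generic \<Longrightarrow> open (cell a)"
  and convex_cell: "a \<in> generic \<Longrightarrow> convex (cell a)"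
proof -
  assume a: "a \<in> generic"
  let ?S = "\<lambda>\<alpha>. {x. of_int \<lfloor>coroot \<alpha> a\<rfloor> < coroot \<alpha> x} \<inter> {x. coroot \<alpha> x < of_int \<lfloor>coroot \<alpha> a\<rfloor> + 1}"
  have e: "cell a = (\<Inter>\<alpha>\<in>P. ?S \<alpha>)" unfolding cell_strips[OF a] by auto
  show "open (cell a)" unfolding e
    by (intro open_INT ballI open_Int finite_positive open_Collect_less continuous_coroot continuous_on_const)
  show "convex (cell a)" unfolding e coroot_inner
    by (intro convex_INT convex_Int convex_halfspace_lt convex_halfspace_gt)
qed

lemma closure_cell:
  assumes "a \<in> generic"
  shows "closure (cell a) = {x. \<forall>\<alpha>\<in>P. of_int \<lfloor>coroot \<alpha> a\<rfloor> \<le> coroot \<alpha> x \<and> coroot \<alpha> x \<le> of_int \<lfloor>coroot \<alpha> a\<rfloor> + 1}"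
    (is "_ = ?S")
proof
  have "?S = (\<Inter>\<alpha>\<in>P. {x. of_int \<lfloor>coroot \<alpha> a\<rfloor> \<le> coroot \<alpha> x} \<inter> {x. coroot \<alpha> x \<le> of_int \<lfloor>coroot \<alpha> a\<rfloor> + 1})"
    by auto
  moreover have "closed \<dots>"
    by (intro closed_INT ballI closed_Int closed_Collect_le continuous_coroot continuous_on_const)
  ultimately have "closed ?S" by simp
  moreover have "cell a \<subseteq> ?S" unfolding cell_strips[OF assms] by force
  ultimately show "closure (cell a) \<subseteq> ?S" by (rule closure_minimal[rotated])
next
  show "?S \<subseteq> closure (cell a)"
  proof
    fix x assume x: "x \<in> ?S"
    show "x \<in> closure (cell a)"
    proof (cases "x = a")
      case True
      then show ?thesis using cell_self[OF assms] closure_subset by blast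
    next
      case False
      \<comment> \<open>Moving from \<open>x\<close> towards the interior point \<open>a\<close>
        makes all weak inequalities strict at once.\<close>
      have "open_segment x a \<subseteq> cell a"
      proof
        fix y assume "y \<in> open_segment x a"
        then obtain u where u: "0 < u" "u < 1" "y = (1 - u) *\<^sub>R x + u *\<^sub>R a"
          by (auto simp: in_segment)
        have "of_int \<lfloor>coroot \<alpha> a\<rfloor> < coroot \<alpha> y \<and> coroot \<alpha> y < of_int \<lfloor>coroot \<alpha> a\<rfloor> + 1" if \<alpha>: "\<alpha> \<in> P" for \<alpha>
        proof -
          let ?k = "real_of_int \<lfloor>coroot \<alpha> a\<rfloor>"
          have c: "coroot \<alpha> y = (1 - u) * coroot \<alpha> x + u * coroot \<alpha> a"
            by (simp add: u coroot_add coroot_scale)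
          have a: "?k < coroot \<alpha> a" "coroot \<alpha> a < ?k + 1"
            using cell_self[OF assms] \<alpha> unfolding cell_strips[OF assms] by auto
          have x': "?k \<le> coroot \<alpha> x" "coroot \<alpha> x \<le> ?k + 1" using x \<alpha> by auto
          have "(1 - u) * ?k \<le> (1 - u) * coroot \<alpha> x" "(1 - u) * coroot \<alpha> x \<le> (1 - u) * (?k + 1)"
            using u x' by (auto intro!: mult_left_mono)
          moreover have "u * ?k < u * coroot \<alpha> a" "u * coroot \<alpha> a < u * (?k + 1)"
            using u a by auto
          ultimately have "(1 - u) * ?k + u * ?k < coroot \<alpha> y"
            "coroot \<alpha> y < (1 - u) * (?k + 1) + u * (?k + 1)"
            unfolding c by (auto intro: add_le_less_mono)
          then show ?thesis by (simp add: ring_distribs)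
        qed
        then show "y \<in> cell a" unfolding cell_strips[OF assms] by auto
      qed
      then have "closure (open_segment x a) \<subseteq> closure (cell a)" by (rule closure_mono)
      then show ?thesis using False by auto
    qed
  qed
qed

text \<open>The relative frontier of a polyhedron is the union of its facets; this is how a wall is
  found on a segment leaving the alcove.\<close>

lemma polyhedron_closure_cell: assumes "a \<in> generic" shows "polyhedron (closure (cell a))"
proof -
  have "closure (cell a)
      = (\<Inter>\<alpha>\<in>P. {x. coroot \<alpha> x \<ge> of_int \<lfloor>coroot \<alpha> a\<rfloor>} \<inter> {x. coroot \<alpha> x \<le> of_int \<lfloor>coroot \<alpha> a\<rfloor> + 1})"
    unfolding closure_cell[OF assms] by auto
  moreover have "polyhedron \<dots>"
  proof (rule polyhedron_Inter)
    fix S assume "S \<in> (\<lambda>\<alpha>. {x. coroot \<alpha> x \<ge> of_int \<lfloor>coroot \<alpha> a\<rfloor>} \<inter> {x. coroot \<alpha> x \<le> of_int \<lfloor>coroot \<alpha> a\<rfloor> + 1}) ` P"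
    then obtain \<alpha> where S: "S = {x. coroot \<alpha> x \<ge> of_int \<lfloor>coroot \<alpha> a\<rfloor>} \<inter> {x. coroot \<alpha> x \<le> of_int \<lfloor>coroot \<alpha> a\<rfloor> + 1}"
      by blast
    show "polyhedron S" unfolding S coroot_inner
      by (rule polyhedron_Int[OF polyhedron_halfspace_ge polyhedron_halfspace_le])
  qed (simp add: finite_positive)
  ultimately show ?thesis by simp
qed

lemma connected_same_side:
  assumes "connected C" "x \<in> C" "y \<in> C" "(coroot \<alpha> x - of_int n) * (coroot \<alpha> y - of_int n) \<le> 0"
  obtains z where "z \<in> C" "z \<in> hyperplane \<alpha> n"
proof -
  have "\<exists>z\<in>C. coroot \<alpha> z = n"
    using assms(4) connected_ivt_hyperplane[OF assms(1,2,3), of "(2 / (\<alpha> \<bullet> \<alpha>)) *\<^sub>R \<alpha>" n]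
      connected_ivt_hyperplane[OF assms(1,3,2), of "(2 / (\<alpha> \<bullet> \<alpha>)) *\<^sub>R \<alpha>" n]
    unfolding coroot_inner[symmetric] mult_le_0_iff by auto
  then show thesis using that by (auto simp: hyperplane_def)
qed

text \<open>A connected set of generic points cannot change any of the signs, and a cell is convex,
  hence connected.\<close>

lemma alcoves_cell: "alcoves P = cell ` generic"
proof -
  have "connected_component_set generic a = cell a" if a: "a \<in> generic" for a
  proof
    show "connected_component_set generic a \<subseteq> cell a"
    proof
      fix x assume "x \<in> connected_component_set generic a"
      then obtain C where C: "connected C" "C \<subseteq> generic" "a \<in> C" "x \<in> C"
        by (auto simp: connected_component_def)
      show "x \<in> cell a" unfolding cell_def
      proof (clarify, rule ccontr)
        fix \<alpha> n assume \<alpha>: "\<alpha> \<in> \<Phi>" and "\<not> 0 < (coroot \<alpha> x - real_of_int n) * (coroot \<alpha> a - real_of_int n)"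
        then obtain z where "z \<in> C" "z \<in> hyperplane \<alpha> n"
          using connected_same_side[OF C(1,4,3)] by (metis linorder_not_less)
        then show False using C(2) \<alpha> by (auto simp: generic_iff hyperplane_def)
      qed
    qed
    show "cell a \<subseteq> connected_component_set generic a"
      using cell_self[OF a] convex_cell[OF a] cell_generic
      by (intro connected_component_maximal) (auto intro: convex_connected)
  qed
  then show ?thesis unfolding alcoves_def components_def generic_def[symmetric] by simp
qed

lemma alcove_cell: "A \<in> alcoves P \<Longrightarrow> a \<in> A \<Longrightarrow> a \<in> generic \<and> A = cell a"
proof -
  assume "A \<in> alcoves P" "a \<in> A"
  then obtain a0 where a0: "A = cell a0" "a \<in> cell a0" unfolding alcoves_cell by blast
  show "a \<in> generic \<and> A = cell a" using cell_cong[OF a0(2)] cell_generic[OF a0(2)] a0(1) by simp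
qed

lemma alcove_point: assumes "A \<in> alcoves P" obtains a where "a \<in> A"
proof -
  obtain a where "a \<in> generic" "A = cell a" using assms unfolding alcoves_cell by blast
  then show thesis using cell_self[of a] that by simp
qed

end

section \<open>Separation of alcoves as a sign condition at points\<close>

context affine_arrangement begin
lemma alcove_side:
  "A \<in> alcoves P \<Longrightarrow> a \<in> A \<Longrightarrow> a' \<in> A \<Longrightarrow> \<alpha> \<in> \<Phi> \<Longrightarrow> 0 < (coroot \<alpha> a - of_int n) * (coroot \<alpha> a' - of_int n)"
proof -
  assume A: "A \<in> alcoves P" "a \<in> A" "a' \<in> A" "\<alpha> \<in> \<Phi>"
  then have "a \<in> cell a'" using alcove_cell[OF A(1,3)] by simp
  then show ?thesis using A(4) by (simp add: cell_def)
qed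

lemma alcove_off: "A \<in> alcoves P \<Longrightarrow> a \<in> A \<Longrightarrow> \<alpha> \<in> \<Phi> \<Longrightarrow> coroot \<alpha> a \<noteq> of_int n"
proof
  assume "A \<in> alcoves P" "a \<in> A" "\<alpha> \<in> \<Phi>" "coroot \<alpha> a = of_int n"
  then show False using alcove_side[of A a a \<alpha> n] by simp
qed

lemma alcove_eqI:
  assumes "A \<in> alcoves P" "B \<in> alcoves P" "a \<in> A" "b \<in> B"
    "\<And>\<alpha> n. \<alpha> \<in> \<Phi> \<Longrightarrow> \<not> (coroot \<alpha> a - of_int n) * (coroot \<alpha> b - of_int n) < 0"
  shows "A = B"
proof -
  have "a \<in> cell b" unfolding cell_def
  proof clarify
    fix \<alpha> n assume \<alpha>: "\<alpha> \<in> \<Phi>"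
    have "coroot \<alpha> a \<noteq> of_int n" "coroot \<alpha> b \<noteq> of_int n"
      using alcove_off[OF assms(1,3) \<alpha>] alcove_off[OF assms(2,4) \<alpha>] by simp_all
    then have "(coroot \<alpha> a - of_int n) * (coroot \<alpha> b - of_int n) \<noteq> 0" by simp
    then show "0 < (coroot \<alpha> a - of_int n) * (coroot \<alpha> b - of_int n)"
      using assms(5)[OF \<alpha>, of n] by linarith
  qed
  then have "cell a = cell b" by (rule cell_cong)
  then show ?thesis using alcove_cell[OF assms(1,3)] alcove_cell[OF assms(2,4)] by simp
qed

lemma separates_iff:
  assumes "A \<in> alcoves P" "B \<in> alcoves P" "a \<in> A" "b \<in> B" "\<alpha> \<in> \<Phi>"
  shows "separates (hyperplane \<alpha> n) A B \<longleftrightarrow> (coroot \<alpha> a - of_int n) * (coroot \<alpha> b - of_int n) < 0"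
proof -
  have lt: "C \<subseteq> {x. coroot \<alpha> x < n} \<longleftrightarrow> coroot \<alpha> c < n"
    and gt: "C \<subseteq> {x. coroot \<alpha> x > n} \<longleftrightarrow> coroot \<alpha> c > n" if C: "C \<in> alcoves P" "c \<in> C" for C c
    using C alcove_side[OF C _ assms(5), of _ n] by (auto simp: zero_less_mult_iff)
  have ne: "{x. coroot \<alpha> x < n} \<noteq> {x. coroot \<alpha> x > n}"
  proof
    assume "{x. coroot \<alpha> x < n} = {x. coroot \<alpha> x > n}"
    then have "a \<in> {x. coroot \<alpha> x < n} \<longleftrightarrow> a \<in> {x. coroot \<alpha> x > n}" by simp
    then show False using alcove_off[OF assms(1,3,5), of n] by auto
  qed
  show ?thesis
    unfolding separates_def components_hyperplane[OF root_nonzero[OF assms(5)]]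
    using ne lt[OF assms(1,3)] lt[OF assms(2,4)] gt[OF assms(1,3)] gt[OF assms(2,4)]
    by (auto simp: mult_less_0_iff)
qed

lemma separating_iff:
  assumes "A \<in> alcoves P" "B \<in> alcoves P" "a \<in> A" "b \<in> B" "\<alpha> \<in> \<Phi>"
  shows "hyperplane \<alpha> n \<in> separating P A B \<longleftrightarrow> (coroot \<alpha> a - of_int n) * (coroot \<alpha> b - of_int n) < 0"
  using separates_iff[OF assms] hyperplane_in[OF assms(5)] by (simp add: separating_def)

lemma separating_hyperplane: "H \<in> separating P A B \<Longrightarrow> H \<in> hyperplanes P"
  by (simp add: separating_def)

lemma finite_separating:
  assumes "A \<in> alcoves P" "B \<in> alcoves P" shows "finite (separating P A B)"
proof -
  obtain a b where ab: "a \<in> A" "b \<in> B" using assms alcove_point by metis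
  let ?N = "\<lambda>\<alpha>. {\<lfloor>min (coroot \<alpha> a) (coroot \<alpha> b)\<rfloor> .. \<lceil>max (coroot \<alpha> a) (coroot \<alpha> b)\<rceil>}"
  have "separating P A B \<subseteq> (\<Union>\<alpha>\<in>P. hyperplane \<alpha> ` ?N \<alpha>)"
  proof
    fix H assume H: "H \<in> separating P A B"
    then obtain \<alpha> n where \<alpha>: "\<alpha> \<in> P" "H = hyperplane \<alpha> n"
      by (auto simp: separating_def hyperplanes_def)
    then have "(coroot \<alpha> a - of_int n) * (coroot \<alpha> b - of_int n) < 0"
      using separating_iff[OF assms ab] H positive_subset by blast
    then have "min (coroot \<alpha> a) (coroot \<alpha> b) \<le> n" "n \<le> max (coroot \<alpha> a) (coroot \<alpha> b)"
      unfolding mult_less_0_iff by linarith+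
    then have "n \<in> ?N \<alpha>" unfolding atLeastAtMost_iff by linarith
    then show "H \<in> (\<Union>\<alpha>\<in>P. hyperplane \<alpha> ` ?N \<alpha>)" using \<alpha> by blast
  qed
  then show ?thesis by (rule finite_subset) (simp add: finite_positive)
qed

lemma separating_empty_iff:
  assumes "A \<in> alcoves P" "B \<in> alcoves P" shows "separating P A B = {} \<longleftrightarrow> A = B"
proof -
  obtain a b where ab: "a \<in> A" "b \<in> B" using assms alcove_point by metis
  show ?thesis
  proof
    assume "separating P A B = {}"
    then show "A = B" using alcove_eqI[OF assms ab] separating_iff[OF assms ab] by blast
  next
    assume AB: "A = B"
    show "separating P A B = {}"
    proof (rule equals0I)
      fix H assume H: "H \<in> separating P A B"
      then obtain \<alpha> n where \<alpha>: "\<alpha> \<in> \<Phi>" "H = hyperplane \<alpha> n"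
        using hyperplanesE separating_hyperplane by metis
      then show False using H separating_iff[OF assms, of a a \<alpha> n] ab AB
        by (simp add: mult_less_0_iff)
    qed
  qed
qed

lemma separating_commute:
  assumes "A \<in> alcoves P" "B \<in> alcoves P" shows "separating P A B = separating P B A"
  by (auto simp: separating_def separates_def)

text \<open>Every hyperplane gives each alcove one of two signs, so separation behaves like addition
  modulo 2.\<close>

lemma separating_symdiff:
  assumes "A \<in> alcoves P" "B \<in> alcoves P" "C \<in> alcoves P"
  shows "H \<in> separating P A C \<longleftrightarrow> (H \<in> separating P A B \<longleftrightarrow> H \<notin> separating P B C)"
proof (cases "H \<in> hyperplanes P")
  case True
  then obtain \<alpha> n where \<alpha>: "\<alpha> \<in> \<Phi>" "H = hyperplane \<alpha> n" by (rule hyperplanesE)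
  obtain a b c where abc: "a \<in> A" "b \<in> B" "c \<in> C" using assms alcove_point by metis
  show ?thesis
    using separating_iff[OF assms(1,3) abc(1,3) \<alpha>(1), of n] separating_iff[OF assms(1,2) abc(1,2) \<alpha>(1), of n]
      separating_iff[OF assms(2,3) abc(2,3) \<alpha>(1), of n]
      alcove_off[OF assms(1) abc(1) \<alpha>(1), of n] alcove_off[OF assms(2) abc(2) \<alpha>(1), of n]
      alcove_off[OF assms(3) abc(3) \<alpha>(1), of n]
    unfolding \<alpha>(2) by (auto simp: mult_less_0_iff)
next
  case False
  then have "H \<notin> separating P A B" "H \<notin> separating P B C" "H \<notin> separating P A C"
    by (auto simp: separating_def)
  then show ?thesis by blast
qed


section \<open>Walls\<close>

lemma locally_finite:
  obtains e where "0 < e" "\<And>x H. x \<in> ball p e \<Longrightarrow> H \<in> hyperplanes P \<Longrightarrow> x \<in> H \<Longrightarrow> p \<in> H"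
proof -
  have "eventually (\<lambda>x. \<forall>n::int. coroot \<alpha> x = n \<longrightarrow> coroot \<alpha> p = n) (nhds p)" for \<alpha>
  proof -
    let ?c = "coroot \<alpha> p" and ?k = "real_of_int \<lfloor>coroot \<alpha> p\<rfloor>"
    \<comment> \<open>Within distance \<open>d\<close> of the value at \<open>p\<close> there is no
      integer except possibly that value itself: for an integral value the next integers are at
      distance 1, otherwise \<open>d\<close> is the distance to the nearer neighbour.\<close>
    define d where "d = (if ?c = ?k then 1 else min (?c - ?k) (?k + 1 - ?c))"
    have k: "?k \<le> ?c" "?c < ?k + 1" by linarith+
    have d: "d > 0" using k by (cases "?c = ?k") (simp_all add: d_def less_le min_def)
    have "isCont (coroot \<alpha>) p"
      using continuous_coroot[of UNIV \<alpha>] by (simp add: continuous_on_eq_continuous_at)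
    then have "(coroot \<alpha> \<longlongrightarrow> ?c) (nhds p)" by (simp add: isCont_def tendsto_at_iff_tendsto_nhds)
    then have "eventually (\<lambda>x. dist (coroot \<alpha> x) ?c < d) (nhds p)" using d by (rule tendstoD)
    then show ?thesis
    proof (rule eventually_mono, intro allI impI)
      fix x n assume x: "dist (coroot \<alpha> x) ?c < d" and n: "coroot \<alpha> x = real_of_int n"
      have "\<bar>n - ?c\<bar> < d" using x n by (simp add: dist_real_def)
      moreover have "n \<le> \<lfloor>?c\<rfloor> - 1 \<or> n = \<lfloor>?c\<rfloor> \<or> n = \<lfloor>?c\<rfloor> + 1 \<or> n \<ge> \<lfloor>?c\<rfloor> + 2" by linarith
      then have "real_of_int n \<le> ?k - 1 \<or> n = ?k \<or> real_of_int n = ?k + 1 \<or> real_of_int n \<ge> ?k + 2"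
        by linarith
      ultimately show "?c = n" using k unfolding d_def by (auto split: if_splits)
    qed
  qed
  then have "eventually (\<lambda>x. \<forall>\<alpha>\<in>P. \<forall>n::int. coroot \<alpha> x = n \<longrightarrow> coroot \<alpha> p = n) (nhds p)"
    by (simp add: eventually_ball_finite_distrib finite_positive)
  then obtain e where e: "e > 0" "\<And>x. dist x p < e \<Longrightarrow> \<forall>\<alpha>\<in>P. \<forall>n::int. coroot \<alpha> x = n \<longrightarrow> coroot \<alpha> p = n"
    unfolding eventually_nhds_metric by blast
  show thesis
  proof (rule that[OF e(1)])
    fix x H assume x: "x \<in> ball p e" "H \<in> hyperplanes P" "x \<in> H"
    then obtain \<alpha> n where "\<alpha> \<in> P" "H = hyperplane \<alpha> n" by (auto simp: hyperplanes_def)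
    then show "p \<in> H" using e(2)[of x] x by (auto simp: hyperplane_def dist_commute)
  qed
qed

lemma closure_side:
  assumes "A \<in> alcoves P" "\<alpha> \<in> \<Phi>"
  shows "(\<forall>x\<in>closure A. coroot \<alpha> x \<le> of_int n) \<or> (\<forall>x\<in>closure A. coroot \<alpha> x \<ge> of_int n)"
proof -
  obtain a where a: "a \<in> A" using assms alcove_point by blast
  show ?thesis
  proof (cases "coroot \<alpha> a < n")
    case True
    have "A \<subseteq> {x. coroot \<alpha> x \<le> n}"
      using alcove_side[OF assms(1) a _ assms(2), of _ n] True by (fastforce simp: zero_less_mult_iff)
    moreover have "closed {x. coroot \<alpha> x \<le> n}"
      by (intro closed_Collect_le continuous_coroot continuous_on_const)
    ultimately have "closure A \<subseteq> {x. coroot \<alpha> x \<le> n}" by (rule closure_minimal)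
    then show ?thesis by auto
  next
    case False
    have "A \<subseteq> {x. coroot \<alpha> x \<ge> n}"
      using alcove_side[OF assms(1) a _ assms(2), of _ n] False by (fastforce simp: zero_less_mult_iff)
    moreover have "closed {x. coroot \<alpha> x \<ge> n}"
      by (intro closed_Collect_le continuous_coroot continuous_on_const)
    ultimately have "closure A \<subseteq> {x. coroot \<alpha> x \<ge> n}" by (rule closure_minimal)
    then show ?thesis by auto
  qed
qed

lemma alcove_topology:
  assumes "A \<in> alcoves P"
  shows "open A" "convex (closure A)" "polyhedron (closure A)" "A \<subseteq> rel_interior (closure A)"
    "aff_dim (closure A) = int DIM('a)"
proof -
  obtain a where a: "a \<in> A" using assms alcove_point by blast
  have c: "a \<in> generic" "A = cell a" using alcove_cell[OF assms a] by simp_all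
  show o: "open A" using c open_cell by simp
  show "convex (closure A)" using c convex_cell convex_closure by auto
  show "polyhedron (closure A)" using c polyhedron_closure_cell by simp
  have i: "A \<subseteq> interior (closure A)" using o closure_subset interior_maximal by metis
  then show "A \<subseteq> rel_interior (closure A)" using interior_subset_rel_interior by blast
  show "aff_dim (closure A) = int DIM('a)"
    using a i by (intro aff_dim_nonempty_interior) auto
qed

lemma frontier_hyperplane:
  assumes "A \<in> alcoves P" "p \<in> closure A" "p \<notin> A"
  obtains \<alpha> n where "\<alpha> \<in> \<Phi>" "p \<in> hyperplane \<alpha> n"
proof -
  obtain a where a: "a \<in> A" using assms alcove_point by blast
  have c: "a \<in> generic" "A = cell a" using alcove_cell[OF assms(1) a] by simp_all
  have le: "\<forall>\<alpha>\<in>P. of_int \<lfloor>coroot \<alpha> a\<rfloor> \<le> coroot \<alpha> p \<and> coroot \<alpha> p \<le> of_int \<lfloor>coroot \<alpha> a\<rfloor> + 1"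
    using assms(2) closure_cell[OF c(1)] c(2) by simp
  have "\<not> (\<forall>\<alpha>\<in>P. of_int \<lfloor>coroot \<alpha> a\<rfloor> < coroot \<alpha> p \<and> coroot \<alpha> p < of_int \<lfloor>coroot \<alpha> a\<rfloor> + 1)"
    using assms(3) cell_strips[OF c(1)] c(2) by simp
  then obtain \<alpha> where \<alpha>: "\<alpha> \<in> P" "coroot \<alpha> p = of_int \<lfloor>coroot \<alpha> a\<rfloor> \<or> coroot \<alpha> p = of_int (\<lfloor>coroot \<alpha> a\<rfloor> + 1)"
    using le by (force simp: not_less)
  then have "\<exists>n. p \<in> hyperplane \<alpha> n" unfolding hyperplane_def by blast
  then show thesis using that \<alpha>(1) positive_subset by blast
qed

text \<open>Take p in the relative interior of F. A hyperplane of the arrangement through p supports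
  the closed alcove, hence contains the whole face F, and equality with the affine hull follows by
  dimension. Some hyperplane does pass through p because p lies on the frontier.\<close>

lemma facet_point:
  assumes A: "A \<in> alcoves P" and F: "F facet_of closure A"
  obtains p where "p \<in> F" "affine hull F \<in> hyperplanes P"
    "\<And>H. H \<in> hyperplanes P \<Longrightarrow> p \<in> H \<Longrightarrow> H = affine hull F"
proof -
  have Ff: "F face_of closure A" "F \<noteq> {}" "aff_dim F = int DIM('a) - 1"
    using F alcove_topology(5)[OF A] by (auto simp: facet_of_def)
  have "rel_interior F \<noteq> {}"
    using Ff face_of_imp_convex rel_interior_eq_empty by blast
  then obtain p where p: "p \<in> rel_interior F" by blast
  have pF: "p \<in> F" using p rel_interior_subset by blast
  have pcl: "p \<in> closure A" using pF face_of_imp_subset[OF Ff(1)] by blast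
  have "F \<noteq> closure A" using Ff(3) alcove_topology(5)[OF A] by auto
  then have "F \<inter> rel_interior (closure A) = {}"
    using face_of_disjoint_rel_interior[OF Ff(1)] by blast
  then have pA: "p \<notin> A" using pF alcove_topology(4)[OF A] by blast
  have *: "affine hull F = hyperplane \<alpha> n" if \<alpha>: "\<alpha> \<in> \<Phi>" and pn: "p \<in> hyperplane \<alpha> n" for \<alpha> n
  proof -
    let ?u = "(2 / (\<alpha> \<bullet> \<alpha>)) *\<^sub>R \<alpha>"
    have u: "?u \<noteq> 0" using root_nonzero[OF \<alpha>] by simp
    have "(closure A \<inter> {x. ?u \<bullet> x = n}) face_of closure A"
      using closure_side[OF A \<alpha>, of n] unfolding coroot_inner
      by (metis (no_types) face_of_Int_supporting_hyperplane_le[OF alcove_topology(2)[OF A]]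
          face_of_Int_supporting_hyperplane_ge[OF alcove_topology(2)[OF A]])
    then have "F \<subseteq> closure A \<inter> {x. ?u \<bullet> x = n}"
    proof (rule subset_of_face_of)
      show "F \<subseteq> closure A" using Ff(1) by (rule face_of_imp_subset)
      show "(closure A \<inter> {x. ?u \<bullet> x = n}) \<inter> rel_interior F \<noteq> {}"
        using p pcl pn unfolding hyperplane_inner by blast
    qed
    then have FH: "F \<subseteq> hyperplane \<alpha> n" unfolding hyperplane_inner by blast
    have aH: "affine (hyperplane \<alpha> n)" unfolding hyperplane_inner by (rule affine_hyperplane)
    show ?thesis
    proof (rule affine_dim_equal)
      show "affine hull F \<subseteq> hyperplane \<alpha> n" using FH aH by (rule hull_minimal)
      show "aff_dim (affine hull F) = aff_dim (hyperplane \<alpha> n)"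
        unfolding hyperplane_inner aff_dim_hyperplane[OF u] using Ff(3) by simp
    qed (use aH Ff(2) in auto)
  qed
  obtain \<alpha> n where "\<alpha> \<in> \<Phi>" "p \<in> hyperplane \<alpha> n" using frontier_hyperplane[OF A pcl pA] .
  then have "affine hull F \<in> hyperplanes P" using * hyperplane_in by metis
  moreover have "H = affine hull F" if "H \<in> hyperplanes P" "p \<in> H" for H
    using hyperplanesE[OF that(1)] * that(2) by metis
  ultimately show thesis using that pF by blast
qed

text \<open>In a small ball around the point of \<open>facet_point\<close> the only hyperplane met
  is the affine hull of F, and a ball is connected.\<close>

lemma separating_near_facet:
  assumes A: "A \<in> alcoves P" and F: "F facet_of closure A"
  obtains p e where "p \<in> F" "0 < e"
    "\<And>B C. B \<in> alcoves P \<Longrightarrow> C \<in> alcoves P \<Longrightarrow> B \<inter> ball p e \<noteq> {} \<Longrightarrow> C \<inter> ball p e \<noteq> {} \<Longrightarrow>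
       separating P B C \<subseteq> {affine hull F}"
proof -
  obtain p where p: "p \<in> F" "\<And>H. H \<in> hyperplanes P \<Longrightarrow> p \<in> H \<Longrightarrow> H = affine hull F"
    using facet_point[OF A F] by blast
  obtain e where e: "0 < e" "\<And>x H. x \<in> ball p e \<Longrightarrow> H \<in> hyperplanes P \<Longrightarrow> x \<in> H \<Longrightarrow> p \<in> H"
    using locally_finite[of p] by blast
  show thesis
  proof (rule that[OF p(1) e(1)], rule subsetI)
    fix B C H assume BC: "B \<in> alcoves P" "C \<in> alcoves P" "B \<inter> ball p e \<noteq> {}" "C \<inter> ball p e \<noteq> {}"
      and H: "H \<in> separating P B C"
    obtain b c where bc: "b \<in> B" "c \<in> C" "b \<in> ball p e" "c \<in> ball p e" using BC by blast
    obtain \<alpha> n where \<alpha>: "\<alpha> \<in> \<Phi>" "H = hyperplane \<alpha> n"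
      using separating_hyperplane[OF H] hyperplanesE by blast
    have "(coroot \<alpha> b - of_int n) * (coroot \<alpha> c - of_int n) \<le> 0"
      using separating_iff[OF BC(1,2) bc(1,2) \<alpha>(1), of n] H \<alpha>(2) by simp
    then obtain z where "z \<in> ball p e" "z \<in> hyperplane \<alpha> n"
      using connected_same_side[of "ball p e" b c] bc by (metis connected_ball)
    then have "p \<in> H" using e(2) \<alpha>(2) separating_hyperplane[OF H] by blast
    then show "H \<in> {affine hull F}" using p(2) separating_hyperplane[OF H] by blast
  qed
qed

text \<open>The segment from A to B leaves the closure of A through a facet. Its end points lie off
  the hyperplane of that facet, so the affine functional vanishing at the exit point has opposite
  strict signs at them.\<close>

lemma exists_separating_facet:
  assumes A: "A \<in> alcoves P" and B: "B \<in> alcoves P" and "A \<noteq> B"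
  obtains F where "F facet_of closure A" "affine hull F \<in> separating P A B"
proof -
  obtain a b where ab: "a \<in> A" "b \<in> B" using assms alcove_point by metis
  have "b \<notin> closure A"
  proof
    assume "b \<in> closure A"
    then have "B \<inter> closure A \<noteq> {}" using ab(2) by blast
    then have "B \<inter> A \<noteq> {}" by (simp add: open_Int_closure_eq_empty[OF alcove_topology(1)[OF B]])
    then obtain x where "x \<in> A" "x \<in> B" by blast
    then have "A = B" using alcove_cell[OF A, of x] alcove_cell[OF B, of x] by simp
    with \<open>A \<noteq> B\<close> show False by simp
  qed
  then have "closed_segment a b - closure A \<noteq> {}" by auto
  moreover have "closed_segment a b \<inter> closure A \<noteq> {}" using ab(1) closure_subset[of A] by auto
  ultimately have "closed_segment a b \<inter> frontier (closure A) \<noteq> {}"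
    by (intro connected_Int_frontier) auto
  then obtain q where q: "q \<in> closed_segment a b" "q \<in> frontier (closure A)" by blast
  have "interior (closure A) \<noteq> {}"
    using ab(1) alcove_topology(1)[OF A] closure_subset[of A] interior_maximal by blast
  then have "rel_frontier (closure A) = frontier (closure A)" by (rule rel_frontier_nonempty_interior)
  then have "q \<in> \<Union> {F. F facet_of closure A}"
    using q(2) rel_frontier_of_polyhedron[OF alcove_topology(3)[OF A]] by simp
  then obtain F where F: "F facet_of closure A" "q \<in> F" by blast
  obtain p where p: "affine hull F \<in> hyperplanes P" using facet_point[OF A F(1)] by blast
  then obtain \<alpha> n where \<alpha>: "\<alpha> \<in> \<Phi>" "affine hull F = hyperplane \<alpha> n" by (rule hyperplanesE)
  have qn: "coroot \<alpha> q = n" using F(2) \<alpha>(2) hull_subset[of F affine] by (auto simp: hyperplane_def)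
  obtain u where u: "0 \<le> u" "u \<le> 1" "q = (1 - u) *\<^sub>R a + u *\<^sub>R b"
    using q(1) by (auto simp: in_segment)
  have e: "(1 - u) * (coroot \<alpha> a - n) + u * (coroot \<alpha> b - n) = 0"
    using qn unfolding u(3) coroot_add coroot_scale by (simp add: algebra_simps)
  have nz: "coroot \<alpha> a \<noteq> n" "coroot \<alpha> b \<noteq> n"
    using alcove_off[OF A ab(1) \<alpha>(1)] alcove_off[OF B ab(2) \<alpha>(1)] by simp_all
  have u0: "0 < u" "u < 1" using e nz u by (auto simp: order_le_less)
  have "(coroot \<alpha> a - n) * (coroot \<alpha> b - n) < 0"
  proof (cases "coroot \<alpha> a < n")
    case True
    then have "(1 - u) * (coroot \<alpha> a - n) < 0" using u0 by (simp add: mult_pos_neg)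
    then have "u * (coroot \<alpha> b - n) > 0" using e by linarith
    then have "coroot \<alpha> b > n" using u0 by (simp add: zero_less_mult_iff)
    then show ?thesis using True by (simp add: mult_neg_pos)
  next
    case False
    then have an: "coroot \<alpha> a > n" using nz by linarith
    then have "(1 - u) * (coroot \<alpha> a - n) > 0" using u0 by simp
    then have "u * (coroot \<alpha> b - n) < 0" using e by linarith
    then have "coroot \<alpha> b < n" using u0 by (simp add: mult_less_0_iff)
    then show ?thesis using an by (simp add: mult_pos_neg)
  qed
  then have "affine hull F \<in> separating P A B"
    using separating_iff[OF A B ab \<alpha>(1), of n] \<alpha>(2) by simp
  then show thesis using that F(1) by blast
qed

end

section \<open>The group generated by the reflections\<close>

context affine_arrangement begin

lemma reflectionE:
  assumes "H \<in> hyperplanes P"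
  obtains \<alpha> n where "\<alpha> \<in> \<Phi>" "H = hyperplane \<alpha> n" "reflection H = arefl \<alpha> n"
  using hyperplanesE[OF assms] reflection_hyperplane root_nonzero by metis

lemma reflection_reflection: "H \<in> hyperplanes P \<Longrightarrow> reflection H (reflection H x) = x"
  by (metis reflectionE arefl_arefl root_nonzero)

lemma reflection_comp_self: "H \<in> hyperplanes P \<Longrightarrow> reflection H \<circ> reflection H = id"
  by (simp add: fun_eq_iff reflection_reflection)

lemma reflection_image_image: "H \<in> hyperplanes P \<Longrightarrow> reflection H ` reflection H ` S = S"
  by (simp add: image_comp reflection_comp_self)

lemma bij_reflection: "H \<in> hyperplanes P \<Longrightarrow> bij (reflection H)"
  by (metis o_bij reflection_comp_self)

lemma reflection_image_id: "H \<in> hyperplanes P \<Longrightarrow> S \<subseteq> H \<Longrightarrow> reflection H ` S = S"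
proof -
  assume H: "H \<in> hyperplanes P" and S: "S \<subseteq> H"
  obtain \<alpha> n where \<alpha>: "H = hyperplane \<alpha> n" "reflection H = arefl \<alpha> n" using reflectionE[OF H] by metis
  then have "\<And>x. x \<in> S \<Longrightarrow> reflection H x = x" using S arefl_fixes by auto
  then show ?thesis by force
qed

lemma reflection_functional:
  assumes "H \<in> hyperplanes P" "\<beta> \<in> \<Phi>"
  obtains \<beta>' m' where "\<beta>' \<in> \<Phi>" "reflection H ` hyperplane \<beta> m = hyperplane \<beta>' m'"
    "\<And>x. coroot \<beta>' (reflection H x) - of_int m' = coroot \<beta> x - of_int m"
    "\<And>x. arefl \<beta>' m' (reflection H x) = reflection H (arefl \<beta> m x)"
proof -
  obtain \<alpha> n where \<alpha>: "\<alpha> \<in> \<Phi>" "reflection H = arefl \<alpha> n" using reflectionE[OF assms(1)] by metis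
  obtain \<beta>' m' where b: "\<beta>' \<in> \<Phi>"
    "\<And>x. coroot \<beta>' (arefl \<alpha> n x) - of_int m' = coroot \<beta> x - of_int m"
    "\<And>x. arefl \<beta>' m' (arefl \<alpha> n x) = arefl \<alpha> n (arefl \<beta> m x)"
    using arefl_root[OF \<alpha>(1) assms(2), of n m] by blast
  have "reflection H ` hyperplane \<beta> m = hyperplane \<beta>' m'"
    unfolding \<alpha>(2) by (rule arefl_image_hyperplane[OF root_nonzero[OF \<alpha>(1)] b(2)])
  then show thesis using that b unfolding \<alpha>(2) by metis
qed

lemma reflection_image_hyperplane:
  assumes "H \<in> hyperplanes P" "K \<in> hyperplanes P" shows "reflection H ` K \<in> hyperplanes P"
proof -
  obtain \<beta> m where \<beta>: "\<beta> \<in> \<Phi>" "K = hyperplane \<beta> m" using hyperplanesE[OF assms(2)] .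
  obtain \<beta>' m' where "\<beta>' \<in> \<Phi>" "reflection H ` hyperplane \<beta> m = hyperplane \<beta>' m'"
    using reflection_functional[OF assms(1) \<beta>(1), of m] by metis
  then show ?thesis using hyperplane_in \<beta>(2) by simp
qed

lemma reflection_conjugate:
  assumes "H \<in> hyperplanes P" "K \<in> hyperplanes P"
  shows "reflection (reflection H ` K) \<circ> reflection H = reflection H \<circ> reflection K"
proof -
  obtain \<beta> m where \<beta>: "\<beta> \<in> \<Phi>" "K = hyperplane \<beta> m" "reflection K = arefl \<beta> m"
    using reflectionE[OF assms(2)] .
  obtain \<beta>' m' where "\<beta>' \<in> \<Phi>" "reflection H ` hyperplane \<beta> m = hyperplane \<beta>' m'"
    "\<And>x. arefl \<beta>' m' (reflection H x) = reflection H (arefl \<beta> m x)"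
    using reflection_functional[OF assms(1) \<beta>(1), of m] by metis
  then show ?thesis using \<beta> reflection_hyperplane[OF root_nonzero] by (simp add: fun_eq_iff)
qed

lemma reflection_alcove:
  assumes H: "H \<in> hyperplanes P" and A: "A \<in> alcoves P" shows "reflection H ` A \<in> alcoves P"
proof -
  have sub: "reflection H x \<in> cell (reflection H a)" if x: "x \<in> cell a" for x a
    unfolding cell_def
  proof clarify
    fix \<beta> m assume \<beta>: "\<beta> \<in> \<Phi>"
    obtain \<beta>' m' where b: "\<beta>' \<in> \<Phi>"
      "\<And>x. coroot \<beta>' (reflection H x) - of_int m' = coroot \<beta> x - of_int m"
      using reflection_functional[OF H \<beta>, of m] by metis
    have e: "coroot \<beta> (reflection H y) - of_int m = coroot \<beta>' y - of_int m'" for y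
      using b(2)[of "reflection H y"] reflection_reflection[OF H] by simp
    show "0 < (coroot \<beta> (reflection H x) - of_int m) * (coroot \<beta> (reflection H a) - of_int m)"
      unfolding e using x b(1) by (simp add: cell_def)
  qed
  obtain a where a: "a \<in> generic" "A = cell a" using A by (auto simp: alcoves_cell)
  have "reflection H ` A = cell (reflection H a)"
  proof
    show "reflection H ` A \<subseteq> cell (reflection H a)" using sub a(2) by blast
    show "cell (reflection H a) \<subseteq> reflection H ` A"
    proof
      fix x assume "x \<in> cell (reflection H a)"
      then have "reflection H x \<in> A" using sub[of x "reflection H a"] reflection_reflection[OF H] a(2) by simp
      then show "x \<in> reflection H ` A" using reflection_reflection[OF H] by (metis imageI)
    qed
  qed
  moreover have "reflection H a \<in> generic"
    using sub[OF cell_self[OF a(1)]] cell_generic by blast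
  ultimately show ?thesis by (simp add: alcoves_cell)
qed

lemma reflection_separating:
  assumes H: "H \<in> hyperplanes P" and A: "A \<in> alcoves P" and B: "B \<in> alcoves P"
    and K: "K \<in> hyperplanes P"
  shows "reflection H ` K \<in> separating P (reflection H ` A) (reflection H ` B) \<longleftrightarrow> K \<in> separating P A B"
proof -
  obtain \<beta> m where \<beta>: "\<beta> \<in> \<Phi>" "K = hyperplane \<beta> m" using hyperplanesE[OF K] .
  obtain \<beta>' m' where b: "\<beta>' \<in> \<Phi>" "reflection H ` hyperplane \<beta> m = hyperplane \<beta>' m'"
    "\<And>x. coroot \<beta>' (reflection H x) - of_int m' = coroot \<beta> x - of_int m"
    using reflection_functional[OF H \<beta>(1), of m] by metis
  obtain a b where ab: "a \<in> A" "b \<in> B" using A B alcove_point by metis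
  show ?thesis unfolding \<beta>(2) b(2)
    using separating_iff[OF A B ab \<beta>(1), of m]
      separating_iff[OF reflection_alcove[OF H A] reflection_alcove[OF H B] imageI[OF ab(1)] imageI[OF ab(2)] b(1), of m']
    by (simp add: b(3))
qed

lemma reflection_affine_hull:
  "H \<in> hyperplanes P \<Longrightarrow> affine hull (reflection H ` S) = reflection H ` (affine hull S)"
  by (metis reflectionE arefl_affine_hull)

lemma reflection_facet:
  assumes H: "H \<in> hyperplanes P" and F: "F facet_of closure A"
  shows "reflection H ` F facet_of closure (reflection H ` A)"
proof -
  obtain \<alpha> n where \<alpha>: "\<alpha> \<in> \<Phi>" "reflection H = arefl \<alpha> n" using reflectionE[OF H] by metis
  show ?thesis unfolding \<alpha>(2) arefl_closure[OF root_nonzero[OF \<alpha>(1)]]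
    by (rule arefl_facet_of[OF root_nonzero[OF \<alpha>(1)] F])
qed

lemma separating_reflection:
  assumes H: "H \<in> hyperplanes P" and A: "A \<in> alcoves P"
  shows "H \<in> separating P A (reflection H ` A)"
proof -
  obtain \<alpha> n where \<alpha>: "\<alpha> \<in> \<Phi>" "H = hyperplane \<alpha> n" "reflection H = arefl \<alpha> n" using reflectionE[OF H] .
  obtain a where a: "a \<in> A" using A alcove_point by blast
  let ?t = "coroot \<alpha> a - of_int n"
  have "?t \<noteq> 0" using alcove_off[OF A a \<alpha>(1)] by simp
  then have "?t * - ?t < 0" by (simp add: mult_less_0_iff) linarith
  then have "?t * (coroot \<alpha> (reflection H a) - of_int n) < 0"
    using coroot_arefl_self[OF root_nonzero[OF \<alpha>(1)], of n a] \<alpha>(3) by simp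
  then show ?thesis
    using separating_iff[OF A reflection_alcove[OF H A] a imageI[OF a] \<alpha>(1), of n] \<alpha>(2) by simp
qed

subsection \<open>Adjacent alcoves\<close>

definition walls :: "'a set \<Rightarrow> 'a set set" where
  "walls A = {affine hull F | F. F facet_of closure A}"

lemma wallsI: "F facet_of closure A \<Longrightarrow> affine hull F \<in> walls A"
  by (auto simp: walls_def)

lemma walls_hyperplanes: "A \<in> alcoves P \<Longrightarrow> walls A \<subseteq> hyperplanes P"
  using facet_point unfolding walls_def by blast

text \<open>The reflection in the wall fixes the facet point p and preserves distances, so A and its
  mirror image both come close to p, where the wall is the only hyperplane.\<close>

lemma separating_across_wall:
  assumes A: "A \<in> alcoves P" and H: "H \<in> walls A"
  shows "separating P A (reflection H ` A) = {H}"
proof -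
  obtain F where F: "F facet_of closure A" "H = affine hull F" using H by (auto simp: walls_def)
  have Hh: "H \<in> hyperplanes P" using walls_hyperplanes[OF A] H by blast
  obtain \<alpha> n where \<alpha>: "\<alpha> \<in> \<Phi>" "H = hyperplane \<alpha> n" "reflection H = arefl \<alpha> n" using reflectionE[OF Hh] .
  obtain p e where p: "p \<in> F" "0 < e"
    "\<And>B C. B \<in> alcoves P \<Longrightarrow> C \<in> alcoves P \<Longrightarrow> B \<inter> ball p e \<noteq> {} \<Longrightarrow> C \<inter> ball p e \<noteq> {} \<Longrightarrow>
       separating P B C \<subseteq> {H}"
    using separating_near_facet[OF A F(1)] F(2) by metis
  have "p \<in> closure A" using p(1) facet_of_imp_subset[OF F(1)] by blast
  then obtain a where a: "a \<in> A" "dist a p < e" using p(2) by (auto simp: closure_approachable)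
  have "p \<in> H" using p(1) F(2) hull_subset by fastforce
  then have "reflection H p = p" using arefl_fixes \<alpha> by simp
  then have "dist (reflection H a) p < e"
    using a(2) arefl_dist[OF root_nonzero[OF \<alpha>(1)], of n a p] \<alpha>(3) by simp
  then have "reflection H ` A \<inter> ball p e \<noteq> {}" "A \<inter> ball p e \<noteq> {}"
    using a by (auto simp: dist_commute)
  then have "separating P A (reflection H ` A) \<subseteq> {H}"
    using p(3)[OF A reflection_alcove[OF Hh A]] by simp
  then show ?thesis using separating_reflection[OF Hh A] by blast
qed

text \<open>Both B and the mirror image of A are separated from A by the wall alone, so nothing
  separates them from each other.\<close>

lemma facet_adjacent:
  assumes A: "A \<in> alcoves P" and B: "B \<in> alcoves P"
    and F: "F facet_of closure A" "F facet_of closure B" and ne: "A \<noteq> B"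
  shows "B = reflection (affine hull F) ` A"
proof -
  let ?H = "affine hull F"
  have H: "?H \<in> hyperplanes P" using walls_hyperplanes[OF A] wallsI[OF F(1)] by blast
  obtain p e where p: "p \<in> F" "0 < e"
    "\<And>B C. B \<in> alcoves P \<Longrightarrow> C \<in> alcoves P \<Longrightarrow> B \<inter> ball p e \<noteq> {} \<Longrightarrow> C \<inter> ball p e \<noteq> {} \<Longrightarrow>
       separating P B C \<subseteq> {?H}"
    using separating_near_facet[OF A F(1)] by metis
  have near: "C \<inter> ball p e \<noteq> {}" if "F facet_of closure C" for C
  proof -
    have "p \<in> closure C" using p(1) facet_of_imp_subset[OF that] by blast
    then obtain c where "c \<in> C" "dist c p < e" using p(2) by (auto simp: closure_approachable)
    then show ?thesis by (auto simp: dist_commute)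
  qed
  have "separating P A B \<subseteq> {?H}" by (rule p(3)[OF A B near[OF F(1)] near[OF F(2)]])
  then have AB: "separating P A B = {?H}" using separating_empty_iff[OF A B] ne by blast
  have r: "reflection ?H ` A \<in> alcoves P" using reflection_alcove[OF H A] .
  have "K \<notin> separating P B (reflection ?H ` A)" for K
    using separating_symdiff[OF A B r, of K] AB separating_across_wall[OF A wallsI[OF F(1)]] by auto
  then show ?thesis using separating_empty_iff[OF B r] by blast
qed

lemma exists_separating_wall:
  assumes "A \<in> alcoves P" "B \<in> alcoves P" "A \<noteq> B"
  obtains H where "H \<in> walls A" "H \<in> separating P A B"
  using exists_separating_facet[OF assms] wallsI by metis

lemma reflection_separating_image:
  assumes H: "H \<in> hyperplanes P" and A: "A \<in> alcoves P" and B: "B \<in> alcoves P"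
  shows "separating P (reflection H ` A) (reflection H ` B) = (`) (reflection H) ` separating P A B"
proof (intro equalityI subsetI)
  fix K assume K: "K \<in> separating P (reflection H ` A) (reflection H ` B)"
  then have h: "reflection H ` K \<in> hyperplanes P"
    using reflection_image_hyperplane[OF H separating_hyperplane] by blast
  have "reflection H ` K \<in> separating P A B"
    using reflection_separating[OF H A B h] K by (simp add: reflection_image_image[OF H])
  then show "K \<in> (`) (reflection H) ` separating P A B"
    by (metis imageI reflection_image_image[OF H])
next
  fix K assume "K \<in> (`) (reflection H) ` separating P A B"
  then show "K \<in> separating P (reflection H ` A) (reflection H ` B)"
    using reflection_separating[OF H A B] separating_hyperplane by blast
qed

lemma card_separating_reflection:
  assumes H: "H \<in> hyperplanes P" and A: "A \<in> alcoves P" and B: "B \<in> alcoves P"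
  shows "card (separating P (reflection H ` A) (reflection H ` B)) = card (separating P A B)"
  unfolding reflection_separating_image[OF assms]
  by (rule card_image, rule inj_on_inverseI[where g="(`) (reflection H)"])
    (rule reflection_image_image[OF H])

lemma separating_step:
  assumes A: "A \<in> alcoves P" and B: "B \<in> alcoves P" and H: "H \<in> walls A"
  shows "separating P (reflection H ` A) B =
    (if H \<in> separating P A B then separating P A B - {H} else insert H (separating P A B))"
proof -
  have Hh: "H \<in> hyperplanes P" using walls_hyperplanes[OF A] H by blast
  have "K \<in> separating P (reflection H ` A) B \<longleftrightarrow> (K = H \<longleftrightarrow> K \<notin> separating P A B)" for K
    using separating_symdiff[OF A reflection_alcove[OF Hh A] B, of K] separating_across_wall[OF A H] by auto
  then show ?thesis by auto
qed

text \<open>Applying the reflection to both alcoves turns the move of B into a move of A across its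
  own wall, which removes one hyperplane. This is the descent in the inductions over words
  below.\<close>

lemma card_separating_step:
  assumes A: "A \<in> alcoves P" and B: "B \<in> alcoves P" and H: "H \<in> walls A" and "H \<in> separating P A B"
  shows "card (separating P A (reflection H ` B)) < card (separating P A B)"
proof -
  have Hh: "H \<in> hyperplanes P" using walls_hyperplanes[OF A] H by blast
  have "card (separating P A (reflection H ` B)) = card (separating P (reflection H ` A) B)"
    using card_separating_reflection[OF Hh reflection_alcove[OF Hh A] B] by (simp add: reflection_image_image[OF Hh])
  also have "\<dots> < card (separating P A B)"
    using separating_step[OF A B H] assms(4) card_Diff1_less[OF finite_separating[OF A B] assms(4)] by simp
  finally show ?thesis .
qed

end

subsection \<open>Words of reflections\<close>

text \<open>Elements of the reflection group are handled as lists of hyperplanes, since the exchange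
  argument is an induction on the length of a word.\<close>

definition refl_word :: "'a::euclidean_space set list \<Rightarrow> 'a \<Rightarrow> 'a" where
  "refl_word Hs = foldr (\<lambda>H f. reflection H \<circ> f) Hs id"

lemma refl_word_Nil [simp]: "refl_word [] = id"
  and refl_word_Cons: "refl_word (H # Hs) = reflection H \<circ> refl_word Hs"
  by (simp_all add: refl_word_def)

lemma refl_word_Cons_apply [simp]: "refl_word (H # Hs) x = reflection H (refl_word Hs x)"
  by (simp add: refl_word_Cons)

lemma refl_word_Cons_image [simp]: "refl_word (H # Hs) ` S = reflection H ` refl_word Hs ` S"
  by (simp only: refl_word_Cons image_comp)

lemma refl_word_singleton [simp]: "refl_word [H] = reflection H"
  by (rule ext) simp

lemma refl_word_append: "refl_word (Hs @ Ks) = refl_word Hs \<circ> refl_word Ks"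
  by (rule ext, induction Hs) simp_all

lemma refl_word_append_apply [simp]: "refl_word (Hs @ Ks) x = refl_word Hs (refl_word Ks x)"
  by (simp add: refl_word_append)

lemma refl_word_append_image [simp]: "refl_word (Hs @ Ks) ` S = refl_word Hs ` refl_word Ks ` S"
  by (simp only: refl_word_append image_comp)

context affine_arrangement begin

lemma refl_word_rev_apply: "set Hs \<subseteq> hyperplanes P \<Longrightarrow> refl_word (rev Hs) (refl_word Hs x) = x"
  by (induction Hs) (simp_all add: reflection_reflection)

lemma refl_word_rev: "set Hs \<subseteq> hyperplanes P \<Longrightarrow> refl_word (rev Hs) \<circ> refl_word Hs = id"
  by (rule ext) (simp add: refl_word_rev_apply)

lemma bij_refl_word: "set Hs \<subseteq> hyperplanes P \<Longrightarrow> bij (refl_word Hs)"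
  using refl_word_rev[of Hs] refl_word_rev[of "rev Hs"] by (intro o_bij) simp_all

text \<open>Reflections are their own inverses, so words without inverses already exhaust the
  generated group.\<close>

lemma Omega_eq: "Omega P = refl_word ` {Hs. set Hs \<subseteq> hyperplanes P}"
proof -
  let ?G = "BijGroup (UNIV :: 'a set)"
  have G: "group ?G" by (rule group_BijGroup)
  have car: "carrier ?G = {f. bij f}"
    by (auto simp: BijGroup_def Bij_def extensional_def)
  have mult: "f \<otimes>\<^bsub>?G\<^esub> g = f \<circ> g" if "bij f" "bij g" for f g
    using that by (auto simp: BijGroup_def Bij_def extensional_def compose_def fun_eq_iff)
  have one: "\<one>\<^bsub>?G\<^esub> = id" by (auto simp: BijGroup_def fun_eq_iff)
  have inv: "inv\<^bsub>?G\<^esub> (reflection H) = reflection H" if "H \<in> hyperplanes P" for H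
    using group.inv_equality[OF G, of "reflection H" "reflection H"] bij_reflection[OF that]
    by (simp add: car mult one reflection_comp_self[OF that])
  show ?thesis
  proof (intro equalityI subsetI)
    fix \<omega> assume "\<omega> \<in> Omega P"
    then have "\<omega> \<in> generate ?G (reflection ` hyperplanes P)" by (simp add: Omega_def)
    then show "\<omega> \<in> refl_word ` {Hs. set Hs \<subseteq> hyperplanes P}"
    proof induction
      case one
      show ?case unfolding \<open>\<one>\<^bsub>?G\<^esub> = id\<close> by (rule image_eqI[of _ _ "[]"]) simp_all
    next
      case (incl h)
      then obtain H where "H \<in> hyperplanes P" "h = reflection H" by auto
      then show ?case by (intro image_eqI[of _ _ "[H]"]) simp_all
    next
      case (inv h)
      then obtain H where "H \<in> hyperplanes P" "inv\<^bsub>?G\<^esub> h = reflection H"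
        using \<open>\<And>H. H \<in> hyperplanes P \<Longrightarrow> inv\<^bsub>?G\<^esub> (reflection H) = reflection H\<close> by auto
      then show ?case by (intro image_eqI[of _ _ "[H]"]) simp_all
    next
      case (eng f g)
      then obtain Hs Ks where "set Hs \<subseteq> hyperplanes P" "f = refl_word Hs"
        "set Ks \<subseteq> hyperplanes P" "g = refl_word Ks" by auto
      then show ?case
        using mult[of f g] bij_refl_word by (intro image_eqI[of _ _ "Hs @ Ks"]) (simp_all add: refl_word_append)
    qed
  next
    fix \<omega> assume "\<omega> \<in> refl_word ` {Hs. set Hs \<subseteq> hyperplanes P}"
    then obtain Hs where Hs: "set Hs \<subseteq> hyperplanes P" "\<omega> = refl_word Hs" by auto
    have "refl_word Hs \<in> generate ?G (reflection ` hyperplanes P)" using Hs(1)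
    proof (induction Hs)
      case Nil
      show ?case using generate.one[of ?G "reflection ` hyperplanes P"] unfolding one refl_word_Nil .
    next
      case (Cons H Hs)
      have "reflection H \<otimes>\<^bsub>?G\<^esub> refl_word Hs \<in> generate ?G (reflection ` hyperplanes P)"
        using Cons by (intro generate.eng[OF generate.incl]) auto
      moreover have "bij (reflection H)" "bij (refl_word Hs)"
        using Cons.prems bij_reflection bij_refl_word by auto
      ultimately show ?case by (simp only: mult refl_word_Cons)
    qed
    then show "\<omega> \<in> Omega P" using Hs(2) by (simp add: Omega_def)
  qed
qed

lemma id_in_Omega: "id \<in> Omega P"
  unfolding Omega_eq by (rule image_eqI[of _ _ "[]"]) simp_all

lemma reflection_in_Omega: "H \<in> hyperplanes P \<Longrightarrow> reflection H \<in> Omega P"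
  unfolding Omega_eq by (rule image_eqI[of _ _ "[H]"]) simp_all

lemma Omega_comp:
  assumes "\<omega> \<in> Omega P" "\<rho> \<in> Omega P" shows "\<omega> \<circ> \<rho> \<in> Omega P"
proof -
  obtain Hs Ks where "set Hs \<subseteq> hyperplanes P" "\<omega> = refl_word Hs"
    "set Ks \<subseteq> hyperplanes P" "\<rho> = refl_word Ks" using assms unfolding Omega_eq by auto
  then show ?thesis unfolding Omega_eq by (intro image_eqI[of _ _ "Hs @ Ks"]) (simp_all add: refl_word_append)
qed

lemma Omega_inverse:
  assumes "\<omega> \<in> Omega P" obtains \<rho> where "\<rho> \<in> Omega P" "\<rho> \<circ> \<omega> = id" "\<omega> \<circ> \<rho> = id"
proof -
  obtain Hs where Hs: "set Hs \<subseteq> hyperplanes P" "\<omega> = refl_word Hs" using assms unfolding Omega_eq by auto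
  have "refl_word (rev Hs) \<in> Omega P" unfolding Omega_eq using Hs by simp
  moreover have "refl_word (rev Hs) \<circ> \<omega> = id" using refl_word_rev Hs by simp
  moreover have "\<omega> \<circ> refl_word (rev Hs) = id" using refl_word_rev[of "rev Hs"] Hs by simp
  ultimately show thesis using that by blast
qed

lemma Omega_induct [consumes 1, case_names id reflection]:
  assumes "\<omega> \<in> Omega P" "Q id"
    "\<And>H \<omega>. H \<in> hyperplanes P \<Longrightarrow> \<omega> \<in> Omega P \<Longrightarrow> Q \<omega> \<Longrightarrow> Q (reflection H \<circ> \<omega>)"
  shows "Q \<omega>"
proof -
  obtain Hs where Hs: "set Hs \<subseteq> hyperplanes P" "\<omega> = refl_word Hs" using assms(1) unfolding Omega_eq by auto
  have "Q (refl_word Hs)" using Hs(1)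
  proof (induction Hs)
    case (Cons H Hs)
    then have "refl_word Hs \<in> Omega P" unfolding Omega_eq by simp
    then have "Q (reflection H \<circ> refl_word Hs)" using Cons assms(3) by simp
    then show ?case by (simp only: refl_word_Cons)
  qed (simp only: refl_word_Nil assms(2))
  then show ?thesis using Hs by simp
qed

lemma Omega_hyperplane: "\<omega> \<in> Omega P \<Longrightarrow> K \<in> hyperplanes P \<Longrightarrow> \<omega> ` K \<in> hyperplanes P"
  by (induction \<omega> rule: Omega_induct) (simp_all only: image_id id_apply image_ident image_comp[symmetric] reflection_image_hyperplane)

lemma Omega_alcove: "\<omega> \<in> Omega P \<Longrightarrow> A \<in> alcoves P \<Longrightarrow> \<omega> ` A \<in> alcoves P"
  by (induction \<omega> rule: Omega_induct) (simp_all only: image_id id_apply image_ident image_comp[symmetric] reflection_alcove)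

lemma Omega_facet: "\<omega> \<in> Omega P \<Longrightarrow> F facet_of closure A \<Longrightarrow> \<omega> ` F facet_of closure (\<omega> ` A)"
  by (induction \<omega> rule: Omega_induct) (simp_all only: image_id id_apply image_ident image_comp[symmetric] reflection_facet)

lemma Omega_affine_hull: "\<omega> \<in> Omega P \<Longrightarrow> affine hull (\<omega> ` S) = \<omega> ` (affine hull S)"
  by (induction \<omega> rule: Omega_induct) (simp_all only: image_id id_apply image_ident image_comp[symmetric] reflection_affine_hull)

lemma image_image_comp: "(`) (f \<circ> g) ` X = (`) f ` (`) g ` X"
  by (simp only: image_image[of "(`) f" "(`) g"] image_comp[of f g])

lemma Omega_separating:
  assumes "\<omega> \<in> Omega P" "A \<in> alcoves P" "B \<in> alcoves P"
  shows "separating P (\<omega> ` A) (\<omega> ` B) = (`) \<omega> ` separating P A B"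
  using assms(1)
proof (induction rule: Omega_induct)
  case (reflection H \<omega>)
  have "separating P ((reflection H \<circ> \<omega>) ` A) ((reflection H \<circ> \<omega>) ` B)
      = separating P (reflection H ` \<omega> ` A) (reflection H ` \<omega> ` B)"
    by (simp only: image_comp)
  also have "\<dots> = (`) (reflection H) ` (`) \<omega> ` separating P A B"
    using reflection_separating_image[OF reflection(1) Omega_alcove[OF reflection(2) assms(2)]
        Omega_alcove[OF reflection(2) assms(3)]] reflection(3) by (rule subst[rotated])
  finally show ?case by (rule trans[OF _ image_image_comp[symmetric]])
qed simp

lemma Omega_conjugate:
  assumes "\<omega> \<in> Omega P" "K \<in> hyperplanes P"
  shows "reflection (\<omega> ` K) (\<omega> x) = \<omega> (reflection K x)"
  using assms(1)
proof (induction arbitrary: x rule: Omega_induct)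
  case (reflection H \<omega>)
  have "reflection (reflection H ` \<omega> ` K) (reflection H (\<omega> x)) = reflection H (reflection (\<omega> ` K) (\<omega> x))"
    using fun_cong[OF reflection_conjugate[OF reflection(1) Omega_hyperplane[OF reflection(2) assms(2)]], of "\<omega> x"]
    by simp
  then have "reflection ((reflection H \<circ> \<omega>) ` K) (reflection H (\<omega> x)) = reflection H (\<omega> (reflection K x))"
    by (simp only: reflection(3) image_comp)
  then show ?case by (simp only: comp_def[of "reflection H" \<omega>])
qed simp

subsection \<open>Simple transitivity on alcoves\<close>

lemma walls_word_in_Omega: "A \<in> alcoves P \<Longrightarrow> set Hs \<subseteq> walls A \<Longrightarrow> refl_word Hs \<in> Omega P"
  using walls_hyperplanes unfolding Omega_eq by blast

lemma walls_word_reaches: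
  assumes A: "A \<in> alcoves P" and "B \<in> alcoves P"
  shows "\<exists>Hs. set Hs \<subseteq> walls A \<and> B = refl_word Hs ` A"
  using assms(2)
proof (induction "card (separating P A B)" arbitrary: B rule: less_induct)
  case less
  show ?case
  proof (cases "A = B")
    case True
    then show ?thesis by (intro exI[of _ "[]"]) simp
  next
    case False
    then obtain H where H: "H \<in> walls A" "H \<in> separating P A B"
      using exists_separating_wall A less.prems by metis
    have Hh: "H \<in> hyperplanes P" using walls_hyperplanes[OF A] H by blast
    obtain Hs where "set Hs \<subseteq> walls A" "reflection H ` B = refl_word Hs ` A"
      using less.hyps[OF card_separating_step[OF A less.prems H] reflection_alcove[OF Hh less.prems]] by blast
    then show ?thesis using reflection_image_image[OF Hh, of B] H(1)
      by (intro exI[of _ "H # Hs"]) (simp cong del: image_cong_simp)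
  qed
qed

lemma Omega_transitive:
  assumes "A \<in> alcoves P" "B \<in> alcoves P" obtains \<omega> where "\<omega> \<in> Omega P" "B = \<omega> ` A"
  using walls_word_reaches[OF assms] walls_word_in_Omega[OF assms(1)] by blast

text \<open>Every K separates A from some alcove, for instance from its mirror image. A wall H of A
  on the way to that alcove carries K to a hyperplane closer to A, and conjugating the word found
  there with H gives one for K.\<close>

lemma reflection_walls_word:
  assumes A: "A \<in> alcoves P" and K: "K \<in> hyperplanes P"
  shows "\<exists>Hs. set Hs \<subseteq> walls A \<and> reflection K = refl_word Hs"
proof -
  \<comment> \<open>The alcove \<open>B\<close> beyond \<open>K\<close> is introduced only to have
    the number of hyperplanes between \<open>A\<close> and \<open>B\<close> as induction
    measure.\<close>
  have "\<exists>Hs. set Hs \<subseteq> walls A \<and> reflection K = refl_word Hs"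
    if "B \<in> alcoves P" "K \<in> separating P A B" for B K
    using that
  proof (induction "card (separating P A B)" arbitrary: B K rule: less_induct)
    case less
    note B = less.prems(1)
    then have "A \<noteq> B" using less.prems separating_empty_iff[OF A B] by blast
    then obtain H where H: "H \<in> walls A" "H \<in> separating P A B"
      using exists_separating_wall A B by metis
    have Hh: "H \<in> hyperplanes P" using walls_hyperplanes[OF A] H by blast
    have Kh: "K \<in> hyperplanes P" using separating_hyperplane less.prems by blast
    show ?case
    proof (cases "K = H")
      case True
      then show ?thesis using H by (intro exI[of _ "[H]"]) simp
    next
      case False
      have "K \<in> separating P (reflection H ` A) B"
        using separating_step[OF A B H(1)] H(2) less.prems(2) False by simp
      then have K': "reflection H ` K \<in> separating P A (reflection H ` B)"
        using reflection_separating[OF Hh reflection_alcove[OF Hh A] B Kh] reflection_image_image[OF Hh, of A] by simp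
      obtain Hs where Hs: "set Hs \<subseteq> walls A" "reflection (reflection H ` K) = refl_word Hs"
        using less.hyps[OF card_separating_step[OF A B H] reflection_alcove[OF Hh B] K'] by blast
      have "reflection K x = refl_word (H # Hs @ [H]) x" for x
        using fun_cong[OF reflection_conjugate[OF Hh Kh], of x] reflection_reflection[OF Hh]
        by (simp add: Hs(2)[symmetric])
      then show ?thesis using Hs H by (intro exI[of _ "H # Hs @ [H]"]) auto
    qed
  qed
  then show ?thesis using reflection_alcove[OF K A] separating_reflection[OF K A] by blast
qed

lemma Omega_walls_word:
  assumes A: "A \<in> alcoves P" and "\<omega> \<in> Omega P"
  shows "\<exists>Hs. set Hs \<subseteq> walls A \<and> \<omega> = refl_word Hs"
  using assms(2)
proof (induction rule: Omega_induct)
  case id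
  show ?case by (intro exI[of _ "[]"]) simp
next
  case (reflection H \<omega>)
  then obtain Hs Ks where "set Hs \<subseteq> walls A" "\<omega> = refl_word Hs" "set Ks \<subseteq> walls A" "reflection H = refl_word Ks"
    using reflection_walls_word[OF A] by metis
  then show ?case by (intro exI[of _ "Ks @ Hs"]) (simp add: refl_word_append)
qed

text \<open>The exchange condition: the gallery \<open>A\<close>, \<open>H\<^sub>1A\<close>, \<open>H\<^sub>1H\<^sub>2A\<close>, \<dots> has to cross \<open>H\<close>, and the part
  before the crossing can be reflected in \<open>H\<close>.\<close>

lemma walls_word_exchange:
  assumes A: "A \<in> alcoves P" and H: "H \<in> walls A"
  shows "set Hs \<subseteq> walls A \<Longrightarrow> H \<in> separating P A (refl_word Hs ` A) \<Longrightarrow>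
    \<exists>Ks. set Ks \<subseteq> walls A \<and> length Ks < length Hs \<and> refl_word Hs = reflection H \<circ> refl_word Ks"
proof (induction Hs rule: rev_induct)
  case Nil
  then show ?case using separating_empty_iff[OF A A] by simp
next
  case (snoc K Hs)
  let ?\<omega> = "refl_word Hs"
  have Hh: "H \<in> hyperplanes P" using walls_hyperplanes[OF A] H by blast
  have \<omega>: "?\<omega> \<in> Omega P" using walls_word_in_Omega[OF A] snoc.prems by simp
  have K: "K \<in> walls A" "K \<in> hyperplanes P" using snoc.prems walls_hyperplanes[OF A] by auto
  show ?case
  proof (cases "H \<in> separating P A (?\<omega> ` A)")
    case True
    moreover have "set Hs \<subseteq> walls A" using snoc.prems by simp
    ultimately obtain Ks where "set Ks \<subseteq> walls A" "length Ks < length Hs" "?\<omega> = reflection H \<circ> refl_word Ks"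
      using snoc.IH by blast
    then show ?thesis using K by (intro exI[of _ "Ks @ [K]"]) (simp add: refl_word_append comp_assoc)
  next
    case False
    have "H \<in> separating P (?\<omega> ` A) (?\<omega> ` reflection K ` A)"
      using separating_symdiff[OF A Omega_alcove[OF \<omega> A] Omega_alcove[OF \<omega> reflection_alcove[OF K(2) A]], of H]
        False snoc.prems(2)[unfolded refl_word_append_image refl_word_singleton] by blast
    then have "H = ?\<omega> ` K"
      using Omega_separating[OF \<omega> A reflection_alcove[OF K(2) A]] separating_across_wall[OF A K(1)] by simp
    then have "refl_word (Hs @ [K]) = reflection H \<circ> ?\<omega>" using Omega_conjugate[OF \<omega> K(2)] by (simp add: fun_eq_iff)
    then show ?thesis using snoc.prems by (intro exI[of _ Hs]) simp
  qed
qed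

text \<open>If a word starting with H fixes A, the rest of it carries A to the neighbour across H.
  Exchange rewrites the rest as H followed by a shorter word, the two letters H cancel, and a
  shorter word for the same element remains.\<close>

lemma walls_word_free:
  assumes A: "A \<in> alcoves P"
  shows "set Hs \<subseteq> walls A \<Longrightarrow> refl_word Hs ` A = A \<Longrightarrow> refl_word Hs = id"
proof (induction "length Hs" arbitrary: Hs rule: less_induct)
  case less
  show ?case
  proof (cases Hs)
    case (Cons H Ks)
    have H: "H \<in> walls A" "H \<in> hyperplanes P" using less.prems Cons walls_hyperplanes[OF A] by auto
    have "refl_word Ks ` A = reflection H ` A"
      using less.prems(2) Cons reflection_image_image[OF H(2), of "refl_word Ks ` A"]
      by (simp cong del: image_cong_simp)
    then have "H \<in> separating P A (refl_word Ks ` A)" using separating_across_wall[OF A H(1)] by simp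
    moreover have "set Ks \<subseteq> walls A" using less.prems Cons by simp
    ultimately obtain Js where Js: "set Js \<subseteq> walls A" "length Js < length Ks"
        "refl_word Ks = reflection H \<circ> refl_word Js"
      using walls_word_exchange[OF A H(1)] by blast
    have e: "refl_word Hs = refl_word Js"
      by (rule ext) (simp add: Cons Js(3) reflection_reflection[OF H(2)])
    have "length Js < length Hs" using Js(2) Cons by simp
    moreover have "refl_word Js ` A = A" using less.prems(2) unfolding e .
    ultimately show ?thesis using less.hyps Js(1) unfolding e by blast
  qed simp
qed

lemma Omega_free: "\<omega> \<in> Omega P \<Longrightarrow> A \<in> alcoves P \<Longrightarrow> \<omega> ` A = A \<Longrightarrow> \<omega> = id"
  using Omega_walls_word walls_word_free by metis

end

section \<open>Types of faces and the affine Weyl group\<close>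

context affine_arrangement begin

lemma face_typesE:
  assumes "s \<in> face_types P"
  obtains F A where "A \<in> alcoves P" "F facet_of closure A" "s = {\<omega> ` F | \<omega>. \<omega> \<in> Omega P}"
  using assms by (auto simp: face_types_def faces_def)

lemma Omega_image_in_type:
  assumes "s \<in> face_types P" "F \<in> s" "\<omega> \<in> Omega P" shows "\<omega> ` F \<in> s"
proof -
  obtain F0 A0 where F0: "A0 \<in> alcoves P" "F0 facet_of closure A0" "s = {\<omega> ` F0 | \<omega>. \<omega> \<in> Omega P}"
    using face_typesE[OF assms(1)] .
  obtain \<rho> where "\<rho> \<in> Omega P" "F = \<rho> ` F0" using assms(2) unfolding F0(3) by blast
  then have "\<omega> ` F = (\<omega> \<circ> \<rho>) ` F0" "\<omega> \<circ> \<rho> \<in> Omega P" using Omega_comp[OF assms(3)] by (simp_all only: image_comp)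
  then show ?thesis unfolding F0(3) by blast
qed

lemma type_member_facet:
  assumes "s \<in> face_types P" "F \<in> s" obtains A where "A \<in> alcoves P" "F facet_of closure A"
proof -
  obtain F0 A0 where F0: "A0 \<in> alcoves P" "F0 facet_of closure A0" "s = {\<omega> ` F0 | \<omega>. \<omega> \<in> Omega P}"
    using face_typesE[OF assms(1)] .
  then obtain \<omega> where "\<omega> \<in> Omega P" "F = \<omega> ` F0" using assms(2) by auto
  then show thesis using that[of "\<omega> ` A0"] Omega_alcove F0 Omega_facet by simp
qed

lemma facet_has_type:
  assumes "A \<in> alcoves P" "F facet_of closure A" obtains s where "s \<in> face_types P" "F \<in> s"
proof -
  have "{\<omega> ` F | \<omega>. \<omega> \<in> Omega P} \<in> face_types P" using assms by (auto simp: face_types_def faces_def)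
  moreover have "F \<in> {\<omega> ` F | \<omega>. \<omega> \<in> Omega P}" using id_in_Omega by (intro CollectI exI[of _ id]) simp
  ultimately show thesis using that by blast
qed

lemma facet_of_type_exists:
  assumes "s \<in> face_types P" "A \<in> alcoves P" obtains F where "F \<in> s" "F facet_of closure A"
proof -
  obtain F0 A0 where F0: "A0 \<in> alcoves P" "F0 facet_of closure A0" "s = {\<omega> ` F0 | \<omega>. \<omega> \<in> Omega P}"
    using face_typesE[OF assms(1)] .
  obtain \<omega> where \<omega>: "\<omega> \<in> Omega P" "A = \<omega> ` A0" using Omega_transitive[OF F0(1) assms(2)] .
  have "\<omega> ` F0 \<in> s" using F0(3) \<omega>(1) by blast
  moreover have "\<omega> ` F0 facet_of closure A" unfolding \<omega>(2) by (rule Omega_facet[OF \<omega>(1) F0(2)])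
  ultimately show thesis using that by blast
qed

text \<open>Let \<omega> carry F to G. Then A and its image under \<omega> share the facet G, so
  they coincide or are neighbours across G. In the second case the reflection in G composed with
  \<omega> fixes A, hence is the identity; as this reflection fixes G pointwise, F = G
  again.\<close>

lemma facet_of_type_unique:
  assumes s: "s \<in> face_types P" and A: "A \<in> alcoves P"
    and F: "F \<in> s" "F facet_of closure A" and G: "G \<in> s" "G facet_of closure A"
  shows "F = G"
proof -
  obtain F0 A0 where F0: "A0 \<in> alcoves P" "F0 facet_of closure A0" "s = {\<omega> ` F0 | \<omega>. \<omega> \<in> Omega P}"
    using face_typesE[OF s] .
  obtain \<omega>1 where \<omega>1: "\<omega>1 \<in> Omega P" "F = \<omega>1 ` F0" using F(1) unfolding F0(3) by blast
  obtain \<omega>2 where \<omega>2: "\<omega>2 \<in> Omega P" "G = \<omega>2 ` F0" using G(1) unfolding F0(3) by blast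
  obtain \<rho> where \<rho>: "\<rho> \<in> Omega P" "\<rho> \<circ> \<omega>1 = id" using Omega_inverse[OF \<omega>1(1)] by blast
  define \<omega> where "\<omega> = \<omega>2 \<circ> \<rho>"
  have \<omega>: "\<omega> \<in> Omega P" using Omega_comp[OF \<omega>2(1) \<rho>(1)] by (simp only: \<omega>_def)
  have "\<omega> ` F = \<omega>2 ` (\<rho> \<circ> \<omega>1) ` F0" unfolding \<omega>_def \<omega>1(2) by (simp only: image_comp comp_assoc)
  then have \<omega>F: "\<omega> ` F = G" using \<rho>(2) \<omega>2(2) by simp
  let ?H = "affine hull G"
  have H: "?H \<in> walls A" "?H \<in> hyperplanes P" using wallsI[OF G(2)] walls_hyperplanes[OF A] by auto
  have facet: "G facet_of closure (\<omega> ` A)" using Omega_facet[OF \<omega> F(2)] \<omega>F by simp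
  show ?thesis
  proof (cases "\<omega> ` A = A")
    case True
    then have "\<omega> = id" using Omega_free[OF \<omega> A] by simp
    then show ?thesis using \<omega>F by simp
  next
    case False
    then have "\<omega> ` A = reflection ?H ` A"
      using facet_adjacent[OF A Omega_alcove[OF \<omega> A] G(2) facet] by simp
    then have "(reflection ?H \<circ> \<omega>) ` A = A"
      using reflection_image_image[OF H(2), of A] by (simp only: image_comp[symmetric])
    then have "reflection ?H \<circ> \<omega> = id"
      using Omega_free[OF Omega_comp[OF reflection_in_Omega[OF H(2)] \<omega>] A] by simp
    then have "reflection ?H ` \<omega> ` F = F" by (simp only: image_comp image_id id_apply)
    then show ?thesis unfolding \<omega>F using reflection_image_id[OF H(2) hull_subset] by simp
  qed
qed

text \<open>The mirror image in the wall satisfies the description; it is the only solution because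
  A has one facet of each type and one neighbour across each facet.\<close>

lemma type_invol_eq:
  assumes s: "s \<in> face_types P" and A: "A \<in> alcoves P" and F: "F \<in> s" "F facet_of closure A"
  shows "type_invol P s A = reflection (affine hull F) ` A"
proof -
  let ?H = "affine hull F"
  have H: "?H \<in> walls A" "?H \<in> hyperplanes P" using wallsI[OF F(2)] walls_hyperplanes[OF A] by auto
  have "(THE B. B \<in> alcoves P \<and> B \<noteq> A \<and> (\<exists>F\<in>s. F facet_of closure A \<and> F facet_of closure B))
      = reflection ?H ` A"
  proof (rule the_equality)
    have "reflection ?H ` A \<noteq> A"
      using separating_reflection[OF H(2) A] separating_empty_iff[OF A A] by auto
    moreover have "F facet_of closure (reflection ?H ` A)"
      using reflection_facet[OF H(2) F(2)] reflection_image_id[OF H(2) hull_subset] by simp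
    ultimately show "reflection ?H ` A \<in> alcoves P \<and> reflection ?H ` A \<noteq> A \<and>
        (\<exists>F'\<in>s. F' facet_of closure A \<and> F' facet_of closure (reflection ?H ` A))"
      using reflection_alcove[OF H(2) A] F by blast
  next
    fix B assume B: "B \<in> alcoves P \<and> B \<noteq> A \<and> (\<exists>F\<in>s. F facet_of closure A \<and> F facet_of closure B)"
    then obtain G where G: "G \<in> s" "G facet_of closure A" "G facet_of closure B" by blast
    have "G = F" using facet_of_type_unique[OF s A G(1,2) F] .
    then show "B = reflection ?H ` A" using facet_adjacent[OF A _ F(2), of B] B G by blast
  qed
  then show ?thesis using A by (simp add: type_invol_def)
qed

lemma type_invol_alcove: "s \<in> face_types P \<Longrightarrow> A \<in> alcoves P \<Longrightarrow> type_invol P s A \<in> alcoves P"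
proof -
  assume s: "s \<in> face_types P" and A: "A \<in> alcoves P"
  obtain F where F: "F \<in> s" "F facet_of closure A" using facet_of_type_exists[OF s A] .
  have "affine hull F \<in> hyperplanes P" using wallsI[OF F(2)] walls_hyperplanes[OF A] by blast
  then show ?thesis using type_invol_eq[OF s A F] reflection_alcove[OF _ A] by simp
qed

lemma type_invol_invol:
  assumes s: "s \<in> face_types P" and A: "A \<in> alcoves P"
  shows "type_invol P s (type_invol P s A) = A"
proof -
  obtain F where F: "F \<in> s" "F facet_of closure A" using facet_of_type_exists[OF assms] .
  let ?H = "affine hull F"
  have H: "?H \<in> hyperplanes P" using wallsI[OF F(2)] walls_hyperplanes[OF A] by auto
  have e: "type_invol P s A = reflection ?H ` A" using type_invol_eq[OF assms F] .
  have "F facet_of closure (reflection ?H ` A)"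
    using reflection_facet[OF H F(2)] reflection_image_id[OF H hull_subset] by simp
  then have "type_invol P s (reflection ?H ` A) = reflection ?H ` reflection ?H ` A"
    using type_invol_eq[OF s reflection_alcove[OF H A] F(1)] by simp
  then show ?thesis unfolding e using reflection_image_image[OF H] by simp
qed

lemma type_invol_Omega:
  assumes s: "s \<in> face_types P" and A: "A \<in> alcoves P" and \<omega>: "\<omega> \<in> Omega P"
  shows "type_invol P s (\<omega> ` A) = \<omega> ` type_invol P s A"
proof -
  obtain F where F: "F \<in> s" "F facet_of closure A" using facet_of_type_exists[OF s A] .
  let ?H = "affine hull F"
  have H: "?H \<in> hyperplanes P" using wallsI[OF F(2)] walls_hyperplanes[OF A] by auto
  have "type_invol P s (\<omega> ` A) = reflection (affine hull (\<omega> ` F)) ` \<omega> ` A"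
    using type_invol_eq[OF s Omega_alcove[OF \<omega> A] Omega_image_in_type[OF s F(1) \<omega>] Omega_facet[OF \<omega> F(2)]] .
  also have "\<dots> = \<omega> ` reflection ?H ` A"
    unfolding Omega_affine_hull[OF \<omega>] image_image Omega_conjugate[OF \<omega> H] ..
  finally show ?thesis using type_invol_eq[OF s A F] by simp
qed

lemma type_invol_Bij: "s \<in> face_types P \<Longrightarrow> type_invol P s \<in> Bij (alcoves P)"
proof -
  assume s: "s \<in> face_types P"
  have "bij_betw (type_invol P s) (alcoves P) (alcoves P)"
    by (rule bij_betw_byWitness[where f'="type_invol P s"])
      (auto simp: type_invol_invol[OF s] type_invol_alcove[OF s])
  moreover have "type_invol P s \<in> extensional (alcoves P)" by (simp add: type_invol_def)
  ultimately show ?thesis by (simp add: Bij_def)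
qed

section \<open>The group W, its words and its simple transitivity on alcoves\<close>

abbreviation W where "W \<equiv> carrier (affine_weyl P)"
abbreviation mult_W (infixl "\<bullet>\<^sub>W" 70) where "u \<bullet>\<^sub>W w \<equiv> u \<otimes>\<^bsub>affine_weyl P\<^esub> w"
abbreviation one_W ("\<one>\<^sub>W") where "\<one>\<^sub>W \<equiv> \<one>\<^bsub>affine_weyl P\<^esub>"

lemma simple_gens_Bij: "simple_gens P \<subseteq> Bij (alcoves P)"
  using type_invol_Bij by (auto simp: simple_gens_def)

lemma group_affine_weyl: "group (affine_weyl P)"
  and W_Bij: "W \<subseteq> Bij (alcoves P)"
proof -
  have sub: "subgroup (generate (BijGroup (alcoves P)) (simple_gens P)) (BijGroup (alcoves P))"
    using simple_gens_Bij by (intro group.generate_is_subgroup group_BijGroup) (simp add: BijGroup_def)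
  show "group (affine_weyl P)" unfolding affine_weyl_def
    by (rule group.subgroup_imp_group[OF group_BijGroup sub])
  have "carrier (BijGroup (alcoves P)) = Bij (alcoves P)" by (simp add: BijGroup_def)
  then show "W \<subseteq> Bij (alcoves P)" using subgroup.subset[OF sub] by (simp add: affine_weyl_def)
qed

interpretation Wgrp: group "affine_weyl P" by (rule group_affine_weyl)

lemma W_mult_apply:
  assumes "u \<in> W" "w \<in> W" "A \<in> alcoves P" shows "(u \<bullet>\<^sub>W w) A = u (w A)"
proof -
  have "u \<in> Bij (alcoves P)" "w \<in> Bij (alcoves P)" using assms W_Bij by blast+
  moreover have "u \<bullet>\<^sub>W w = u \<otimes>\<^bsub>BijGroup (alcoves P)\<^esub> w" by (simp add: affine_weyl_def)
  ultimately show ?thesis using assms(3) by (simp add: BijGroup_def compose_def)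
qed

lemma W_one_apply: "A \<in> alcoves P \<Longrightarrow> \<one>\<^sub>W A = A"
  by (simp add: affine_weyl_def BijGroup_def)

lemma W_alcove: assumes "w \<in> W" "A \<in> alcoves P" shows "w A \<in> alcoves P"
proof -
  have "w \<in> alcoves P \<rightarrow> alcoves P" using assms(1) W_Bij by (intro Bij_imp_funcset) blast
  then show ?thesis using assms(2) by (rule funcset_mem)
qed

lemma W_ext:
  assumes "u \<in> W" "w \<in> W" "\<And>A. A \<in> alcoves P \<Longrightarrow> u A = w A" shows "u = w"
proof (rule extensionalityI)
  show "u \<in> extensional (alcoves P)" "w \<in> extensional (alcoves P)"
    using subsetD[OF W_Bij assms(1)] subsetD[OF W_Bij assms(2)] by (simp_all add: Bij_imp_extensional)
qed (rule assms(3))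

lemma simple_gens_W: "simple_gens P \<subseteq> W"
  by (auto simp: affine_weyl_def intro: generate.incl)

lemma simple_gen_invol:
  assumes "s \<in> simple_gens P" "A \<in> alcoves P" shows "s (s A) = A"
proof -
  obtain t where "t \<in> face_types P" "s = type_invol P t" using assms(1) by (auto simp: simple_gens_def)
  then show ?thesis using type_invol_invol assms(2) by simp
qed

lemma simple_gen_square: "s \<in> simple_gens P \<Longrightarrow> s \<bullet>\<^sub>W s = \<one>\<^sub>W"
proof -
  assume s: "s \<in> simple_gens P"
  then have "s \<in> W" using simple_gens_W by blast
  then show ?thesis
    using s by (intro W_ext Wgrp.m_closed Wgrp.one_closed) (simp_all add: W_mult_apply W_one_apply simple_gen_invol)
qed

lemma simple_gen_cancel_left: "s \<in> simple_gens P \<Longrightarrow> w \<in> W \<Longrightarrow> s \<bullet>\<^sub>W (s \<bullet>\<^sub>W w) = w"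
  using subsetD[OF simple_gens_W, of s] simple_gen_square[of s] by (simp add: Wgrp.m_assoc[symmetric])

lemma simple_gen_cancel_right: "s \<in> simple_gens P \<Longrightarrow> w \<in> W \<Longrightarrow> w \<bullet>\<^sub>W s \<bullet>\<^sub>W s = w"
  using subsetD[OF simple_gens_W, of s] simple_gen_square[of s] by (simp add: Wgrp.m_assoc)

lemma word_prod_simps [simp]:
  "word_prod P [] = \<one>\<^sub>W" "word_prod P (s # ss) = s \<bullet>\<^sub>W word_prod P ss"
  by (simp_all add: word_prod_def)

lemma word_prod_W: "set ss \<subseteq> simple_gens P \<Longrightarrow> word_prod P ss \<in> W"
  by (induction ss) (use simple_gens_W in auto)

lemma word_prod_append:
  "set ss \<subseteq> simple_gens P \<Longrightarrow> set ts \<subseteq> simple_gens P \<Longrightarrow>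
    word_prod P (ss @ ts) = word_prod P ss \<bullet>\<^sub>W word_prod P ts"
proof (induction ss)
  case (Cons s ss)
  then have "s \<in> W" "word_prod P ss \<in> W" "word_prod P ts \<in> W" using simple_gens_W word_prod_W by auto
  then show ?case using Cons by (simp add: Wgrp.m_assoc)
qed (simp add: word_prod_W)

lemma W_word:
  assumes "w \<in> W" obtains ss where "set ss \<subseteq> simple_gens P" "w = word_prod P ss"
proof -
  let ?B = "BijGroup (alcoves P)"
  have mult: "u \<bullet>\<^sub>W w = u \<otimes>\<^bsub>?B\<^esub> w" for u w by (simp add: affine_weyl_def)
  have one: "\<one>\<^sub>W = \<one>\<^bsub>?B\<^esub>" by (simp add: affine_weyl_def)
  have inv: "inv\<^bsub>?B\<^esub> s = s" if "s \<in> simple_gens P" for s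
    using simple_gen_square[OF that] simple_gens_Bij that unfolding mult one
    by (intro group.inv_equality[OF group_BijGroup]) (auto simp: BijGroup_def)
  have "w \<in> generate ?B (simple_gens P)" using assms by (simp add: affine_weyl_def)
  then have "\<exists>ss. set ss \<subseteq> simple_gens P \<and> w = word_prod P ss"
  proof induction
    case one
    show ?case by (rule exI[of _ "[]"]) (simp add: \<open>\<one>\<^sub>W = \<one>\<^bsub>?B\<^esub>\<close>)
  next
    case (incl h)
    then show ?case using simple_gens_W by (intro exI[of _ "[h]"]) auto
  next
    case (inv h)
    then have "inv\<^bsub>?B\<^esub> h = h" using \<open>\<And>s. s \<in> simple_gens P \<Longrightarrow> inv\<^bsub>?B\<^esub> s = s\<close> by blast
    then show ?case using simple_gens_W inv by (intro exI[of _ "[h]"]) auto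
  next
    case (eng u w)
    then obtain ss ts where "set ss \<subseteq> simple_gens P" "u = word_prod P ss" "set ts \<subseteq> simple_gens P" "w = word_prod P ts"
      by blast
    then show ?case using word_prod_append[of ss ts] by (intro exI[of _ "ss @ ts"]) (simp add: mult)
  qed
  then show thesis using that by blast
qed

lemma W_Omega:
  assumes "w \<in> W" "A \<in> alcoves P" "\<omega> \<in> Omega P" shows "w (\<omega> ` A) = \<omega> ` w A"
proof -
  obtain ss where ss: "set ss \<subseteq> simple_gens P" "w = word_prod P ss" using W_word[OF assms(1)] .
  have "word_prod P ss (\<omega> ` A) = \<omega> ` word_prod P ss A" using ss(1)
  proof (induction ss)
    case Nil
    then show ?case using assms Omega_alcove by (simp add: W_one_apply)
  next
    case (Cons s ss)
    then have W: "s \<in> W" "word_prod P ss \<in> W" using simple_gens_W word_prod_W by auto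
    obtain t where t: "t \<in> face_types P" "s = type_invol P t" using Cons.prems by (auto simp: simple_gens_def)
    have "word_prod P (s # ss) (\<omega> ` A) = s (\<omega> ` word_prod P ss A)"
      using Cons W assms Omega_alcove by (simp add: W_mult_apply)
    also have "\<dots> = \<omega> ` s (word_prod P ss A)"
      unfolding t(2) by (rule type_invol_Omega[OF t(1) W_alcove[OF W(2) assms(2)] assms(3)])
    finally show ?case using W assms by (simp add: W_mult_apply)
  qed
  then show ?thesis using ss(2) by simp
qed

text \<open>W commutes with the reflection group, which is transitive on alcoves, so the image of a
  single alcove determines all the others.\<close>

lemma W_free: assumes "u \<in> W" "w \<in> W" "A \<in> alcoves P" "u A = w A" shows "u = w"
proof (rule W_ext[OF assms(1,2)])
  fix B assume "B \<in> alcoves P"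
  then obtain \<omega> where "\<omega> \<in> Omega P" "B = \<omega> ` A" using Omega_transitive[OF assms(3)] by blast
  then show "u B = w B" using W_Omega[OF assms(1,3)] W_Omega[OF assms(2,3)] assms(4) by simp
qed

lemma simple_gen_wall:
  assumes "s \<in> simple_gens P" "B \<in> alcoves P"
  obtains H t F where "H \<in> walls B" "s B = reflection H ` B"
    "t \<in> face_types P" "s = type_invol P t" "F \<in> t" "affine hull F = H"
proof -
  obtain t where t: "t \<in> face_types P" "s = type_invol P t" using assms(1) by (auto simp: simple_gens_def)
  obtain F where F: "F \<in> t" "F facet_of closure B" using facet_of_type_exists[OF t(1) assms(2)] .
  show thesis using that[OF wallsI[OF F(2)] _ t F(1) refl] type_invol_eq[OF t(1) assms(2) F] t(2) by simp
qed

lemma wall_simple_gen: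
  assumes "H \<in> walls B" "B \<in> alcoves P"
  obtains s where "s \<in> simple_gens P" "s B = reflection H ` B"
proof -
  obtain F where F: "F facet_of closure B" "H = affine hull F" using assms(1) by (auto simp: walls_def)
  obtain t where t: "t \<in> face_types P" "F \<in> t" using facet_has_type[OF assms(2) F(1)] .
  then show thesis using that[of "type_invol P t"] type_invol_eq[OF t(1) assms(2) t(2) F(1)] F(2)
    by (simp add: simple_gens_def)
qed

lemma separating_step_right:
  assumes "A \<in> alcoves P" "B \<in> alcoves P" "H \<in> walls B"
  shows "separating P A (reflection H ` B) =
    (if H \<in> separating P A B then separating P A B - {H} else insert H (separating P A B))"
proof -
  have "reflection H ` B \<in> alcoves P"
    using assms reflection_alcove walls_hyperplanes by blast
  then show ?thesis
    using separating_step[OF assms(2,1,3)] separating_commute assms by metis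
qed

text \<open>Left multiplication by a generator crosses a wall of the current alcove; crossing
  separating walls of B leads back to A.\<close>

lemma W_transitive:
  assumes A: "A \<in> alcoves P" and "B \<in> alcoves P"
  shows "\<exists>w\<in>W. B = w A"
  using assms(2)
proof (induction "card (separating P A B)" arbitrary: B rule: less_induct)
  case less
  show ?case
  proof (cases "B = A")
    case True
    then show ?thesis using W_one_apply[OF A] Wgrp.one_closed by metis
  next
    case False
    obtain H where H: "H \<in> walls B" "H \<in> separating P B A"
      using exists_separating_wall[OF less.prems A False] .
    obtain s where s: "s \<in> simple_gens P" "s B = reflection H ` B" using wall_simple_gen[OF H(1) less.prems] .
    have sW: "s \<in> W" using s simple_gens_W by blast
    have HA: "H \<in> separating P A B" using H(2) separating_commute[OF A less.prems] by simp
    have "card (separating P A (s B)) < card (separating P A B)"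
      using separating_step_right[OF A less.prems H(1)] HA s(2)
        card_Diff1_less[OF finite_separating[OF A less.prems] HA] by simp
    then obtain w where w: "w \<in> W" "s B = w A" using less.hyps W_alcove[OF sW less.prems] by blast
    have "B = (s \<bullet>\<^sub>W w) A" using w sW simple_gen_invol[OF s(1) less.prems] by (simp add: W_mult_apply A)
    then show ?thesis using w(1) sW by blast
  qed
qed

subsection \<open>Length\<close>

lemma card_separating_word:
  assumes "A \<in> alcoves P" "set ss \<subseteq> simple_gens P"
  shows "card (separating P A (word_prod P ss A)) \<le> length ss"
  using assms(2)
proof (induction ss)
  case Nil
  then show ?case using separating_empty_iff[OF assms(1) assms(1)] assms(1) by (simp add: W_one_apply)
next
  case (Cons s ss)
  let ?B = "word_prod P ss A"
  have W: "s \<in> simple_gens P" "s \<in> W" "word_prod P ss \<in> W" using Cons.prems simple_gens_W word_prod_W by auto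
  then have B: "?B \<in> alcoves P" using W_alcove assms(1) by blast
  obtain H where H: "H \<in> walls ?B" "s ?B = reflection H ` ?B" using simple_gen_wall[OF W(1) B] by blast
  have "separating P A (s ?B) \<subseteq> insert H (separating P A ?B)"
    unfolding H(2) separating_step_right[OF assms(1) B H(1)] by auto
  then have "card (separating P A (s ?B)) \<le> card (insert H (separating P A ?B))"
    using finite_separating[OF assms(1) B] by (intro card_mono) auto
  also have "\<dots> \<le> Suc (card (separating P A ?B))" by (rule card_insert_le_m1) simp_all
  finally show ?case using Cons W assms(1) by (simp add: W_mult_apply)
qed

lemma exists_word_card_separating:
  assumes A: "A \<in> alcoves P" and "w \<in> W"
  shows "\<exists>ss. set ss \<subseteq> simple_gens P \<and> length ss = card (separating P A (w A)) \<and> word_prod P ss = w"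
  using assms(2)
proof (induction "card (separating P A (w A))" arbitrary: w rule: less_induct)
  case less
  note w = less.prems
  let ?B = "w A"
  have B: "?B \<in> alcoves P" using W_alcove w A by blast
  show ?case
  proof (cases "?B = A")
    case True
    then have "w = \<one>\<^sub>W" using W_free[OF w Wgrp.one_closed A] W_one_apply[OF A] by simp
    moreover have "separating P A ?B = {}" using True separating_empty_iff[OF A A] by simp
    ultimately show ?thesis by (intro exI[of _ "[]"]) simp
  next
    case False
    obtain H where H: "H \<in> walls ?B" "H \<in> separating P ?B A"
      using exists_separating_wall[OF B A False] .
    obtain s where s: "s \<in> simple_gens P" "s ?B = reflection H ` ?B" using wall_simple_gen[OF H(1) B] .
    have sW: "s \<in> W" using s simple_gens_W by blast
    have HA: "H \<in> separating P A ?B" using H(2) separating_commute[OF A B] by simp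
    have sw: "(s \<bullet>\<^sub>W w) A = s ?B" using W_mult_apply[OF sW w A] .
    have c: "separating P A ((s \<bullet>\<^sub>W w) A) = separating P A ?B - {H}"
      using separating_step_right[OF A B H(1)] HA s(2) sw by simp
    have fin: "finite (separating P A ?B)" using finite_separating[OF A B] .
    have lt: "card (separating P A ((s \<bullet>\<^sub>W w) A)) < card (separating P A ?B)"
      unfolding c using card_Diff1_less[OF fin HA] .
    obtain ss where ss: "set ss \<subseteq> simple_gens P"
      "length ss = card (separating P A ((s \<bullet>\<^sub>W w) A))" "word_prod P ss = s \<bullet>\<^sub>W w"
      using less.hyps[of "s \<bullet>\<^sub>W w", OF lt Wgrp.m_closed[OF sW w]] by blast
    have "length (s # ss) = card (separating P A ?B)"
      using ss(2) unfolding c using card_Suc_Diff1[OF fin HA] by simp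
    then show ?thesis using ss s simple_gen_cancel_left[OF s(1) w] by (intro exI[of _ "s # ss"]) simp
  qed
qed

text \<open>Each letter of a word changes the set of separating hyperplanes by one wall, and a word
  crossing only separating walls exists. The freedom in the base alcove is essential later:
  \<open>weyl_length_right\<close> uses the neighbour of A, and the final induction uses
  yA_0.\<close>

lemma weyl_length_eq:
  assumes "A \<in> alcoves P" "w \<in> W" shows "weyl_length P w = card (separating P A (w A))"
  unfolding weyl_length_def
proof (rule Least_equality)
  show "\<exists>ss. set ss \<subseteq> simple_gens P \<and> length ss = card (separating P A (w A)) \<and> word_prod P ss = w"
    by (rule exists_word_card_separating[OF assms])
  show "card (separating P A (w A)) \<le> n"
    if "\<exists>ss. set ss \<subseteq> simple_gens P \<and> length ss = n \<and> word_prod P ss = w" for n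
    using that card_separating_word[OF assms(1)] by blast
qed

end

section \<open>Lengths of products with a generator, descents and the Bruhat order\<close>

context affine_arrangement begin

interpretation Wgrp: group "affine_weyl P" by (rule group_affine_weyl)

text \<open>The vector \<gamma> defining positivity is positive on all positive coroots. Scaling it
  by \<open>t\<close> pushes the sum of these values, hence each of them, below 1 and yields a point
  of the fundamental alcove.\<close>

lemma fundamental_alcove: "fundamental_alcove P \<in> alcoves P"
proof -
  obtain \<gamma> where \<gamma>: "P = {\<alpha>\<in>\<Phi>. \<gamma> \<bullet> \<alpha> > 0}"
    using positive unfolding positive_roots_def by blast
  have pos: "0 < coroot \<alpha> \<gamma>" if "\<alpha> \<in> P" for \<alpha>
  proof -
    have "\<gamma> \<bullet> \<alpha> > 0" "\<alpha> \<noteq> 0" using that \<gamma> root_nonzero by auto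
    then show ?thesis by (simp add: coroot_def)
  qed
  define t where "t = 1 / (1 + (\<Sum>\<alpha>\<in>P. coroot \<alpha> \<gamma>))"
  have s: "0 \<le> (\<Sum>\<alpha>\<in>P. coroot \<alpha> \<gamma>)" using pos by (intro sum_nonneg) (simp add: less_imp_le)
  have t: "t > 0" unfolding t_def using s by simp
  have bnd: "0 < coroot \<alpha> (t *\<^sub>R \<gamma>) \<and> coroot \<alpha> (t *\<^sub>R \<gamma>) < 1" if "\<alpha> \<in> P" for \<alpha>
  proof -
    have "coroot \<alpha> \<gamma> \<le> (\<Sum>\<alpha>\<in>P. coroot \<alpha> \<gamma>)"
      using pos that finite_positive by (intro member_le_sum) (auto intro: less_imp_le)
    then have "t * coroot \<alpha> \<gamma> < 1" unfolding t_def using s by simp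
    then show ?thesis using pos[OF that] t by (simp add: coroot_scale)
  qed
  have ne: "\<not> (0 < c \<and> c < 1)" if "c = of_int n" for c :: real and n :: int
    using that by simp
  have gen: "t *\<^sub>R \<gamma> \<in> generic" unfolding generic_iff
  proof (intro ballI allI notI)
    fix \<alpha> and n :: int assume "\<alpha> \<in> \<Phi>" and n: "coroot \<alpha> (t *\<^sub>R \<gamma>) = n"
    then consider "\<alpha> \<in> P" | "- \<alpha> \<in> P" using root_cases by auto
    then show False
    proof cases
      case 1
      then show ?thesis using bnd ne[OF n] by blast
    next
      case 2
      have "coroot (- \<alpha>) (t *\<^sub>R \<gamma>) = of_int (- n)" using n by (simp add: coroot_uminus)
      then show ?thesis using bnd[OF 2] ne by blast
    qed
  qed
  have fl: "\<lfloor>coroot \<alpha> (t *\<^sub>R \<gamma>)\<rfloor> = 0" if "\<alpha> \<in> P" for \<alpha>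
    using bnd[OF that] by (simp add: floor_eq_iff)
  have "fundamental_alcove P = cell (t *\<^sub>R \<gamma>)"
    unfolding cell_strips[OF gen] fundamental_alcove_def using fl by auto
  then show ?thesis using gen by (simp add: alcoves_cell)
qed

lemma weyl_length_left:
  assumes A: "A \<in> alcoves P" and w: "w \<in> W" and s: "s \<in> simple_gens P"
    and H: "H \<in> walls (w A)" "s (w A) = reflection H ` w A"
  shows "if H \<in> separating P A (w A) then weyl_length P w = Suc (weyl_length P (s \<bullet>\<^sub>W w))
    else weyl_length P (s \<bullet>\<^sub>W w) = Suc (weyl_length P w)"
proof -
  have sW: "s \<in> W" using s simple_gens_W by blast
  have B: "w A \<in> alcoves P" using W_alcove[OF w A] .
  have fin: "finite (separating P A (w A))" using finite_separating[OF A B] .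
  have "separating P A ((s \<bullet>\<^sub>W w) A) =
      (if H \<in> separating P A (w A) then separating P A (w A) - {H} else insert H (separating P A (w A)))"
    using separating_step_right[OF A B H(1)] H(2) W_mult_apply[OF sW w A] by simp
  then show ?thesis
    using weyl_length_eq[OF A w] weyl_length_eq[OF A Wgrp.m_closed[OF sW w]] card_Suc_Diff1[OF fin]
      card_insert_disjoint[OF fin] by (auto split: if_splits)
qed

text \<open>The product ws maps the neighbour sA to wA. Taking sA as base alcove turns right
  multiplication into a move of the starting alcove across its wall H.\<close>

lemma weyl_length_right:
  assumes A: "A \<in> alcoves P" and w: "w \<in> W" and s: "s \<in> simple_gens P"
    and H: "H \<in> walls A" "s A = reflection H ` A"
  shows "if H \<in> separating P A (w A) then weyl_length P w = Suc (weyl_length P (w \<bullet>\<^sub>W s))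
    else weyl_length P (w \<bullet>\<^sub>W s) = Suc (weyl_length P w)"
proof -
  have sW: "s \<in> W" using s simple_gens_W by blast
  have B: "w A \<in> alcoves P" "s A \<in> alcoves P" using W_alcove[OF w A] W_alcove[OF sW A] .
  have fin: "finite (separating P A (w A))" using finite_separating[OF A B(1)] .
  have "(w \<bullet>\<^sub>W s) (s A) = w A" using W_mult_apply[OF w sW B(2)] simple_gen_invol[OF s A] by simp
  then have "weyl_length P (w \<bullet>\<^sub>W s) = card (separating P (reflection H ` A) (w A))"
    using weyl_length_eq[OF B(2) Wgrp.m_closed[OF w sW]] H(2) by simp
  then show ?thesis
    using separating_step[OF A B(1) H(1)] weyl_length_eq[OF A w] card_Suc_Diff1[OF fin]
      card_insert_disjoint[OF fin] by (auto split: if_splits)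
qed

lemma weyl_length_left_cases:
  assumes "s \<in> simple_gens P" "w \<in> W"
  shows "weyl_length P w = Suc (weyl_length P (s \<bullet>\<^sub>W w)) \<or> weyl_length P (s \<bullet>\<^sub>W w) = Suc (weyl_length P w)"
proof -
  let ?A = "fundamental_alcove P"
  obtain H where "H \<in> walls (w ?A)" "s (w ?A) = reflection H ` w ?A"
    using simple_gen_wall[OF assms(1) W_alcove[OF assms(2) fundamental_alcove]] by blast
  then show ?thesis
    using weyl_length_left[OF fundamental_alcove assms(2,1)] by (meson)
qed

lemma weyl_length_right_cases:
  assumes "s \<in> simple_gens P" "w \<in> W"
  shows "weyl_length P w = Suc (weyl_length P (w \<bullet>\<^sub>W s)) \<or> weyl_length P (w \<bullet>\<^sub>W s) = Suc (weyl_length P w)"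
proof -
  let ?A = "fundamental_alcove P"
  obtain H where "H \<in> walls ?A" "s ?A = reflection H ` ?A"
    using simple_gen_wall[OF assms(1) fundamental_alcove] by blast
  then show ?thesis
    using weyl_length_right[OF fundamental_alcove assms(2,1)] by (meson)
qed

lemma weyl_length_one: "weyl_length P \<one>\<^sub>W = 0"
  using weyl_length_eq[OF fundamental_alcove Wgrp.one_closed] W_one_apply[OF fundamental_alcove]
    separating_empty_iff[OF fundamental_alcove fundamental_alcove] by simp

lemma weyl_length_simple: "s \<in> simple_gens P \<Longrightarrow> weyl_length P s = 1"
  using weyl_length_left_cases[of s "\<one>\<^sub>W"] weyl_length_one subsetD[OF simple_gens_W, of s] by simp

lemma weyl_nontrivial_apply: "w \<in> W \<Longrightarrow> w \<noteq> \<one>\<^sub>W \<Longrightarrow> A \<in> alcoves P \<Longrightarrow> w A \<noteq> A"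
  using W_free[of w "\<one>\<^sub>W" A] W_one_apply[of A] by auto

lemma weyl_reduce_right:
  assumes w: "w \<in> W" "w \<noteq> \<one>\<^sub>W"
  obtains u s where "u \<in> W" "s \<in> simple_gens P" "w = u \<bullet>\<^sub>W s" "weyl_length P w = Suc (weyl_length P u)"
proof -
  let ?A = "fundamental_alcove P"
  note A = fundamental_alcove
  obtain H where H: "H \<in> walls ?A" "H \<in> separating P ?A (w ?A)"
    using exists_separating_wall[OF A W_alcove[OF w(1) A]] weyl_nontrivial_apply[OF w A] by metis
  obtain s where s: "s \<in> simple_gens P" "s ?A = reflection H ` ?A" using wall_simple_gen[OF H(1) A] .
  have "weyl_length P w = Suc (weyl_length P (w \<bullet>\<^sub>W s))"
    using weyl_length_right[OF A w(1) s(1) H(1) s(2)] H(2) by simp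
  moreover have "w = w \<bullet>\<^sub>W s \<bullet>\<^sub>W s" using simple_gen_cancel_right[OF s(1) w(1)] by simp
  moreover have "w \<bullet>\<^sub>W s \<in> W" using w(1) s(1) simple_gens_W by blast
  ultimately show thesis using that s(1) by blast
qed

lemma weyl_reduce_left:
  assumes w: "w \<in> W" "w \<noteq> \<one>\<^sub>W"
  obtains u s where "u \<in> W" "s \<in> simple_gens P" "w = s \<bullet>\<^sub>W u" "weyl_length P w = Suc (weyl_length P u)"
proof -
  let ?A = "fundamental_alcove P"
  note A = fundamental_alcove
  have B: "w ?A \<in> alcoves P" using W_alcove[OF w(1) A] .
  obtain H where H: "H \<in> walls (w ?A)" "H \<in> separating P (w ?A) ?A"
    using exists_separating_wall[OF B A weyl_nontrivial_apply[OF w A]] .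
  obtain s where s: "s \<in> simple_gens P" "s (w ?A) = reflection H ` w ?A" using wall_simple_gen[OF H(1) B] .
  have "weyl_length P w = Suc (weyl_length P (s \<bullet>\<^sub>W w))"
    using weyl_length_left[OF A w(1) s(1) H(1) s(2)] H(2) separating_commute[OF A B] by simp
  moreover have "w = s \<bullet>\<^sub>W (s \<bullet>\<^sub>W w)" using simple_gen_cancel_left[OF s(1) w(1)] by simp
  moreover have "s \<bullet>\<^sub>W w \<in> W" using w(1) s(1) simple_gens_W by blast
  ultimately show thesis using that s(1) by blast
qed

lemma weyl_length_mult_le:
  assumes "u \<in> W" "w \<in> W" shows "weyl_length P (u \<bullet>\<^sub>W w) \<le> weyl_length P u + weyl_length P w"
  using assms(1)
proof (induction "weyl_length P u" arbitrary: u rule: less_induct)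
  case less
  show ?case
  proof (cases "u = \<one>\<^sub>W")
    case True
    then show ?thesis using assms(2) by simp
  next
    case False
    then obtain v s where vs: "v \<in> W" "s \<in> simple_gens P" "u = s \<bullet>\<^sub>W v" "weyl_length P u = Suc (weyl_length P v)"
      using weyl_reduce_left[OF less.prems] by blast
    have sW: "s \<in> W" using vs(2) simple_gens_W by blast
    have "weyl_length P (u \<bullet>\<^sub>W w) = weyl_length P (s \<bullet>\<^sub>W (v \<bullet>\<^sub>W w))"
      using vs sW assms(2) by (simp add: Wgrp.m_assoc)
    also have "\<dots> \<le> Suc (weyl_length P (v \<bullet>\<^sub>W w))"
      using weyl_length_left_cases[OF vs(2) Wgrp.m_closed[OF vs(1) assms(2)]] by linarith
    finally show ?thesis using less.hyps[of v] vs by simp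
  qed
qed

text \<open>The Hecke relations are phrased with \<open>bruhat_less\<close>, the arguments here with
  lengths. A generator is a reflection, as its own conjugate by the identity, so one step of the
  transitive closure suffices.\<close>

lemma bruhat_less_simple:
  assumes s: "s \<in> simple_gens P" and w: "w \<in> W" and "weyl_length P w < weyl_length P (s \<bullet>\<^sub>W w)"
  shows "bruhat_less P w (s \<bullet>\<^sub>W w)"
proof -
  have sW: "s \<in> W" using s simple_gens_W by blast
  have "s = \<one>\<^sub>W \<bullet>\<^sub>W s \<bullet>\<^sub>W inv\<^bsub>affine_weyl P\<^esub> \<one>\<^sub>W" using sW by simp
  then have "s \<in> weyl_reflections P" unfolding weyl_reflections_def using s Wgrp.one_closed by blast
  then show ?thesis unfolding bruhat_less_def using assms by (intro tranclp.r_into_trancl) blast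
qed

lemma bruhat_less_simple':
  assumes s: "s \<in> simple_gens P" and w: "w \<in> W" and "weyl_length P (s \<bullet>\<^sub>W w) < weyl_length P w"
  shows "bruhat_less P (s \<bullet>\<^sub>W w) w"
proof -
  have sW: "s \<in> W" using s simple_gens_W by blast
  show ?thesis
    using bruhat_less_simple[OF s Wgrp.m_closed[OF sW w]] simple_gen_cancel_left[OF s w] assms(3) by simp
qed

subsection \<open>Weights of hyperplanes\<close>

text \<open>\<open>hyp_weight\<close> is a definite description that needs a face lying on the
  hyperplane. Crossing separating walls from A towards B must cross K at some moment, and there K is
  a wall.\<close>

lemma separating_is_wall:
  assumes "A \<in> alcoves P" "B \<in> alcoves P" "K \<in> separating P A B"
  shows "\<exists>D\<in>alcoves P. K \<in> walls D"
  using assms(1,3)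
proof (induction "card (separating P A B)" arbitrary: A rule: less_induct)
  case less
  note A = less.prems(1)
  have "A \<noteq> B" using less.prems(2) separating_empty_iff[OF A assms(2)] by blast
  then obtain H where H: "H \<in> walls A" "H \<in> separating P A B"
    using exists_separating_wall[OF A assms(2)] by blast
  show ?case
  proof (cases "K = H")
    case True
    then show ?thesis using H A by blast
  next
    case False
    have Hh: "H \<in> hyperplanes P" using walls_hyperplanes[OF A] H by blast
    have e: "separating P (reflection H ` A) B = separating P A B - {H}"
      using separating_step[OF A assms(2) H(1)] H(2) by simp
    have lt: "card (separating P (reflection H ` A) B) < card (separating P A B)"
      unfolding e by (rule card_Diff1_less[OF finite_separating[OF A assms(2)] H(2)])
    have "K \<in> separating P (reflection H ` A) B" unfolding e using False less.prems(2) by blast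
    then show ?thesis using less.hyps[OF lt reflection_alcove[OF Hh A]] by blast
  qed
qed

text \<open>If \<open>H\<close> supports faces of types \<open>s\<close> and \<open>t\<close>, then \<open>s\<close> and \<open>t\<close> are conjugate in \<open>W\<close>; comparing
  lengths in \<open>tu = us\<close> yields equal weights.\<close>

lemma weight_same_wall:
  assumes L: "weight_function P L"
    and s: "s \<in> simple_gens P" and t: "t \<in> simple_gens P"
    and A: "A \<in> alcoves P" "s A = reflection H ` A" and B: "B \<in> alcoves P" "t B = reflection H ` B"
    and H: "H \<in> hyperplanes P"
  shows "L s = L t"
proof -
  have sW: "s \<in> W" and tW: "t \<in> W" using s t simple_gens_W by auto
  obtain u where u: "u \<in> W" "B = u A" using W_transitive[OF A(1) B(1)] by blast
  have "(t \<bullet>\<^sub>W u) A = t B" using W_mult_apply[OF tW u(1) A(1)] u(2) by simp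
  also have "\<dots> = u (reflection H ` A)"
    using W_Omega[OF u(1) A(1) reflection_in_Omega[OF H]] u(2) B(2) by simp
  also have "\<dots> = (u \<bullet>\<^sub>W s) A" using W_mult_apply[OF u(1) sW A(1)] A(2) by simp
  finally have tu: "t \<bullet>\<^sub>W u = u \<bullet>\<^sub>W s"
    by (rule W_free[OF Wgrp.m_closed[OF tW u(1)] Wgrp.m_closed[OF u(1) sW] A(1)])
  have add: "L (v \<bullet>\<^sub>W w) = L v + L w" if "v \<in> W" "w \<in> W"
      "weyl_length P (v \<bullet>\<^sub>W w) = weyl_length P v + weyl_length P w" for v w
    using L that unfolding weight_function_def by blast
  have usW: "u \<bullet>\<^sub>W s \<in> W" using u(1) sW by simp
  from weyl_length_right_cases[OF s u(1)] show ?thesis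
  proof
    assume l: "weyl_length P (u \<bullet>\<^sub>W s) = Suc (weyl_length P u)"
    have "L (u \<bullet>\<^sub>W s) = L u + L s" by (rule add[OF u(1) sW]) (simp add: l weyl_length_simple[OF s])
    moreover have "L (t \<bullet>\<^sub>W u) = L t + L u" by (rule add[OF tW u(1)]) (simp add: tu l weyl_length_simple[OF t])
    ultimately show ?thesis using tu by simp
  next
    assume l: "weyl_length P u = Suc (weyl_length P (u \<bullet>\<^sub>W s))"
    have u1: "u \<bullet>\<^sub>W s \<bullet>\<^sub>W s = u" using simple_gen_cancel_right[OF s u(1)] .
    have u2: "t \<bullet>\<^sub>W (u \<bullet>\<^sub>W s) = u" using simple_gen_cancel_left[OF t u(1)] tu by simp
    have "L (u \<bullet>\<^sub>W s \<bullet>\<^sub>W s) = L (u \<bullet>\<^sub>W s) + L s"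
      by (rule add[OF usW sW]) (simp add: u1 l weyl_length_simple[OF s])
    moreover have "L (t \<bullet>\<^sub>W (u \<bullet>\<^sub>W s)) = L t + L (u \<bullet>\<^sub>W s)"
      by (rule add[OF tW usW]) (simp add: u2 l weyl_length_simple[OF t])
    ultimately show ?thesis using u1 u2 by simp
  qed
qed

lemma hyp_weight_eq:
  assumes L: "weight_function P L" and t: "t \<in> face_types P" and F: "F \<in> t" "affine hull F = H"
  shows "hyp_weight P L H = L (type_invol P t)"
  unfolding hyp_weight_def
proof (rule the_equality)
  show "\<exists>s\<in>face_types P. \<exists>F\<in>s. affine hull F = H \<and> L (type_invol P t) = L (type_invol P s)"
    using t F by blast
next
  fix c assume "\<exists>s\<in>face_types P. \<exists>F\<in>s. affine hull F = H \<and> c = L (type_invol P s)"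
  then obtain s G where s: "s \<in> face_types P" "G \<in> s" "affine hull G = H" "c = L (type_invol P s)" by blast
  obtain A where A: "A \<in> alcoves P" "F facet_of closure A" using type_member_facet[OF t F(1)] .
  obtain B where B: "B \<in> alcoves P" "G facet_of closure B" using type_member_facet[OF s(1,2)] .
  have H: "H \<in> hyperplanes P" using walls_hyperplanes[OF A(1)] wallsI[OF A(2)] F(2) by blast
  have "L (type_invol P t) = L (type_invol P s)"
  proof (rule weight_same_wall[OF L _ _ A(1) _ B(1) _ H])
    show "type_invol P t A = reflection H ` A" using type_invol_eq[OF t A(1) F(1) A(2)] F(2) by simp
    show "type_invol P s B = reflection H ` B" using type_invol_eq[OF s(1) B(1) s(2) B(2)] s(3) by simp
  qed (use s t in \<open>simp_all add: simple_gens_def\<close>)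
  then show "c = L (type_invol P t)" using s(4) by simp
qed

text \<open>A reflection taking B to its neighbour sB is the one in their common wall, because no
  other hyperplane separates the two.\<close>

lemma hyp_weight_simple_gen:
  assumes L: "weight_function P L" and s: "s \<in> simple_gens P" and B: "B \<in> alcoves P"
    and H: "H \<in> hyperplanes P" "s B = reflection H ` B"
  shows "hyp_weight P L H = L s"
proof -
  obtain K t F where K: "K \<in> walls B" "s B = reflection K ` B"
    "t \<in> face_types P" "s = type_invol P t" "F \<in> t" "affine hull F = K"
    using simple_gen_wall[OF s B] .
  have "H \<in> separating P B (s B)" unfolding H(2) by (rule separating_reflection[OF H(1) B])
  then have "H = K" unfolding K(2) using separating_across_wall[OF B K(1)] by simp
  then show ?thesis using hyp_weight_eq[OF L K(3,5,6)] K(4) by simp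
qed

lemma hyp_weight_wall:
  assumes L: "weight_function P L" and A: "A \<in> alcoves P" and K: "K \<in> walls A"
  obtains s where "s \<in> simple_gens P" "hyp_weight P L K = L s"
proof -
  obtain s where s: "s \<in> simple_gens P" "s A = reflection K ` A" using wall_simple_gen[OF K A] .
  show thesis
    using that[OF s(1)] hyp_weight_simple_gen[OF L s(1) A _ s(2)] walls_hyperplanes[OF A] K by blast
qed

text \<open>Reflecting a face keeps it in its orbit, so its type and with it the weight of its
  hyperplane are preserved.\<close>

lemma hyp_weight_reflection:
  assumes L: "weight_function P L" and A: "A \<in> alcoves P" and K: "K \<in> walls A" and H: "H \<in> hyperplanes P"
  shows "hyp_weight P L (reflection H ` K) = hyp_weight P L K"
proof -
  obtain F where F: "F facet_of closure A" "K = affine hull F" using K by (auto simp: walls_def)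
  obtain t where t: "t \<in> face_types P" "F \<in> t" using facet_has_type[OF A F(1)] .
  have "affine hull (reflection H ` F) = reflection H ` K" using reflection_affine_hull[OF H] F(2) by simp
  then show ?thesis
    using hyp_weight_eq[OF L t(1) Omega_image_in_type[OF t reflection_in_Omega[OF H]]]
      hyp_weight_eq[OF L t(1,2) F(2)[symmetric]] by simp
qed

end

section \<open>Directions\<close>

lemma arefl_parallel:
  assumes "affine_parallel S T" shows "affine_parallel (arefl \<alpha> n ` S) (arefl \<alpha> n ` T)"
proof -
  obtain a where a: "T = (\<lambda>x. a + x) ` S" using assms by (auto simp: affine_parallel_def)
  have e: "arefl \<alpha> n (a + x) = (a - coroot \<alpha> a *\<^sub>R \<alpha>) + arefl \<alpha> n x" for x
    by (simp add: arefl_def coroot_add algebra_simps)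
  have "arefl \<alpha> n ` T = (\<lambda>x. (a - coroot \<alpha> a *\<^sub>R \<alpha>) + x) ` arefl \<alpha> n ` S"
    unfolding a image_image e ..
  then show ?thesis unfolding affine_parallel_def by blast
qed

text \<open>The translation between the hyperplanes forces \<open>coroot \<beta>\<close> to vanish
  on the kernel of \<open>coroot \<alpha>\<close>, so the two are proportional; evaluation at
  \<alpha>, where \<open>coroot \<alpha>\<close> is 2, gives the factor. It may differ from 1 and
  -1, since non-reduced root systems are allowed.\<close>

lemma parallel_hyperplanes:
  assumes "\<alpha> \<noteq> 0" "\<beta> \<noteq> 0" "affine_parallel (hyperplane \<alpha> n) (hyperplane \<beta> m)"
  obtains c where "c \<noteq> 0" "\<And>x. coroot \<beta> x = c * coroot \<alpha> x"
proof -
  obtain a where a: "hyperplane \<beta> m = (\<lambda>x. a + x) ` hyperplane \<alpha> n"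
    using assms(3) by (auto simp: affine_parallel_def)
  define p where "p = (n / 2) *\<^sub>R \<alpha>"
  have p: "coroot \<alpha> p = n" using assms(1) by (simp add: p_def coroot_scale coroot_self)
  have mem: "coroot \<beta> (a + x) = m" if "coroot \<alpha> x = n" for x
  proof -
    have "a + x \<in> hyperplane \<beta> m" unfolding a using that by (simp add: hyperplane_def)
    then show ?thesis by (simp add: hyperplane_def)
  qed
  have ker: "coroot \<beta> x = 0" if "coroot \<alpha> x = 0" for x
    using mem[of "p + x"] mem[of p] p that by (simp add: coroot_add)
  define c where "c = coroot \<beta> \<alpha> / 2"
  have c: "coroot \<beta> x = c * coroot \<alpha> x" for x
  proof -
    have "coroot \<alpha> (x - (coroot \<alpha> x / 2) *\<^sub>R \<alpha>) = 0"
      using assms(1) by (simp add: coroot_diff coroot_scale coroot_self)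
    from ker[OF this] show ?thesis by (simp add: c_def coroot_diff coroot_scale)
  qed
  have "c \<noteq> 0" using c[of \<beta>] coroot_self[OF assms(2)] by auto
  then show thesis using that c by blast
qed

lemma parallel_same_root:
  assumes "\<alpha> \<noteq> 0" shows "affine_parallel (hyperplane \<alpha> n) (hyperplane \<alpha> m)"
proof -
  let ?a = "((real_of_int m - real_of_int n) / 2) *\<^sub>R \<alpha>"
  have c: "coroot \<alpha> ?a = m - n" using assms by (simp add: coroot_scale coroot_self)
  have "x \<in> hyperplane \<alpha> n \<longleftrightarrow> ?a + x \<in> hyperplane \<alpha> m" for x
    by (simp add: hyperplane_def coroot_add c)
  then show ?thesis unfolding affine_parallel_expl by blast
qed

context affine_arrangement begin

interpretation Wgrp: group "affine_weyl P" by (rule group_affine_weyl)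

lemma direction_eq_iff:
  assumes "H \<in> hyperplanes P" "K \<in> hyperplanes P"
  shows "direction P H = direction P K \<longleftrightarrow> affine_parallel H K"
proof
  assume "direction P H = direction P K"
  moreover have "K \<in> direction P K" using assms affine_parallel_reflex by (simp add: direction_def)
  ultimately have "K \<in> direction P H" by simp
  then show "affine_parallel H K" by (simp add: direction_def)
next
  assume p: "affine_parallel H K"
  then have "affine_parallel K H" by (rule affine_parallel_commute)
  then have "affine_parallel H J \<longleftrightarrow> affine_parallel K J" for J using p affine_parallel_assoc by blast
  then show "direction P H = direction P K" by (simp add: direction_def)
qed

lemma finite_directions: "finite (directions P)"
proof -
  have "directions P \<subseteq> (\<lambda>\<alpha>. direction P (hyperplane \<alpha> 0)) ` P"
  proof
    fix i assume "i \<in> directions P"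
    then obtain \<alpha> n where i: "\<alpha> \<in> P" "i = direction P (hyperplane \<alpha> n)"
      by (auto simp: directions_def hyperplanes_def)
    have \<alpha>: "\<alpha> \<in> \<Phi>" using i positive_subset by blast
    have "direction P (hyperplane \<alpha> n) = direction P (hyperplane \<alpha> 0)"
      unfolding direction_eq_iff[OF hyperplane_in[OF \<alpha>] hyperplane_in[OF \<alpha>]]
      by (rule parallel_same_root[OF root_nonzero[OF \<alpha>]])
    then show "i \<in> (\<lambda>\<alpha>. direction P (hyperplane \<alpha> 0)) ` P" using i by blast
  qed
  then show ?thesis by (rule finite_subset) (simp add: finite_positive)
qed

text \<open>Reflections thus act on directions; this is the involution over whose orbits the weights
  are compared.\<close>

lemma direction_reflection:
  assumes H: "H \<in> hyperplanes P" and K: "K \<in> hyperplanes P"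
  shows "direction P (reflection H ` K) = (`) (reflection H) ` direction P K"
proof -
  have par: "affine_parallel (reflection H ` S) (reflection H ` T)" if "affine_parallel S T" for S T
    using reflectionE[OF H] arefl_parallel[OF that] by metis
  show ?thesis
  proof (intro equalityI subsetI)
    fix J assume "J \<in> direction P (reflection H ` K)"
    then have J: "J \<in> hyperplanes P" "affine_parallel (reflection H ` K) J" by (auto simp: direction_def)
    have "affine_parallel K (reflection H ` J)"
      using par[OF J(2)] unfolding reflection_image_image[OF H] .
    then have "reflection H ` J \<in> direction P K"
      using reflection_image_hyperplane[OF H J(1)] by (simp add: direction_def)
    then show "J \<in> (`) (reflection H) ` direction P K"
      using reflection_image_image[OF H, of J] by (intro image_eqI[of _ _ "reflection H ` J"]) (rule sym, assumption+)
  next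
    fix J assume "J \<in> (`) (reflection H) ` direction P K"
    then obtain I where "I \<in> hyperplanes P" "affine_parallel K I" "J = reflection H ` I"
      unfolding direction_def by blast
    then show "J \<in> direction P (reflection H ` K)"
      using par[of K I] reflection_image_hyperplane[OF H] by (simp add: direction_def)
  qed
qed

section \<open>The exchange of separating hyperplanes\<close>

text \<open>Passing to the opposite root normalises the sign at \<open>b\<close>. With all
  functionals positive on B, separation from B means being negative.\<close>

lemma positive_equation:
  assumes "K \<in> hyperplanes P" "B \<in> alcoves P" "b \<in> B"
  obtains \<beta> m where "\<beta> \<in> \<Phi>" "K = hyperplane \<beta> m" "0 < coroot \<beta> b - of_int m"
proof -
  obtain \<beta> m where \<beta>: "\<beta> \<in> \<Phi>" "K = hyperplane \<beta> m" using hyperplanesE[OF assms(1)] .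
  have "coroot \<beta> b \<noteq> m" using alcove_off[OF assms(2,3) \<beta>(1)] .
  then consider "coroot \<beta> b - m > 0" | "coroot (- \<beta>) b - of_int (- m) > 0"
    by (fastforce simp: coroot_uminus)
  then show thesis using that \<beta> root_uminus[OF \<beta>(1)] hyperplane_uminus[of \<beta> m] by cases metis+
qed

text \<open>In the application \<open>A = A\<^sub>0\<close>, \<open>B = yA\<^sub>0\<close>, \<open>C = xyA\<^sub>0\<close>, and \<open>H\<close> is the wall of \<open>B\<close> of type \<open>s\<close>,
  where \<open>x = us\<close> is reduced and \<open>sy < y\<close>.  Then \<open>uyA\<^sub>0\<close> is the mirror image of \<open>C\<close> in \<open>H\<close>, so that
  \<open>H\<^sub>x\<^sub>,\<^sub>y\<close> is the set \<open>unfolded\<close> and \<open>H\<^sub>u\<^sub>,\<^sub>y\<close> the set \<open>folded\<close> below.\<close>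

context
  fixes A B C H
  assumes A: "A \<in> alcoves P" and B: "B \<in> alcoves P" and C: "C \<in> alcoves P"
    and wall: "H \<in> walls B" and HAB: "H \<in> separating P A B" and HBC: "H \<in> separating P B C"
begin

definition unfolded :: "'a set set" where
  "unfolded = separating P A B \<inter> separating P B C"

definition folded :: "'a set set" where
  "folded = separating P A B \<inter> separating P B (reflection H ` C)"

lemma Hh: "H \<in> hyperplanes P"
  using separating_hyperplane[OF HAB] .

lemma H_not_folded: "H \<notin> folded"
proof -
  have C': "reflection H ` C \<in> alcoves P" using reflection_alcove[OF Hh C] .
  have "H \<in> separating P C (reflection H ` C)" using separating_reflection[OF Hh C] .
  then have "H \<notin> separating P B (reflection H ` C)" using separating_symdiff[OF B C C', of H] HBC by blast
  then show ?thesis by (simp add: folded_def)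
qed

lemma folding_coordinates:
  obtains \<alpha> n a b c where "\<alpha> \<in> \<Phi>" "H = hyperplane \<alpha> n" "a \<in> A" "b \<in> B" "c \<in> C"
    "coroot \<alpha> a - of_int n < 0" "0 < coroot \<alpha> b - of_int n" "coroot \<alpha> c - of_int n < 0"
    "\<forall>x. reflection H x = x - (coroot \<alpha> x - of_int n) *\<^sub>R \<alpha>"
proof -
  obtain a b c where abc: "a \<in> A" "b \<in> B" "c \<in> C" using A B C alcove_point by metis
  obtain \<alpha> n where \<alpha>: "\<alpha> \<in> \<Phi>" "H = hyperplane \<alpha> n" "0 < coroot \<alpha> b - of_int n"
    using positive_equation[OF Hh B abc(2)] .
  have "coroot \<alpha> a - of_int n < 0"
    using HAB separating_iff[OF A B abc(1,2) \<alpha>(1), of n] \<alpha>(2,3) by (simp add: mult_less_0_iff)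
  moreover have "coroot \<alpha> c - of_int n < 0"
    using HBC separating_iff[OF B C abc(2,3) \<alpha>(1), of n] \<alpha>(2,3) by (simp add: mult_less_0_iff)
  moreover have "reflection H x = x - (coroot \<alpha> x - of_int n) *\<^sub>R \<alpha>" for x
    using reflection_hyperplane[OF root_nonzero[OF \<alpha>(1)], of n] \<alpha>(2) by (simp add: arefl_def)
  ultimately show thesis using that \<alpha> abc by blast
qed

text \<open>H is the only hyperplane between B and its mirror image, so the functional of K stays
  positive at the mirror image of b. Hence both K and its mirror image can be tested against B by
  negative signs at a, c and their mirror images.\<close>

lemma equation_signs:
  assumes K: "K \<in> separating P A B" "K \<noteq> H" and \<beta>: "\<beta> \<in> \<Phi>" "K = hyperplane \<beta> m"
    and abc: "a \<in> A" "b \<in> B" "c \<in> C" and pos: "0 < coroot \<beta> b - of_int m"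
  shows "coroot \<beta> a - of_int m < 0" "0 < coroot \<beta> (reflection H b) - of_int m"
    "K \<in> unfolded \<longleftrightarrow> coroot \<beta> c - of_int m < 0"
    "K \<in> folded \<longleftrightarrow> coroot \<beta> (reflection H c) - of_int m < 0"
    "reflection H ` K \<in> unfolded \<longleftrightarrow>
       coroot \<beta> (reflection H a) - of_int m < 0 \<and> coroot \<beta> (reflection H c) - of_int m < 0"
    "coroot \<beta> c - of_int m \<noteq> 0"
proof -
  note rA = reflection_alcove[OF Hh A] and rB = reflection_alcove[OF Hh B] and rC = reflection_alcove[OF Hh C]
  note ra = imageI[OF abc(1), of "reflection H"] and rb = imageI[OF abc(2), of "reflection H"]
    and rc = imageI[OF abc(3), of "reflection H"]
  have Kh: "K \<in> hyperplanes P" using separating_hyperplane[OF K(1)] .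
  have "K \<notin> separating P B (reflection H ` B)" using separating_across_wall[OF B wall] K(2) by simp
  then have "\<not> (coroot \<beta> b - m) * (coroot \<beta> (reflection H b) - m) < 0"
    using separating_iff[OF B rB abc(2) rb \<beta>(1), of m] \<beta>(2) by simp
  moreover have "coroot \<beta> (reflection H b) \<noteq> m" using alcove_off[OF rB rb \<beta>(1)] .
  ultimately show rbpos: "0 < coroot \<beta> (reflection H b) - of_int m"
    using pos by (auto simp: mult_less_0_iff)
  show "coroot \<beta> a - of_int m < 0"
    using K(1) separating_iff[OF A B abc(1,2) \<beta>(1), of m] \<beta>(2) pos by (simp add: mult_less_0_iff)
  show "K \<in> unfolded \<longleftrightarrow> coroot \<beta> c - of_int m < 0"
    using K(1) separating_iff[OF B C abc(2,3) \<beta>(1), of m] \<beta>(2) pos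
    by (simp add: unfolded_def mult_less_0_iff)
  show "K \<in> folded \<longleftrightarrow> coroot \<beta> (reflection H c) - of_int m < 0"
    using K(1) separating_iff[OF B rC abc(2) rc \<beta>(1), of m] \<beta>(2) pos
    by (simp add: folded_def mult_less_0_iff)
  have sep: "reflection H ` K \<in> separating P X Y \<longleftrightarrow> K \<in> separating P (reflection H ` X) (reflection H ` Y)"
    if "X \<in> alcoves P" "Y \<in> alcoves P" for X Y
    using reflection_separating[OF Hh reflection_alcove[OF Hh that(1)] reflection_alcove[OF Hh that(2)] Kh]
    unfolding reflection_image_image[OF Hh] .
  have "reflection H ` K \<in> separating P A B \<longleftrightarrow> coroot \<beta> (reflection H a) - of_int m < 0"
    unfolding sep[OF A B] using separating_iff[OF rA rB ra rb \<beta>(1), of m] \<beta>(2) rbpos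
    by (simp add: mult_less_0_iff)
  moreover have "reflection H ` K \<in> separating P B C \<longleftrightarrow> coroot \<beta> (reflection H c) - of_int m < 0"
    unfolding sep[OF B C] using separating_iff[OF rB rC rb rc \<beta>(1), of m] \<beta>(2) rbpos
    by (simp add: mult_less_0_iff)
  ultimately show "reflection H ` K \<in> unfolded \<longleftrightarrow>
       coroot \<beta> (reflection H a) - of_int m < 0 \<and> coroot \<beta> (reflection H c) - of_int m < 0"
    by (simp add: unfolded_def)
  show "coroot \<beta> c - of_int m \<noteq> 0" using alcove_off[OF C abc(3) \<beta>(1), of m] by simp
qed

text \<open>Let k and h be the functionals of K and H; the reflection lowers k by h times \<mu>. At
  c it takes k from positive to negative, and h < 0 there, so \<mu> < 0. Since h < 0 at a too, k
  also drops at a, where it was negative already.\<close>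

lemma folded_or_reflected:
  assumes K: "K \<in> folded" "K \<notin> unfolded" shows "reflection H ` K \<in> unfolded"
proof -
  have KAB: "K \<in> separating P A B" using K(1) by (simp add: folded_def)
  have KH: "K \<noteq> H" using K(1) H_not_folded by blast
  obtain \<alpha> n a b c where \<alpha>: "\<alpha> \<in> \<Phi>" "H = hyperplane \<alpha> n" and abc: "a \<in> A" "b \<in> B" "c \<in> C"
    and h: "coroot \<alpha> a - of_int n < 0" "0 < coroot \<alpha> b - of_int n" "coroot \<alpha> c - of_int n < 0"
    and r: "\<forall>x. reflection H x = x - (coroot \<alpha> x - of_int n) *\<^sub>R \<alpha>"
    using folding_coordinates .
  obtain \<beta> m where \<beta>: "\<beta> \<in> \<Phi>" "K = hyperplane \<beta> m" "0 < coroot \<beta> b - of_int m"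
    using positive_equation[OF separating_hyperplane[OF KAB] B abc(2)] .
  note sg = equation_signs[OF KAB KH \<beta>(1,2) abc \<beta>(3)]
  define \<mu> where "\<mu> = coroot \<beta> \<alpha>"
  have k: "coroot \<beta> (reflection H x) - m = coroot \<beta> x - m - (coroot \<alpha> x - n) * \<mu>" for x
    by (simp add: r coroot_diff coroot_scale \<mu>_def)
  have "coroot \<beta> c - m > 0" using sg(3,6) K(2) by linarith
  moreover have rc: "coroot \<beta> (reflection H c) - m < 0" using sg(4) K(1) by blast
  ultimately have "(coroot \<alpha> c - n) * \<mu> > 0" unfolding k by linarith
  then have "\<mu> < 0" using h(3) by (simp add: zero_less_mult_iff)
  then have "(coroot \<alpha> a - n) * \<mu> > 0" using h(1) by (simp add: zero_less_mult_iff)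
  then have "coroot \<beta> (reflection H a) - m < 0" unfolding k using sg(1) by linarith
  then show ?thesis using sg(5) rc by blast
qed

text \<open>If \<open>K\<close> stays but a hyperplane \<open>M\<close> parallel to its mirror image has to be reflected, then the
  mirror image of \<open>K\<close> can be used instead of \<open>M\<close>.  This keeps the assignment of directions injective.\<close>

lemma folded_both:
  assumes K: "K \<in> folded" and M: "M \<in> folded" "M \<notin> unfolded"
    and par: "affine_parallel (reflection H ` K) M"
  shows "reflection H ` K \<in> unfolded"
proof -
  have KAB: "K \<in> separating P A B" and MAB: "M \<in> separating P A B" using K M by (simp_all add: folded_def)
  have KH: "K \<noteq> H" and MH: "M \<noteq> H" using K M H_not_folded by blast+
  obtain \<alpha> n a b c where \<alpha>: "\<alpha> \<in> \<Phi>" "H = hyperplane \<alpha> n" and abc: "a \<in> A" "b \<in> B" "c \<in> C"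
    and h: "coroot \<alpha> a - of_int n < 0" "0 < coroot \<alpha> b - of_int n" "coroot \<alpha> c - of_int n < 0"
    and r: "\<forall>x. reflection H x = x - (coroot \<alpha> x - of_int n) *\<^sub>R \<alpha>"
    using folding_coordinates .
  obtain \<beta> m where \<beta>: "\<beta> \<in> \<Phi>" "K = hyperplane \<beta> m" "0 < coroot \<beta> b - of_int m"
    using positive_equation[OF separating_hyperplane[OF KAB] B abc(2)] .
  obtain \<gamma> l where \<gamma>: "\<gamma> \<in> \<Phi>" "M = hyperplane \<gamma> l" "0 < coroot \<gamma> b - of_int l"
    using positive_equation[OF separating_hyperplane[OF MAB] B abc(2)] .
  note sk = equation_signs[OF KAB KH \<beta>(1,2) abc \<beta>(3)]
  note sm = equation_signs[OF MAB MH \<gamma>(1,2) abc \<gamma>(3)]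
  define k where "k x = coroot \<beta> x - m" for x
  define q where "q x = coroot \<gamma> x - l" for x
  define h where "h x = coroot \<alpha> x - n" for x
  define \<mu> where "\<mu> = coroot \<beta> \<alpha>"
  define \<nu> where "\<nu> = coroot \<gamma> \<alpha>"
  have kr: "k (reflection H x) = k x - h x * \<mu>" and qr: "q (reflection H x) = q x - h x * \<nu>" for x
    by (simp_all add: r coroot_diff coroot_scale k_def q_def h_def \<mu>_def \<nu>_def)
  have hs: "h a < 0" "0 < h b" "h c < 0" using \<open>coroot \<alpha> a - of_int n < 0\<close>
      \<open>0 < coroot \<alpha> b - of_int n\<close> \<open>coroot \<alpha> c - of_int n < 0\<close> by (simp_all add: h_def)
  have ks: "k a < 0" "k (reflection H c) < 0"
    using sk(1) sk(4) K by (simp_all add: k_def)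
  have "\<not> q c < 0" "q c \<noteq> 0" using sm(3,6) M(2) by (simp_all add: q_def)
  then have qs: "q a < 0" "q (reflection H c) < 0" "0 < q c"
    using sm(1) sm(4) M(1) by (simp_all add: q_def)
  obtain \<beta>' m' where \<beta>': "\<beta>' \<in> \<Phi>" "reflection H ` hyperplane \<beta> m = hyperplane \<beta>' m'"
    "\<And>x. coroot \<beta>' (reflection H x) - of_int m' = coroot \<beta> x - of_int m"
    using reflection_functional[OF Hh \<beta>(1), of m] by metis
  have k': "coroot \<beta>' x - m' = k (reflection H x)" for x
    using \<beta>'(3)[of "reflection H x"] reflection_reflection[OF Hh] by (simp add: k_def)
  have "affine_parallel (hyperplane \<beta>' m') (hyperplane \<gamma> l)"
    using par unfolding \<beta>(2) \<gamma>(2) \<beta>'(2) .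
  \<comment> \<open>The functionals of the parallel hyperplanes \<open>M\<close> and mirror image of
    \<open>K\<close> differ by the factor \<open>e\<close> and the constant \<open>d\<close>; the
    signs of both decide the cases below.\<close>
  then obtain e where e: "e \<noteq> 0" "\<And>x. coroot \<gamma> x = e * coroot \<beta>' x"
    using parallel_hyperplanes[OF root_nonzero[OF \<beta>'(1)] root_nonzero[OF \<gamma>(1)]] by blast
  define d where "d = e * m' - l"
  have q: "q x = e * k (reflection H x) + d" for x
    unfolding k'[symmetric] by (simp add: q_def e(2) d_def algebra_simps)
  have q': "q (reflection H x) = e * k x + d" for x
    using q[of "reflection H x"] reflection_reflection[OF Hh] by simp
  \<comment> \<open>Both sides are the value of \<open>q\<close> at the mirror image of
    \<open>b\<close>, once through \<open>k\<close> and once through the reflection formula for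
    \<open>q\<close>. As \<open>h b\<close> is nonzero, this compares the slopes.\<close>
  have "e * k b + d = e * (k b - h b * \<mu>) + d - h b * \<nu>"
    using qr[of b] unfolding q'[of b] q[of b] kr[of b] .
  then have "h b * (e * \<mu> + \<nu>) = 0" by (simp add: algebra_simps)
  then have e\<mu>: "e * \<mu> = - \<nu>" using hs(2) by (simp add: eq_neg_iff_add_eq_0)
  have "h c * \<nu> > 0" using qs(2,3) unfolding qr by linarith
  then have "\<nu> < 0" using hs(3) by (simp add: zero_less_mult_iff)
  then have pos: "e * \<mu> > 0" using e\<mu> by simp
  have "k (reflection H a) < 0"
  \<comment> \<open>For negative \<open>e\<close> the reflection lowers \<open>k\<close> at
    \<open>a\<close>, as in \<open>folded_or_reflected\<close>. For positive \<open>e\<close> the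
    signs at \<open>c\<close> force \<open>d > 0\<close>, and then \<open>q a < 0\<close> leaves
    only a negative value of \<open>k\<close> at the mirror image of \<open>a\<close>.\<close>
  proof (cases "e < 0")
    case True
    then have "\<mu> < 0" using pos by (simp add: zero_less_mult_iff)
    then have "h a * \<mu> > 0" using hs(1) by (simp add: zero_less_mult_iff)
    then show ?thesis unfolding kr using ks(1) by linarith
  next
    case False
    then have e0: "e > 0" using e(1) by linarith
    have "e * k (reflection H c) < 0" using e0 ks(2) by (simp add: mult_less_0_iff)
    then have "d > 0" using qs(3) unfolding q by linarith
    then have "e * k (reflection H a) < 0" using qs(1) unfolding q by linarith
    then show ?thesis using e0 by (simp add: mult_less_0_iff)
  qed
  then show ?thesis using sk(5) ks(2) by (simp add: k_def)
qed

text \<open>Here k = e * h + d, and k > 0 at b and at its mirror image, where h has opposite values;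
  adding gives d > 0. Then k is positive at the mirror image of c if e > 0 and at a if e < 0, while
  a folded hyperplane is negative at both.\<close>

lemma folded_not_parallel:
  assumes K: "K \<in> folded" shows "\<not> affine_parallel H K"
proof
  assume par: "affine_parallel H K"
  have KAB: "K \<in> separating P A B" using K(1) by (simp add: folded_def)
  have KH: "K \<noteq> H" using K(1) H_not_folded by blast
  obtain \<alpha> n a b c where \<alpha>: "\<alpha> \<in> \<Phi>" "H = hyperplane \<alpha> n" and abc: "a \<in> A" "b \<in> B" "c \<in> C"
    and hs: "coroot \<alpha> a - of_int n < 0" "0 < coroot \<alpha> b - of_int n" "coroot \<alpha> c - of_int n < 0"
    and r: "\<forall>x. reflection H x = x - (coroot \<alpha> x - of_int n) *\<^sub>R \<alpha>"
    using folding_coordinates .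
  obtain \<beta> m where \<beta>: "\<beta> \<in> \<Phi>" "K = hyperplane \<beta> m" "0 < coroot \<beta> b - of_int m"
    using positive_equation[OF separating_hyperplane[OF KAB] B abc(2)] .
  note sg = equation_signs[OF KAB KH \<beta>(1,2) abc \<beta>(3)]
  obtain e where e: "e \<noteq> 0" "\<And>x. coroot \<beta> x = e * coroot \<alpha> x"
    using parallel_hyperplanes[OF root_nonzero[OF \<alpha>(1)] root_nonzero[OF \<beta>(1)]] par \<alpha>(2) \<beta>(2) by blast
  define h where "h x = coroot \<alpha> x - n" for x
  define d where "d = e * n - m"
  have k: "coroot \<beta> x - m = e * h x + d" for x by (simp add: e(2) h_def d_def algebra_simps)
  have hr: "h (reflection H x) = - h x" for x
    by (simp add: h_def r coroot_diff coroot_scale coroot_self[OF root_nonzero[OF \<alpha>(1)]])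
  have h: "h a < 0" "0 < h b" "h c < 0" using hs by (simp_all add: h_def)
  have s: "e * h a + d < 0" "0 < e * h b + d" "0 < - (e * h b) + d" "- (e * h c) + d < 0"
    using sg(1) \<beta>(3) sg(2) sg(4) K unfolding k hr by simp_all
  show False
  proof (cases "e > 0")
    case True
    then have "e * h b > 0" "e * h c < 0" using h by (simp_all add: mult_less_0_iff)
    then show ?thesis using s by linarith
  next
    case False
    then have "e * h b < 0" "e * h a > 0" using h e(1) by (simp_all add: mult_less_0_iff zero_less_mult_iff)
    then show ?thesis using s by linarith
  qed
qed

end

end

section \<open>Comparison of the bounds\<close>

locale weighted_arrangement = affine_arrangement +
  fixes L :: "('a set \<Rightarrow> 'a set) \<Rightarrow> int"
  assumes weight: "weight_function P L"
    and weight_pos: "w \<in> carrier (affine_weyl P) \<Longrightarrow> w \<noteq> \<one>\<^bsub>affine_weyl P\<^esub> \<Longrightarrow> 0 < L w"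
begin

interpretation Wgrp: group "affine_weyl P" by (rule group_affine_weyl)

lemma simple_gen_weight_pos: assumes "s \<in> simple_gens P" shows "0 < L s"
proof (rule weight_pos)
  show "s \<in> W" using assms simple_gens_W by blast
  show "s \<noteq> \<one>\<^sub>W" using weyl_length_simple[OF assms] weyl_length_one by auto
qed

lemma hyp_weight_pos:
  assumes "A \<in> alcoves P" "B \<in> alcoves P" "K \<in> separating P A B" shows "0 < hyp_weight P L K"
proof -
  obtain D where "D \<in> alcoves P" "K \<in> walls D" using separating_is_wall[OF assms] by blast
  then obtain s where "s \<in> simple_gens P" "hyp_weight P L K = L s" using hyp_weight_wall[OF weight] by blast
  then show ?thesis using simple_gen_weight_pos by simp
qed

lemma hyp_weight_reflected:
  assumes "A \<in> alcoves P" "B \<in> alcoves P" "K \<in> separating P A B" "H \<in> hyperplanes P"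
  shows "hyp_weight P L (reflection H ` K) = hyp_weight P L K"
  using separating_is_wall[OF assms(1-3)] hyp_weight_reflection[OF weight _ _ assms(4)] by blast

text \<open>The inserted 0 lets a direction that does not occur in T contribute nothing, so that all
  sums can run over the same finite set of directions.\<close>

definition max_weight :: "'a set set \<Rightarrow> 'a set set \<Rightarrow> int" where
  "max_weight T i = Max (insert 0 {hyp_weight P L K | K. K \<in> T \<and> direction P K = i})"

lemma finite_weights: "finite T \<Longrightarrow> finite {hyp_weight P L K | K. K \<in> T \<and> direction P K = i}"
  by (rule finite_subset[of _ "hyp_weight P L ` T"]) auto

lemma max_weight_nonneg: "finite T \<Longrightarrow> 0 \<le> max_weight T i"
  unfolding max_weight_def using finite_weights by (intro Max_ge) auto

lemma max_weight_ge: "finite T \<Longrightarrow> K \<in> T \<Longrightarrow> direction P K = i \<Longrightarrow> hyp_weight P L K \<le> max_weight T i"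
  unfolding max_weight_def using finite_weights by (intro Max_ge) auto

lemma max_weight_cases:
  assumes "finite T"
  obtains "max_weight T i = 0" | K where "K \<in> T" "direction P K = i" "max_weight T i = hyp_weight P L K"
proof -
  have "max_weight T i \<in> insert 0 {hyp_weight P L K | K. K \<in> T \<and> direction P K = i}"
    unfolding max_weight_def using finite_weights[OF assms] by (intro Max_in) auto
  then show thesis using that by blast
qed

lemma max_weight_mono: "finite T \<Longrightarrow> S \<subseteq> T \<Longrightarrow> max_weight S i \<le> max_weight T i"
  unfolding max_weight_def using finite_weights by (intro Max_mono) auto

definition total_weight :: "'a set set \<Rightarrow> int" where
  "total_weight T = (\<Sum>i\<in>directions P. max_weight T i)"

lemma H_set_eq:
  assumes "x \<in> W" "y \<in> W"
  shows "H_set P x y = separating P (fundamental_alcove P) (y (fundamental_alcove P)) \<inter>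
    separating P (y (fundamental_alcove P)) (x (y (fundamental_alcove P)))"
  unfolding H_set_def using W_mult_apply[OF assms fundamental_alcove] by simp

lemma finite_H_set: "y \<in> W \<Longrightarrow> finite (H_set P x y)"
  unfolding H_set_def using finite_separating[OF fundamental_alcove W_alcove[OF _ fundamental_alcove]] by simp

text \<open>Separating hyperplanes have positive weight because L is positive on generators, so the
  0 in \<open>max_weight\<close> never changes a maximum over a direction that occurs.\<close>

lemma c_bound_total_weight:
  assumes y: "y \<in> W" shows "c_bound P L x y = total_weight (H_set P x y)"
proof -
  let ?S = "H_set P x y"
  have pos: "0 < hyp_weight P L K" if "K \<in> ?S" for K
    using hyp_weight_pos[OF fundamental_alcove W_alcove[OF y fundamental_alcove]] that unfolding H_set_def by blast
  have "(\<Sum>i\<in>I_set P x y. c_dir P L x y i) = (\<Sum>i\<in>I_set P x y. max_weight ?S i)"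
  proof (rule sum.cong[OF refl])
    fix i assume "i \<in> I_set P x y"
    then obtain K where K: "K \<in> ?S" "direction P K = i" by (auto simp: I_set_def)
    let ?X = "{hyp_weight P L K | K. K \<in> ?S \<and> direction P K = i}"
    have X: "finite ?X" "?X \<noteq> {}" "\<And>w. w \<in> ?X \<Longrightarrow> 0 < w"
      using finite_weights[OF finite_H_set[OF y]] K pos by auto
    then have "0 < Max ?X" using Max_in by blast
    then show "c_dir P L x y i = max_weight ?S i"
      unfolding c_dir_def max_weight_def Max_insert[OF X(1,2)] by simp
  qed
  also have "\<dots> = (\<Sum>i\<in>directions P. max_weight ?S i)"
  proof (rule sum.mono_neutral_left[OF finite_directions])
    show "I_set P x y \<subseteq> directions P" by (auto simp: I_set_def)
    show "\<forall>i\<in>directions P - I_set P x y. max_weight ?S i = 0"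
    proof
      fix i assume "i \<in> directions P - I_set P x y"
      then have "{hyp_weight P L K | K. K \<in> ?S \<and> direction P K = i} = {}" by (auto simp: I_set_def)
      then show "max_weight ?S i = 0" unfolding max_weight_def by (simp only: Max_singleton)
    qed
  qed
  finally show ?thesis by (simp add: c_bound_def total_weight_def)
qed

lemma total_weight_mono: "finite T \<Longrightarrow> S \<subseteq> T \<Longrightarrow> total_weight S \<le> total_weight T"
  unfolding total_weight_def by (intro sum_mono max_weight_mono)

lemma total_weight_nonneg: "finite T \<Longrightarrow> 0 \<le> total_weight T"
  unfolding total_weight_def by (intro sum_nonneg max_weight_nonneg)

context
  fixes A B C H
  assumes A: "A \<in> alcoves P" and B: "B \<in> alcoves P" and C: "C \<in> alcoves P"
    and wall: "H \<in> walls B" and HAB: "H \<in> separating P A B" and HBC: "H \<in> separating P B C"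
begin

text \<open>Take heaviest folded hyperplanes K in direction i and M in direction j, where they
  exist. Either both are kept in their own directions or both are replaced by their mirror images,
  which exchanges i and j; weights are preserved. The argument also covers i = j, where both sides
  are doubled.\<close>

lemma folded_pair_le:
  assumes i: "i \<in> directions P" and j_def: "j = (`) (reflection H) ` i"
  shows "max_weight (folded A B C H) i + max_weight (folded A B C H) j
    \<le> max_weight (unfolded A B C) i + max_weight (unfolded A B C) j"
proof -
  let ?F = "folded A B C H" and ?U = "unfolded A B C" and ?r = "(`) (reflection H)"
  note config = A B C wall HAB HBC
  have Hh: "H \<in> hyperplanes P" using separating_hyperplane[OF HAB] .
  have fin: "finite ?F" "finite ?U"
    using finite_separating[OF A B] by (simp_all add: folded_def[OF config] unfolded_def[OF config])
  have FAB: "K \<in> separating P A B" if "K \<in> ?F" for K using that by (simp add: folded_def[OF config])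
  have Kh: "K \<in> hyperplanes P" if "K \<in> ?F" for K using separating_hyperplane[OF FAB[OF that]] .
  have rw: "hyp_weight P L (?r K) = hyp_weight P L K" if "K \<in> ?F" for K
    using hyp_weight_reflected[OF A B FAB[OF that] Hh] .
  have rd: "direction P (?r K) = ?r ` direction P K" if "K \<in> ?F" for K
    using direction_reflection[OF Hh Kh[OF that]] .
  have rj: "?r ` j = i" unfolding j_def by (simp add: image_image reflection_reflection[OF Hh])
  note nonneg = max_weight_nonneg[OF fin(2), of i] max_weight_nonneg[OF fin(2), of j]
  have keep: "hyp_weight P L K \<le> max_weight ?U (direction P K)" if "K \<in> ?U" for K
    using max_weight_ge[OF fin(2) that] by simp
  have move: "hyp_weight P L K \<le> max_weight ?U (?r ` direction P K)" if "K \<in> ?F" "?r K \<in> ?U" for K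
    using max_weight_ge[OF fin(2) that(2) rd[OF that(1)]] rw[OF that(1)] by simp
  note refl1 = folded_or_reflected[OF config]
  note refl2 = folded_both[OF config]
  show ?thesis
  proof (rule max_weight_cases[OF fin(1), of i])
    assume i0: "max_weight ?F i = 0"
    show ?thesis
    proof (rule max_weight_cases[OF fin(1), of j])
      assume "max_weight ?F j = 0"
      then show ?thesis using i0 nonneg by linarith
    next
      fix M assume M: "M \<in> ?F" "direction P M = j" "max_weight ?F j = hyp_weight P L M"
      show ?thesis
      proof (cases "M \<in> ?U")
        case True
        then show ?thesis using keep[of M] M i0 nonneg by simp
      next
        case False
        then show ?thesis using move[OF M(1) refl1[OF M(1)]] M i0 nonneg rj by simp
      qed
    qed
  next
    fix K assume K: "K \<in> ?F" "direction P K = i" "max_weight ?F i = hyp_weight P L K"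
    show ?thesis
    proof (rule max_weight_cases[OF fin(1), of j])
      assume j0: "max_weight ?F j = 0"
      show ?thesis
      proof (cases "K \<in> ?U")
        case True
        then show ?thesis using keep[of K] K j0 nonneg by simp
      next
        case False
        then show ?thesis using move[OF K(1) refl1[OF K(1)]] K j0 nonneg by (simp add: j_def)
      qed
    next
      fix M assume M: "M \<in> ?F" "direction P M = j" "max_weight ?F j = hyp_weight P L M"
      have "direction P (?r K) = direction P M" using rd[OF K(1)] K(2) M(2) by (simp add: j_def)
      then have KM: "affine_parallel (?r K) M"
        using direction_eq_iff[OF reflection_image_hyperplane[OF Hh Kh[OF K(1)]] Kh[OF M(1)]] by simp
      have "direction P (?r M) = direction P K" using rd[OF M(1)] K(2) M(2) rj by simp
      then have MK: "affine_parallel (?r M) K"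
        using direction_eq_iff[OF reflection_image_hyperplane[OF Hh Kh[OF M(1)]] Kh[OF K(1)]] by simp
      show ?thesis
      proof (cases "K \<in> ?U \<and> M \<in> ?U")
        case True
        then show ?thesis using keep[of K] keep[of M] K M by simp
      next
        case False
        \<comment> \<open>If just one of the two has to be reflected, \<open>folded_both\<close>
          shows that the mirror image of the other is unfolded as well.\<close>
        then have "?r K \<in> ?U \<and> ?r M \<in> ?U"
          using refl1[OF K(1)] refl1[OF M(1)] refl2[OF K(1) M(1) _ KM] refl2[OF M(1) K(1) _ MK] by blast
        then show ?thesis using move[OF K(1)] move[OF M(1)] K M rj by (simp add: j_def)
      qed
    qed
  qed
qed

text \<open>The reflection permutes the directions other than that of H, so summing the inequality
  for pairs over all of them counts each total twice, and no representatives of orbits are needed.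
  The direction of H contributes 0 to the folded side and at least the weight of H to the unfolded
  side.\<close>

lemma total_weight_folded:
  "total_weight (folded A B C H) + hyp_weight P L H \<le> total_weight (unfolded A B C)"
proof -
  let ?F = "max_weight (folded A B C H)" and ?U = "max_weight (unfolded A B C)"
  let ?r = "(`) ((`) (reflection H))" and ?h = "direction P H"
  note config = A B C wall HAB HBC
  have Hh: "H \<in> hyperplanes P" using separating_hyperplane[OF HAB] .
  have fin: "finite (folded A B C H)" "finite (unfolded A B C)"
    using finite_separating[OF A B] by (simp_all add: folded_def[OF config] unfolded_def[OF config])
  let ?D = "directions P - {?h}"
  have rr: "?r (?r i) = i" for i by (simp add: image_image reflection_reflection[OF Hh])
  have rh: "?r ?h = ?h"
    using direction_reflection[OF Hh Hh] reflection_image_id[OF Hh order_refl] by simp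
  have rD: "?r i \<in> ?D" if i: "i \<in> ?D" for i
  proof -
    obtain K where K: "K \<in> hyperplanes P" "i = direction P K" using i by (auto simp: directions_def)
    have "?r i \<in> directions P"
      using direction_reflection[OF Hh K(1)] reflection_image_hyperplane[OF Hh K(1)] K(2)
      unfolding directions_def by (metis imageI)
    moreover have "?r i \<noteq> ?h" using rr[of i] rh i by auto
    ultimately show ?thesis by blast
  qed
  have bij: "bij_betw ?r ?D ?D" 
  proof (rule bij_betw_byWitness[where f'="?r"])
    show "\<forall>i\<in>?D. ?r (?r i) = i" "\<forall>i\<in>?D. ?r (?r i) = i" using rr by simp_all
    show "?r ` ?D \<subseteq> ?D" "?r ` ?D \<subseteq> ?D" by (rule image_subsetI, rule rD, assumption)+
  qed
  have shift: "(\<Sum>i\<in>?D. f (?r i)) = (\<Sum>i\<in>?D. f i)" for f :: "'a set set \<Rightarrow> int"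
    by (rule sum.reindex_bij_betw[OF bij])
  have "(\<Sum>i\<in>?D. ?F i + ?F (?r i)) \<le> (\<Sum>i\<in>?D. ?U i + ?U (?r i))"
    by (intro sum_mono folded_pair_le) auto
  then have le: "(\<Sum>i\<in>?D. ?F i) \<le> (\<Sum>i\<in>?D. ?U i)"
    unfolding sum.distrib shift[of ?F] shift[of ?U] by simp
  have hD: "?h \<in> directions P" using Hh by (auto simp: directions_def)
  have split: "(\<Sum>i\<in>directions P. f i) = f ?h + (\<Sum>i\<in>?D. f i)" for f :: "'a set set \<Rightarrow> int"
    by (rule sum.remove[OF finite_directions hD])
  have "?F ?h = 0"
  proof (rule max_weight_cases[OF fin(1), of ?h])
    fix K assume K: "K \<in> folded A B C H" "direction P K = ?h"
    have "K \<in> hyperplanes P" using K(1) separating_hyperplane by (auto simp: folded_def[OF config])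
    then have "affine_parallel H K" using direction_eq_iff[OF Hh] K(2) by metis
    then show ?thesis using folded_not_parallel[OF config K(1)] by blast
  qed
  moreover have "hyp_weight P L H \<le> ?U ?h"
    using HAB HBC by (intro max_weight_ge[OF fin(2)]) (simp_all add: unfolded_def[OF config])
  ultimately show ?thesis unfolding total_weight_def split[of ?F] split[of ?U] using le by linarith
qed

end

end

section \<open>The degree bound\<close>

text \<open>Bounding exponents instead of degrees covers zero coefficients, where
  \<open>laurent_degree\<close> has no meaning, and is stable under sums.\<close>

definition degree_le :: "'a hecke \<Rightarrow> int \<Rightarrow> bool" where
  "degree_le h c \<longleftrightarrow> (\<forall>z. \<forall>k\<in>Poly_Mapping.keys (Poly_Mapping.lookup h z). k \<le> c)"

lemma degree_le_mono: "degree_le h c \<Longrightarrow> c \<le> d \<Longrightarrow> degree_le h d"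
  unfolding degree_le_def by force

lemma degree_le_hecke_T: "0 \<le> c \<Longrightarrow> degree_le (hecke_T w) c"
  by (auto simp: degree_le_def hecke_T_def lookup_single when_def)

lemma degree_le_add: "degree_le g c \<Longrightarrow> degree_le h c \<Longrightarrow> degree_le (g + h) c"
proof -
  assume g: "degree_le g c" and h: "degree_le h c"
  have "k \<le> c" if k: "k \<in> Poly_Mapping.keys (Poly_Mapping.lookup (g + h) z)" for z k
  proof -
    have "k \<in> Poly_Mapping.keys (Poly_Mapping.lookup g z) \<union> Poly_Mapping.keys (Poly_Mapping.lookup h z)"
      using subsetD[OF Poly_Mapping.keys_add k[unfolded lookup_add]] .
    then show ?thesis using g h unfolding degree_le_def by blast
  qed
  then show ?thesis unfolding degree_le_def by blast
qed

lemma lookup_hecke_scale: "Poly_Mapping.lookup (hecke_scale a h) z = a * Poly_Mapping.lookup h z"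
  by (simp add: hecke_scale_def Poly_Mapping.map.rep_eq when_def)

lemma degree_le_scale:
  assumes "0 \<le> l" "degree_le h c"
  shows "degree_le (hecke_scale (v_power l - v_power (- l)) h) (c + l)"
proof -
  have k: "Poly_Mapping.keys (v_power l - v_power (- l)) \<subseteq> {l, - l}"
    using Poly_Mapping.keys_diff[of "v_power l" "v_power (- l)"] by (auto simp: v_power_def)
  have "k \<le> c + l" if "k \<in> Poly_Mapping.keys ((v_power l - v_power (- l)) * Poly_Mapping.lookup h z)" for k z
  proof -
    have "k \<in> {a + b | a b. a \<in> Poly_Mapping.keys (v_power l - v_power (- l))
        \<and> b \<in> Poly_Mapping.keys (Poly_Mapping.lookup h z)}"
      using keys_mult that by (rule subsetD)
    then obtain a b where "a \<in> Poly_Mapping.keys (v_power l - v_power (- l))"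
      "b \<in> Poly_Mapping.keys (Poly_Mapping.lookup h z)" "k = a + b"
      by blast
    moreover have "b \<le> c" using assms(2) calculation(2) unfolding degree_le_def by blast
    moreover have "a \<le> l" using k calculation(1) assms(1) by auto
    ultimately show ?thesis by linarith
  qed
  then show ?thesis unfolding degree_le_def lookup_hecke_scale by blast
qed

locale hecke_arrangement = weighted_arrangement +
  fixes mul :: "'a hecke \<Rightarrow> 'a hecke \<Rightarrow> 'a hecke"
  assumes mul: "hecke_multiplication P L mul"
begin

interpretation Wgrp: group "affine_weyl P" by (rule group_affine_weyl)

interpretation H: ring "hecke_ring P mul"
  using mul by (simp add: hecke_multiplication_def)

lemma hecke_carrier: "h \<in> carrier (hecke_ring P mul) \<longleftrightarrow> Poly_Mapping.keys h \<subseteq> W"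
  by (simp add: hecke_ring_def)

lemma hecke_T_carrier: "w \<in> W \<Longrightarrow> hecke_T w \<in> carrier (hecke_ring P mul)"
  by (simp add: hecke_carrier hecke_T_def)

lemma hecke_ops:
  "x \<otimes>\<^bsub>hecke_ring P mul\<^esub> y = mul x y" "x \<oplus>\<^bsub>hecke_ring P mul\<^esub> y = x + y"
  "\<one>\<^bsub>hecke_ring P mul\<^esub> = hecke_T \<one>\<^sub>W"
  by (simp_all add: hecke_ring_def)

lemma hecke_scale_carrier:
  "h \<in> carrier (hecke_ring P mul) \<Longrightarrow> hecke_scale a h \<in> carrier (hecke_ring P mul)"
proof -
  have "Poly_Mapping.keys (hecke_scale a h) \<subseteq> Poly_Mapping.keys h"
    by (auto simp: in_keys_iff lookup_hecke_scale)
  then show "h \<in> carrier (hecke_ring P mul) \<Longrightarrow> hecke_scale a h \<in> carrier (hecke_ring P mul)"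
    unfolding hecke_carrier by blast
qed

lemma mul_scale:
  assumes "g \<in> carrier (hecke_ring P mul)" "h \<in> carrier (hecke_ring P mul)"
  shows "mul g (hecke_scale a h) = hecke_scale a (mul g h)"
  using mul assms unfolding hecke_multiplication_def by blast

lemma mul_simple_up:
  assumes s: "s \<in> simple_gens P" and w: "w \<in> W" and "weyl_length P (s \<bullet>\<^sub>W w) = Suc (weyl_length P w)"
  shows "mul (hecke_T s) (hecke_T w) = hecke_T (s \<bullet>\<^sub>W w)"
proof -
  have "bruhat_less P w (s \<bullet>\<^sub>W w)" by (rule bruhat_less_simple[OF s w]) (simp add: assms(3))
  then show ?thesis using mul s w unfolding hecke_multiplication_def by blast
qed

lemma mul_simple_down:
  assumes s: "s \<in> simple_gens P" and w: "w \<in> W" and "weyl_length P w = Suc (weyl_length P (s \<bullet>\<^sub>W w))"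
  shows "mul (hecke_T s) (hecke_T w) =
    hecke_T (s \<bullet>\<^sub>W w) + hecke_scale (v_power (L s) - v_power (- L s)) (hecke_T w)"
proof -
  have "bruhat_less P (s \<bullet>\<^sub>W w) w" by (rule bruhat_less_simple'[OF s w]) (simp add: assms(3))
  then show ?thesis using mul s w unfolding hecke_multiplication_def by blast
qed

text \<open>Peel letters off the left end of u, where the defining relations apply.\<close>

lemma mul_reduced:
  assumes "u \<in> W" "w \<in> W" "weyl_length P (u \<bullet>\<^sub>W w) = weyl_length P u + weyl_length P w"
  shows "mul (hecke_T u) (hecke_T w) = hecke_T (u \<bullet>\<^sub>W w)"
  using assms(1,3)
proof (induction "weyl_length P u" arbitrary: u rule: less_induct)
  case less
  show ?case
  proof (cases "u = \<one>\<^sub>W")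
    case True
    then show ?thesis using H.l_one[OF hecke_T_carrier[OF assms(2)]] assms(2) by (simp add: hecke_ops)
  next
    case False
    then obtain v s where vs: "v \<in> W" "s \<in> simple_gens P" "u = s \<bullet>\<^sub>W v" "weyl_length P u = Suc (weyl_length P v)"
      using weyl_reduce_left[OF less.prems(1)] by blast
    have sW: "s \<in> W" using vs(2) simple_gens_W by blast
    have vw: "v \<bullet>\<^sub>W w \<in> W" using vs(1) assms(2) by simp
    have e: "u \<bullet>\<^sub>W w = s \<bullet>\<^sub>W (v \<bullet>\<^sub>W w)" using vs sW assms(2) by (simp add: Wgrp.m_assoc)
    have l1: "weyl_length P (v \<bullet>\<^sub>W w) \<le> weyl_length P v + weyl_length P w"
      using weyl_length_mult_le[OF vs(1) assms(2)] .
    \<comment> \<open>A letter raises the length by at most 1 and length is subadditive, so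
      additivity for \<open>u\<close> and \<open>w\<close> leaves no slack in either
      estimate.\<close>
    have l2: "weyl_length P (v \<bullet>\<^sub>W w) = weyl_length P v + weyl_length P w"
      "weyl_length P (s \<bullet>\<^sub>W (v \<bullet>\<^sub>W w)) = Suc (weyl_length P (v \<bullet>\<^sub>W w))"
      using weyl_length_left_cases[OF vs(2) vw] l1 less.prems(2) vs(4) unfolding e by linarith+
    have "mul (hecke_T u) (hecke_T w) = mul (mul (hecke_T s) (hecke_T v)) (hecke_T w)"
      using mul_simple_up[OF vs(2,1)] vs(3,4) by simp
    also have "\<dots> = mul (hecke_T s) (mul (hecke_T v) (hecke_T w))"
      using H.m_assoc[OF hecke_T_carrier[OF sW] hecke_T_carrier[OF vs(1)] hecke_T_carrier[OF assms(2)]]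
      by (simp only: hecke_ops)
    also have "\<dots> = hecke_T (s \<bullet>\<^sub>W (v \<bullet>\<^sub>W w))"
      using less.hyps[of v] vs l2 mul_simple_up[OF vs(2) vw] by simp
    finally show ?thesis unfolding e .
  qed
qed

lemma degree_le_mul:
  assumes "x \<in> W" "y \<in> W"
  shows "degree_le (mul (hecke_T x) (hecke_T y)) (c_bound P L x y)"
  using assms
\<comment> \<open>The hypothesis is applied to the pairs (u, sy) and (u, y), so \<open>y\<close> has
  to vary.\<close>
proof (induction "weyl_length P x" arbitrary: x y rule: less_induct)
  case less
  note x = less.prems(1) and y = less.prems(2)
  let ?A = "fundamental_alcove P"
  note A = fundamental_alcove
  show ?case
  proof (cases "x = \<one>\<^sub>W")
    case True
    have "mul (hecke_T x) (hecke_T y) = hecke_T y"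
      using H.l_one[OF hecke_T_carrier[OF y]] True by (simp add: hecke_ops)
    moreover have "0 \<le> c_bound P L x y"
      unfolding c_bound_total_weight[OF y] by (rule total_weight_nonneg[OF finite_H_set[OF y]])
    ultimately show ?thesis by (simp add: degree_le_hecke_T)
  next
    case False
    then obtain u s where us: "u \<in> W" "s \<in> simple_gens P" "x = u \<bullet>\<^sub>W s" "weyl_length P x = Suc (weyl_length P u)"
      using weyl_reduce_right[OF x] by blast
    have sW: "s \<in> W" using us(2) simple_gens_W by blast
    have sy: "s \<bullet>\<^sub>W y \<in> W" using sW y by simp
    define B where "B = y ?A"
    have B: "B \<in> alcoves P" using W_alcove[OF y A] by (simp add: B_def)
    define C where "C = x B"
    have C: "C \<in> alcoves P" using W_alcove[OF x B] by (simp add: C_def)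
    obtain H where H: "H \<in> walls B" "s B = reflection H ` B" using simple_gen_wall[OF us(2) B] by blast
    have Hh: "H \<in> hyperplanes P" using walls_hyperplanes[OF B] H by blast
    have sB: "s B \<in> alcoves P" using W_alcove[OF sW B] .
    have CuB: "C = u (s B)" unfolding C_def us(3) by (rule W_mult_apply[OF us(1) sW B])
    have "reflection H ` s B = B" unfolding H(2) by (rule reflection_image_image[OF Hh])
    \<comment> \<open>The action of \<open>u\<close> commutes with the reflection, and B is the
      mirror image of sB. This identifies \<open>H_set P u y\<close> with the folded set.\<close>
    then have uB: "u B = reflection H ` C"
      unfolding CuB using W_Omega[OF us(1) sB reflection_in_Omega[OF Hh]] by simp
    \<comment> \<open>Lengths are measured from the base alcove B: right multiplication by s
      shortens x, which says that the wall H of B is crossed on the way to xB.\<close>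
    have HBC: "H \<in> separating P B C"
      using weyl_length_right[OF B x us(2) H] us(4) simple_gen_cancel_right[OF us(2,1)]
      unfolding us(3) C_def by (auto split: if_splits)
    have Hx: "H_set P x y = separating P ?A B \<inter> separating P B C"
      using H_set_eq[OF x y] by (simp add: B_def C_def)
    have sBy: "(s \<bullet>\<^sub>W y) ?A = s B" using W_mult_apply[OF sW y A] by (simp add: B_def)
    \<comment> \<open>The pairs (x, y) and (u, sy) lead to the same last alcove C; only the middle
      alcove moves, across H.\<close>
    have Hus: "H_set P u (s \<bullet>\<^sub>W y) = separating P ?A (s B) \<inter> (separating P B C - {H})"
      using H_set_eq[OF us(1) sy] separating_step[OF B C H(1)] HBC unfolding sBy CuB[symmetric] H(2)[symmetric] by simp
    have Ts: "hecke_T s \<in> carrier (hecke_ring P mul)" and Tu: "hecke_T u \<in> carrier (hecke_ring P mul)"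
      and Ty: "hecke_T y \<in> carrier (hecke_ring P mul)" and Tsy: "hecke_T (s \<bullet>\<^sub>W y) \<in> carrier (hecke_ring P mul)"
      using hecke_T_carrier sW us(1) y sy by blast+
    have "mul (hecke_T u) (hecke_T s) = hecke_T x"
      using mul_reduced[OF us(1) sW] us(3,4) weyl_length_simple[OF us(2)] by simp
    then have xy: "mul (hecke_T x) (hecke_T y) = mul (hecke_T u) (mul (hecke_T s) (hecke_T y))"
      using H.m_assoc[OF Tu Ts Ty] by (simp only: hecke_ops)
    have lt: "weyl_length P u < weyl_length P x" using us(4) by simp
    note IH = less.hyps[OF lt us(1)]
    have cx: "c_bound P L x y = total_weight (H_set P x y)" using c_bound_total_weight[OF y] .
    have wl: "if H \<in> separating P ?A B then weyl_length P y = Suc (weyl_length P (s \<bullet>\<^sub>W y))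
        else weyl_length P (s \<bullet>\<^sub>W y) = Suc (weyl_length P y)"
      using weyl_length_left[OF A y us(2), of H] H unfolding B_def .
    show ?thesis
    proof (cases "H \<in> separating P ?A B")
      case False
      have "separating P ?A (s B) = insert H (separating P ?A B)"
        using separating_step_right[OF A B H(1)] False H(2) by simp
      \<comment> \<open>The sets could differ only in H, which lies in neither: it does not separate
        A_0 from B, and it was removed on the side of C.\<close>
      then have "H_set P u (s \<bullet>\<^sub>W y) = H_set P x y" unfolding Hus Hx using False by auto
      then have "c_bound P L u (s \<bullet>\<^sub>W y) = c_bound P L x y"
        unfolding c_bound_total_weight[OF sy] cx by simp
      moreover have "mul (hecke_T x) (hecke_T y) = mul (hecke_T u) (hecke_T (s \<bullet>\<^sub>W y))"
        using xy mul_simple_up[OF us(2) y] wl False by simp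
      ultimately show ?thesis using IH[OF sy] by simp
    next
      case True
      let ?\<xi> = "v_power (L s) - v_power (- L s)"
      have "separating P ?A (s B) = separating P ?A B - {H}"
        using separating_step_right[OF A B H(1)] True H(2) by simp
      then have "H_set P u (s \<bullet>\<^sub>W y) \<subseteq> H_set P x y" unfolding Hus Hx by auto
      then have "c_bound P L u (s \<bullet>\<^sub>W y) \<le> c_bound P L x y"
        unfolding c_bound_total_weight[OF sy] cx by (rule total_weight_mono[OF finite_H_set[OF y]])
      then have d1: "degree_le (mul (hecke_T u) (hecke_T (s \<bullet>\<^sub>W y))) (c_bound P L x y)"
        using degree_le_mono[OF IH[OF sy]] by simp
      note config = A B C H(1) True HBC
      have "H_set P u y = folded ?A B C H"
        using H_set_eq[OF us(1) y] by (simp add: B_def[symmetric] uB folded_def[OF config])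
      moreover have "H_set P x y = unfolded ?A B C" unfolding Hx unfolded_def[OF config] ..
      moreover have "hyp_weight P L H = L s" by (rule hyp_weight_simple_gen[OF weight us(2) B Hh H(2)])
      ultimately have "c_bound P L u y + L s \<le> c_bound P L x y"
        using total_weight_folded[OF config] unfolding c_bound_total_weight[OF y] by simp
      moreover have "degree_le (hecke_scale ?\<xi> (mul (hecke_T u) (hecke_T y))) (c_bound P L u y + L s)"
        using degree_le_scale[OF less_imp_le[OF simple_gen_weight_pos[OF us(2)]] IH[OF y]] .
      ultimately have d2: "degree_le (hecke_scale ?\<xi> (mul (hecke_T u) (hecke_T y))) (c_bound P L x y)"
        using degree_le_mono by blast
      have "mul (hecke_T x) (hecke_T y) = mul (hecke_T u) (hecke_T (s \<bullet>\<^sub>W y) + hecke_scale ?\<xi> (hecke_T y))"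
        using xy mul_simple_down[OF us(2) y] wl True by simp
      also have "\<dots> = mul (hecke_T u) (hecke_T (s \<bullet>\<^sub>W y)) + mul (hecke_T u) (hecke_scale ?\<xi> (hecke_T y))"
        using H.r_distr[OF Tsy hecke_scale_carrier[OF Ty] Tu] by (simp only: hecke_ops)
      also have "\<dots> = mul (hecke_T u) (hecke_T (s \<bullet>\<^sub>W y)) + hecke_scale ?\<xi> (mul (hecke_T u) (hecke_T y))"
        by (simp only: mul_scale[OF Tu Ty])
      finally show ?thesis using degree_le_add[OF d1 d2] by simp
    qed
  qed
qed

end

theorem theorem2p4:
  fixes \<Phi> P :: "'a::euclidean_space set"
    and L :: "('a set \<Rightarrow> 'a set) \<Rightarrow> int"
    and mul :: "'a hecke \<Rightarrow> 'a hecke \<Rightarrow> 'a hecke"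
    and x y z :: "'a set \<Rightarrow> 'a set"
  assumes "irreducible_root_system \<Phi>"
    and "positive_roots \<Phi> P"
    and "weight_function P L"
    and "normalized_weight P L"
    and "\<And>w. w \<in> carrier (affine_weyl P) \<Longrightarrow> w \<noteq> \<one>\<^bsub>affine_weyl P\<^esub> \<Longrightarrow> L w > 0"
    and "hecke_multiplication P L mul"
    and "x \<in> carrier (affine_weyl P)"
    and "y \<in> carrier (affine_weyl P)"
    and "z \<in> carrier (affine_weyl P)"
  shows "hecke_coeff mul x y z \<noteq> 0 \<longrightarrow> laurent_degree (hecke_coeff mul x y z) \<le> c_bound P L x y"
proof
  interpret hecke_arrangement \<Phi> P L mul
    using assms(1-6) by unfold_locales (simp_all add: irreducible_root_system_def)
  assume "hecke_coeff mul x y z \<noteq> 0"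
  moreover have "k \<le> c_bound P L x y" if "k \<in> Poly_Mapping.keys (hecke_coeff mul x y z)" for k
    using degree_le_mul[OF assms(7,8)] that unfolding degree_le_def hecke_coeff_def by blast
  ultimately show "laurent_degree (hecke_coeff mul x y z) \<le> c_bound P L x y"
    unfolding laurent_degree_def by (intro Max.boundedI) simp_all
qed

end
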